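(* Let $T>0$, $s\in(0,T)$, let $I,E\subset\{1,\dots,n\}$ with $|I|+|E|=n$, and let $J=I^c$, $F=E^c$ be their complements in $\{1,\dots,n\}$. Let $\mathbf{F}(\mathbf{x},t)=\mathbf{F}_0(\mathbf{x},t)$ for $t\in[0,s)$ and $\mathbf{F}(\mathbf{x},t)=\mathbf{F}_1(\mathbf{x},t)$ for $t\in(s,T]$. Let $\mathbf{x}:[0,T]\to\mathbb{R}^n$ be an absolutely continuous solution of $$\dot{\mathbf{x}}(t)=\mathbf{F}(\mathbf{x}(t),t)\ \text{for a.e. } t\in[0,T],\qquad \mathbf{x}_I(0)=\mathbf{b}_I,\qquad \mathbf{x}_E(T)=\mathbf{b}_E .$$ Suppose that the Dynamics Smoothness assumption (see context) holds at $\mathbf{x}$, that the objective $C:\mathbb{R}^n\to\mathbb{R}$ is continuously differentiable, and that both matrices $\mathbf{\Phi}_{EJ}(T)$ and $\mathbf{\Psi}_{FI}(T)$ (see context) are invertible. Then the objective, viewed as a function $C(s)$ of the switch point (see context), is differentiable at $s$ with $$\frac{\partial C}{\partial s}(s)=H_0(\mathbf{x}(s),\mathbf{p}(s),s)-H_1(\mathbf{x}(s),\mathbf{p}(s),s),$$ where $H_j(\mathbf{x},\mathbf{p},t)=\mathbf{p}\,\mathbf{F}_j(\mathbf{x},t)$ for $j=0,1$, and the row vector $\mathbf{p}:[0,T]\to\mathbb{R}^n$ is the (absolutely continuous) solution of the linear differential equation $$\dot{\mathbf{p}}(t)=-\mathbf{p}(t)\nabla_x\mathbf{F}(\mathbf{x}(t),t)\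 \text{ for a.e. } t\in[0,T],\qquad \mathbf{p}_F(T)=\nabla_F C(\mathbf{x}(T)),\qquad \mathbf{p}_J(0)=\mathbf{0}.$$
   Context: Notation. $\mathbf{b}_I$ and $\mathbf{b}_E$ are given vectors. For $\mathbf{x}\in\mathbb{R}^n$ and $S\subset\{1,\dots,n\}$, $\mathbf{x}_S$ is the subvector with components $x_i$, $i\in S$; for a matrix $\mathbf{A}$, $\mathbf{A}_{RS}$ is the submatrix with rows in $R$ and columns in $S$ (an empty square matrix counts as invertible). Since $|I|+|E|=n$, we have $|J|=|E|$ and $|F|=|I|$. $\|\cdot\|$ is any norm, and $\mathcal{B}_\rho(\mathbf{c})=\{\mathbf{y}:\|\mathbf{y}-\mathbf{c}\|\le\rho\}$. $\nabla_x$ denotes the Jacobian with respect to $\mathbf{x}$, with $(i,j)$ element $\partial F_i/\partial x_j$. $\nabla_F C$ is the row vector of partial derivatives of $C$ with respect to $x_i$, $i\in F$ (here the subscript $F$ is the index set $E^c$). Differential equations hold almost everywhere. Dynamics Smoothness. $\mathbf{F}_0$ and $\mathbf{F}_1$ are $\mathbb{R}^n$-valued functions of $(\mathbf{x},t)$, and there is $\rho>0$ (with $[s-\rho,s+\rho]\subset[0,T]$) such that, with $$\mathcal{T}_0=\{(\boldsymbol{\chi},t): t\in[0,s+\rho],\ \boldsymbol{\chi}\in\mathcal{B}_\rho(\mathbf{x}(t))\},\qquad \mathcal{T}_1=\{(\boldsymbol{\chi},t): t\in[s-\rho,T],\ \boldsymbol{\chi}\in\mathcal{B}_\rho(\mathbf{x}(t))\},$$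 for $j=0,1$: $\mathbf{F}_j$ is defined and continuously differentiable on $\mathcal{T}_j$, and $\mathbf{F}_j(\boldsymbol{\chi},t)$ is Lipschitz continuously differentiable in $\boldsymbol{\chi}$ on $\mathcal{T}_j$, uniformly in $t$, with Lipschitz constant $L$ (that is, $\nabla_x\mathbf{F}_j(\cdot,t)$ is Lipschitz with constant $L$ independent of $t$). Fundamental matrices. $\mathbf{\Phi},\mathbf{\Psi}:[0,T]\to\mathbb{R}^{n\times n}$ are the solutions of $$\dot{\mathbf{\Phi}}(t)=\nabla_x\mathbf{F}(\mathbf{x}(t),t)\mathbf{\Phi}(t),\ \mathbf{\Phi}(0)=\mathbf{I};\qquad \dot{\mathbf{\Psi}}(t)=-\nabla_x\mathbf{F}(\mathbf{x}(t),t)^{\mathsf T}\mathbf{\Psi}(t),\ \mathbf{\Psi}(0)=\mathbf{I},$$ where the initial value $\mathbf{I}$ is the $n\times n$ identity matrix. Objective as a function of the switch point. For $|\Delta s|\le\rho$ let $\mathbf{F}^+(\mathbf{x},t)=\mathbf{F}_0(\mathbf{x},t)$ for $t\in[0,s+\Delta s)$ and $\mathbf{F}^+(\mathbf{x},t)=\mathbf{F}_1(\mathbf{x},t)$ for $t\in(s+\Delta s,T]$. For $\Delta s$ in a neighborhood of $0$, let $\mathbf{x}^+$ (depending on $\Delta s$) be an absolutely continuous solution of the perturbed boundary-value problem $\dot{\mathbf{x}}(t)=\mathbf{F}^+(\mathbf{x}(t),t)$ a.e. on $[0,T]$, $\mathbf{x}_I(0)=\mathbf{b}_I$, $\mathbf{x}_E(T)=\mathbf{b}_E$,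 satisfying $\|\mathbf{x}^+_J(0)-\mathbf{x}_J(0)\|\le c|\Delta s|$ with $c$ independent of $\Delta s$; under the hypotheses of the theorem such solutions exist for all $\Delta s$ near $0$. Then $C(s+\Delta s):=C(\mathbf{x}^+(T))$, $C(s)=C(\mathbf{x}(T))$, and $$\frac{\partial C}{\partial s}(s)=\lim_{\Delta s\to0}\frac{C(\mathbf{x}^+(T))-C(\mathbf{x}(T))}{\Delta s}.$$ *)

theory Defs
  imports "HOL-Analysis.Analysis"
begin

definition is_norm :: "('a::real_vector \<Rightarrow> real) \<Rightarrow> bool" where
  "is_norm N \<longleftrightarrow>
     (\<forall>v. 0 \<le> N v) \<and> (\<forall>v. N v = 0 \<longleftrightarrow> v = 0) \<and>
     (\<forall>a v. N (a *\<^sub>R v) = \<bar>a\<bar> * N v) \<and>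
     (\<forall>v w. N (v + w) \<le> N v + N w)"

(* The closed ball with respect to an arbitrary norm; cball uses the built-in Euclidean one. *)
definition norm_cball :: "('a::real_vector \<Rightarrow> real) \<Rightarrow> 'a \<Rightarrow> real \<Rightarrow> 'a set" where
  "norm_cball N c r = {y. N (y - c) \<le> r}"

(* The subvector with components in S, extended by 0 so that its norm can be taken with the
   norm of the full space. *)
definition restrict_vec :: "'n set \<Rightarrow> real ^ 'n \<Rightarrow> real ^ 'n" where
  "restrict_vec S v = (\<chi> i. if i \<in> S then v $ i else 0)"

(* The submatrix with rows in R and columns in S has a two-sided inverse B, whose rows are indexed
   by S and whose columns are indexed by R.  For R = S = {} this holds trivially. *)
definition invertible_submatrix :: "'n set \<Rightarrow> 'n set \<Rightarrow> real ^ 'n ^ 'n \<Rightarrow> bool" where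
  "invertible_submatrix R S A \<longleftrightarrow>
     (\<exists>B :: 'n \<Rightarrow> 'n \<Rightarrow> real.
        (\<forall>i\<in>R. \<forall>k\<in>R. (\<Sum>j\<in>S. A $ i $ j * B j k) = (if i = k then 1 else 0)) \<and>
        (\<forall>j\<in>S. \<forall>l\<in>S. (\<Sum>i\<in>R. B j i * A $ i $ l) = (if j = l then 1 else 0)))"

definition absolutely_continuous_on :: "real set \<Rightarrow> (real \<Rightarrow> 'a::metric_space) \<Rightarrow> bool" where
  "absolutely_continuous_on S f \<longleftrightarrow>
     (\<forall>\<epsilon>>0. \<exists>\<delta>>0. \<forall>(m::nat) u v.
        (\<forall>k<m. u k \<le> v k \<and> {u k..v k} \<subseteq> S) \<and>
        (\<forall>k<m. \<forall>l<m. k \<noteq> l \<longrightarrow> {u k<..<v k} \<inter> {u l<..<v l} = {}) \<and>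
        (\<Sum>k<m. v k - u k) < \<delta>
        \<longrightarrow> (\<Sum>k<m. dist (f (u k)) (f (v k))) < \<epsilon>)"

definition ac_solution ::
    "real \<Rightarrow> ('a::real_normed_vector \<Rightarrow> real \<Rightarrow> 'a) \<Rightarrow> (real \<Rightarrow> 'a) \<Rightarrow> bool" where
  "ac_solution T G y \<longleftrightarrow>
     absolutely_continuous_on {0..T} y \<and>
     (AE t\<in>{0..T} in lebesgue. (y has_vector_derivative G (y t) t) (at t within {0..T}))"

definition bvp_solution ::
    "real \<Rightarrow> (real ^ 'n \<Rightarrow> real \<Rightarrow> real ^ 'n) \<Rightarrow> 'n set \<Rightarrow> 'n set \<Rightarrow> real ^ 'n \<Rightarrow> real ^ 'n
      \<Rightarrow> (real \<Rightarrow> real ^ 'n) \<Rightarrow> bool" where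
  "bvp_solution T G I E b\<^sub>I b\<^sub>E y \<longleftrightarrow>
     ac_solution T G y \<and> (\<forall>i\<in>I. y 0 $ i = b\<^sub>I $ i) \<and> (\<forall>i\<in>E. y T $ i = b\<^sub>E $ i)"

(* The value at the switch point itself is immaterial: differential equations hold a.e. *)
definition switched ::
    "('a \<Rightarrow> real \<Rightarrow> 'b) \<Rightarrow> ('a \<Rightarrow> real \<Rightarrow> 'b) \<Rightarrow> real \<Rightarrow> 'a \<Rightarrow> real \<Rightarrow> 'b" where
  "switched F\<^sub>0 F\<^sub>1 \<sigma> z t = (if t < \<sigma> then F\<^sub>0 z t else F\<^sub>1 z t)"

definition tube ::
    "('a::real_vector \<Rightarrow> real) \<Rightarrow> real set \<Rightarrow> (real \<Rightarrow> 'a) \<Rightarrow> real \<Rightarrow> ('a \<times> real) set" where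
  "tube N S x \<rho> = {(z, t). t \<in> S \<and> z \<in> norm_cball N (x t) \<rho>}"

(* On a set that is not open, derivatives are taken relative to the set. *)
definition continuously_differentiable_on ::
    "('a::real_normed_vector \<Rightarrow> 'b::real_normed_vector) \<Rightarrow> 'a set \<Rightarrow> bool" where
  "continuously_differentiable_on f S \<longleftrightarrow>
     (\<exists>f' :: 'a \<Rightarrow> 'a \<Rightarrow>\<^sub>L 'b.
        (\<forall>z\<in>S. (f has_derivative blinfun_apply (f' z)) (at z within S)) \<and> continuous_on S f')"

(* G z t is the Jacobian of F (_, t) at z; as the ball is convex with nonempty interior, the
   derivative relative to the ball is unique.  The difference of two Jacobians is measured in the
   matrix norm induced by N. *)
definition uniformly_lipschitz_jacobian_on_tube ::
    "(real ^ 'n \<Rightarrow> real) \<Rightarrow> real set \<Rightarrow> (real \<Rightarrow> real ^ 'n) \<Rightarrow> real \<Rightarrow> real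
      \<Rightarrow> (real ^ 'n \<Rightarrow> real \<Rightarrow> real ^ 'n) \<Rightarrow> bool" where
  "uniformly_lipschitz_jacobian_on_tube N S x \<rho> L F \<longleftrightarrow>
     (\<exists>G :: real ^ 'n \<Rightarrow> real \<Rightarrow> real ^ 'n ^ 'n.
        (\<forall>t\<in>S. \<forall>z\<in>norm_cball N (x t) \<rho>.
           ((\<lambda>y. F y t) has_derivative (\<lambda>h. G z t *v h)) (at z within norm_cball N (x t) \<rho>)) \<and>
        (\<forall>t\<in>S. \<forall>z\<in>norm_cball N (x t) \<rho>. \<forall>w\<in>norm_cball N (x t) \<rho>. \<forall>h.
           N ((G z t - G w t) *v h) \<le> L * N (z - w) * N h))"

definition dynamics_smoothness ::
    "(real ^ 'n \<Rightarrow> real) \<Rightarrow> real \<Rightarrow> real \<Rightarrow> (real \<Rightarrow> real ^ 'n) \<Rightarrow> (real ^ 'n \<Rightarrow> real \<Rightarrow> real ^ 'n)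
      \<Rightarrow> (real ^ 'n \<Rightarrow> real \<Rightarrow> real ^ 'n) \<Rightarrow> real \<Rightarrow> real \<Rightarrow> bool" where
  "dynamics_smoothness N T s x F\<^sub>0 F\<^sub>1 \<rho> L \<longleftrightarrow>
     0 < \<rho> \<and> {s - \<rho>..s + \<rho>} \<subseteq> {0..T} \<and>
     continuously_differentiable_on (\<lambda>(z, t). F\<^sub>0 z t) (tube N {0..s + \<rho>} x \<rho>) \<and>
     continuously_differentiable_on (\<lambda>(z, t). F\<^sub>1 z t) (tube N {s - \<rho>..T} x \<rho>) \<and>
     uniformly_lipschitz_jacobian_on_tube N {0..s + \<rho>} x \<rho> L F\<^sub>0 \<and>
     uniformly_lipschitz_jacobian_on_tube N {s - \<rho>..T} x \<rho> L F\<^sub>1"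

definition jacobian_along ::
    "(real ^ 'n \<Rightarrow> real \<Rightarrow> real ^ 'n) \<Rightarrow> (real \<Rightarrow> real ^ 'n) \<Rightarrow> real \<Rightarrow> real ^ 'n ^ 'n" where
  "jacobian_along F x t = jacobian (\<lambda>z. F z t) (at (x t))"

definition partial_derivative :: "(real ^ 'n \<Rightarrow> real) \<Rightarrow> 'n \<Rightarrow> real ^ 'n \<Rightarrow> real" where
  "partial_derivative f i z = deriv (\<lambda>h. f (z + h *\<^sub>R axis i 1)) 0"

(* The costate p is a row vector, hence multiplies matrices from the left. *)
definition costate ::
    "real \<Rightarrow> (real ^ 'n \<Rightarrow> real \<Rightarrow> real ^ 'n) \<Rightarrow> (real ^ 'n \<Rightarrow> real) \<Rightarrow> 'n set \<Rightarrow> 'n set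
      \<Rightarrow> (real \<Rightarrow> real ^ 'n) \<Rightarrow> (real \<Rightarrow> real ^ 'n) \<Rightarrow> bool" where
  "costate T G C J F x p \<longleftrightarrow>
     ac_solution T (\<lambda>q t. - (q v* jacobian_along G x t)) p \<and>
     (\<forall>i\<in>F. p T $ i = partial_derivative C i (x T)) \<and> (\<forall>i\<in>J. p 0 $ i = 0)"

definition hamiltonian ::
    "(real ^ 'n \<Rightarrow> real \<Rightarrow> real ^ 'n) \<Rightarrow> real ^ 'n \<Rightarrow> real ^ 'n \<Rightarrow> real \<Rightarrow> real" where
  "hamiltonian F z q t = q \<bullet> F z t"

end

theory Submission
  imports Defs
begin

text \<open>Write a perturbed trajectory as \<open>x + z\<close> and let \<open>r\<close> be what remains of \<open>z' = A z + r\<close> after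
  linearizing along \<open>x\<close>.  Since \<open>\<Psi>\<^sup>T \<Phi> = I\<close>, the function \<open>\<Psi>\<^sup>T z\<close> has derivative \<open>\<Psi>\<^sup>T r\<close>, so that
  \<open>z t = \<Phi> t (z 0 + \<integral>\<^sub>0\<^sup>t \<Psi>\<^sup>T r)\<close>.  The remainder has Lipschitz constant \<open>O(\<delta>)\<close> in \<open>z\<close> on the ball of
  radius \<open>\<delta>\<close>, except between the two switch points, an interval of length \<open>\<bar>\<sigma> - s\<bar>\<close>, where it is
  merely bounded and Lipschitz.  Choosing \<open>z 0\<close> by inverting \<open>\<Phi>\<^sub>E\<^sub>J(T)\<close> turns the perturbed boundary
  value problem into a fixed point problem for a contraction, and the same formula gives the a priori bound
  \<open>z = O(\<bar>\<sigma> - s\<bar>)\<close> for every admissible perturbed solution.  The costate is \<open>p = \<Psi> p(0)\<close>, with \<open>p(0)\<close>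
  found by inverting \<open>\<Psi>\<^sub>F\<^sub>I(T)\<close>; by the boundary conditions \<open>\<nabla>C \<cdot> z(T) = p(T) \<cdot> z(T) - p(0) \<cdot> z(0) = \<integral> p \<cdot> r\<close>,
  and up to \<open>o(\<bar>\<sigma> - s\<bar>)\<close> only the jump \<open>F\<^sub>0 - F\<^sub>1\<close> between \<open>s\<close> and \<open>\<sigma>\<close> contributes.\<close>

section \<open>Absolutely continuous functions\<close>

text \<open>Solutions are differentiable only almost everywhere, so every identity obtained by
  differentiating a product needs the fundamental theorem for absolutely continuous functions. It is
  proved for the gauge integral, where integrability of the derivative is part of the conclusion.
  The linearization is valid only in a tube of fixed radius around \<open>x\<close>, whereas a
  perturbed solution is only known to start nearby. Hence the a priori bound is a continuity
  argument: in a small ball half of the deviation can be absorbed, and this keeps the solution from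
  leaving the ball. The constants live on two scales: first the radius \<open>\<delta>\<close> of
  the ball, to beat the smooth part of the remainder over the whole time \<open>T\<close>; then the
  admissible distance \<open>\<eta>\<close> of the switch points, in terms of
  \<open>\<delta>\<close>, to beat the jump. The jump never gets small pointwise; only its time
  integral is of order \<open>\<bar>\<sigma> - s\<bar>\<close>.\<close>

lemma absolutely_continuous_onE:
  assumes "absolutely_continuous_on S f" "\<epsilon> > 0"
  obtains \<delta> where "\<delta> > 0"
    "\<And>(m::nat) u v. \<lbrakk>\<forall>k<m. u k \<le> v k \<and> {u k..v k} \<subseteq> S;
      \<forall>k<m. \<forall>l<m. k \<noteq> l \<longrightarrow> {u k<..<v k} \<inter> {u l<..<v l} = {};
      (\<Sum>k<m. v k - u k) < \<delta>\<rbrakk> \<Longrightarrow> (\<Sum>k<m. dist (f (u k)) (f (v k))) < \<epsilon>"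
proof -
  obtain \<delta> where "\<delta> > 0" and \<delta>: "\<forall>(m::nat) u v.
        (\<forall>k<m. u k \<le> v k \<and> {u k..v k} \<subseteq> S) \<and>
        (\<forall>k<m. \<forall>l<m. k \<noteq> l \<longrightarrow> {u k<..<v k} \<inter> {u l<..<v l} = {}) \<and>
        (\<Sum>k<m. v k - u k) < \<delta>
        \<longrightarrow> (\<Sum>k<m. dist (f (u k)) (f (v k))) < \<epsilon>"
    using assms(1)[unfolded absolutely_continuous_on_def, THEN spec, THEN mp, OF assms(2)]
    by (elim exE conjE)
  show thesis by (rule that[OF \<open>\<delta> > 0\<close>], rule \<delta>[THEN spec, THEN spec, THEN spec, THEN mp]) (intro conjI)
qed

text \<open>Tagged divisions are finite sets of pairs, not sequences; a bijection with an initial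
  segment of the naturals carries the definition over to them.\<close>

lemma absolutely_continuous_on_finite_family:
  fixes f :: "real \<Rightarrow> 'a::metric_space"
  assumes "absolutely_continuous_on S f" "\<epsilon> > 0"
  obtains \<delta> where "\<delta> > 0"
    "\<And>(Q::'q set) u v. \<lbrakk>finite Q; \<And>k. k \<in> Q \<Longrightarrow> u k \<le> v k \<and> {u k..v k} \<subseteq> S;
      \<And>k l. \<lbrakk>k \<in> Q; l \<in> Q; k \<noteq> l\<rbrakk> \<Longrightarrow> {u k<..<v k} \<inter> {u l<..<v l} = {};
      (\<Sum>k\<in>Q. v k - u k) < \<delta>\<rbrakk> \<Longrightarrow> (\<Sum>k\<in>Q. dist (f (u k)) (f (v k))) < \<epsilon>"
proof -
  from assms obtain \<delta> where "\<delta> > 0" and \<delta>: "\<And>(m::nat) u v. \<lbrakk>\<forall>k<m. u k \<le> v k \<and> {u k..v k} \<subseteq> S;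
      \<forall>k<m. \<forall>l<m. k \<noteq> l \<longrightarrow> {u k<..<v k} \<inter> {u l<..<v l} = {};
      (\<Sum>k<m. v k - u k) < \<delta>\<rbrakk> \<Longrightarrow> (\<Sum>k<m. dist (f (u k)) (f (v k))) < \<epsilon>"
    by (rule absolutely_continuous_onE) blast
  show thesis
  proof (rule that[OF \<open>\<delta> > 0\<close>])
    fix Q :: "'q set" and u v
    assume Q: "finite Q" "\<And>k. k \<in> Q \<Longrightarrow> u k \<le> v k \<and> {u k..v k} \<subseteq> S"
      "\<And>k l. \<lbrakk>k \<in> Q; l \<in> Q; k \<noteq> l\<rbrakk> \<Longrightarrow> {u k<..<v k} \<inter> {u l<..<v l} = {}"
      "(\<Sum>k\<in>Q. v k - u k) < \<delta>"
    obtain h where h: "bij_betw h {..<card Q} Q"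
      using ex_bij_betw_nat_finite[OF Q(1)] by (auto simp: atLeast0LessThan)
    have inQ: "h k \<in> Q" if "k < card Q" for k
      using h that by (auto simp: bij_betw_def)
    have "(\<Sum>k<card Q. dist (f (u (h k))) (f (v (h k)))) < \<epsilon>"
    proof (rule \<delta>)
      show "(\<Sum>k<card Q. v (h k) - u (h k)) < \<delta>"
        using Q(4) sum.reindex_bij_betw[OF h, of "\<lambda>k. v k - u k"] by simp
      show "\<forall>k<card Q. \<forall>l<card Q. k \<noteq> l \<longrightarrow> {u (h k)<..<v (h k)} \<inter> {u (h l)<..<v (h l)} = {}"
      proof (intro allI impI)
        fix k l assume kl: "k < card Q" "l < card Q" "k \<noteq> l"
        then have "h k \<noteq> h l" using h by (auto simp: bij_betw_def inj_on_def)
        with kl show "{u (h k)<..<v (h k)} \<inter> {u (h l)<..<v (h l)} = {}"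
          by (intro Q(3) inQ)
      qed
    qed (use Q(2) inQ in blast)
    then show "(\<Sum>k\<in>Q. dist (f (u k)) (f (v k))) < \<epsilon>"
      using sum.reindex_bij_betw[OF h, of "\<lambda>k. dist (f (u k)) (f (v k))"] by simp
  qed
qed

lemma absolutely_continuous_on_subset:
  "absolutely_continuous_on S f \<Longrightarrow> R \<subseteq> S \<Longrightarrow> absolutely_continuous_on R f"
  unfolding absolutely_continuous_on_def by (smt (verit) order_trans)

text \<open>The only epsilon-delta argument for closure properties: sums, products and linear images
  all reduce to a bound on single increments.\<close>

lemma absolutely_continuous_on_dominated:
  fixes f :: "real \<Rightarrow> 'a::metric_space" and g :: "real \<Rightarrow> 'b::metric_space"
    and h :: "real \<Rightarrow> 'c::metric_space"
  assumes f: "absolutely_continuous_on S f" and g: "absolutely_continuous_on S g"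
    and h: "\<And>u v. u \<in> S \<Longrightarrow> v \<in> S \<Longrightarrow>
      dist (h u) (h v) \<le> B * (dist (f u) (f v) + dist (g u) (g v))"
  shows "absolutely_continuous_on S h"
  unfolding absolutely_continuous_on_def
proof (intro allI impI)
  fix e :: real assume "e > 0"
  \<comment> \<open>\<open>\<bar>B\<bar> + 1\<close> is positive whatever the sign of
    \<open>B\<close>; the factor 2 splits \<open>e\<close> between the sums for \<open>f\<close> and
    for \<open>g\<close>.\<close>
  define e' where "e' = e / (2 * (\<bar>B\<bar> + 1))"
  have "e' > 0" and e: "2 * ((\<bar>B\<bar> + 1) * e') = e"
    using \<open>e > 0\<close> by (auto simp: e'_def divide_simps)
  from f \<open>e' > 0\<close> obtain d1 where d1: "d1 > 0" "\<And>(m::nat) u v.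
    \<lbrakk>\<forall>k<m. u k \<le> v k \<and> {u k..v k} \<subseteq> S; \<forall>k<m. \<forall>l<m. k \<noteq> l \<longrightarrow> {u k<..<v k} \<inter> {u l<..<v l} = {};
     (\<Sum>k<m. v k - u k) < d1\<rbrakk> \<Longrightarrow> (\<Sum>k<m. dist (f (u k)) (f (v k))) < e'"
    by (rule absolutely_continuous_onE) blast
  from g \<open>e' > 0\<close> obtain d2 where d2: "d2 > 0" "\<And>(m::nat) u v.
    \<lbrakk>\<forall>k<m. u k \<le> v k \<and> {u k..v k} \<subseteq> S; \<forall>k<m. \<forall>l<m. k \<noteq> l \<longrightarrow> {u k<..<v k} \<inter> {u l<..<v l} = {};
     (\<Sum>k<m. v k - u k) < d2\<rbrakk> \<Longrightarrow> (\<Sum>k<m. dist (g (u k)) (g (v k))) < e'"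
    by (rule absolutely_continuous_onE) blast
  have "(\<Sum>k<m. dist (h (u k)) (h (v k))) < e"
    if uv: "(\<forall>k<m. u k \<le> v k \<and> {u k..v k} \<subseteq> S) \<and>
        (\<forall>k<m. \<forall>l<m. k \<noteq> l \<longrightarrow> {u k<..<v k} \<inter> {u l<..<v l} = {}) \<and>
        (\<Sum>k<m. v k - u k) < min d1 d2" for m :: nat and u v :: "nat \<Rightarrow> real"
  proof -
    have "(\<Sum>k<m. dist (h (u k)) (h (v k)))
      \<le> (\<Sum>k<m. (\<bar>B\<bar> + 1) * (dist (f (u k)) (f (v k)) + dist (g (u k)) (g (v k))))"
    proof (intro sum_mono)
      fix k assume "k \<in> {..<m}"
      then have "{u k..v k} \<subseteq> S" "u k \<le> v k" using uv by auto
      then have "dist (h (u k)) (h (v k)) \<le> B * (dist (f (u k)) (f (v k)) + dist (g (u k)) (g (v k)))"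
        by (intro h) auto
      also have "\<dots> \<le> (\<bar>B\<bar> + 1) * (dist (f (u k)) (f (v k)) + dist (g (u k)) (g (v k)))"
        by (intro mult_right_mono) auto
      finally show "dist (h (u k)) (h (v k))
        \<le> (\<bar>B\<bar> + 1) * (dist (f (u k)) (f (v k)) + dist (g (u k)) (g (v k)))" .
    qed
    also have "\<dots> = (\<bar>B\<bar> + 1) * ((\<Sum>k<m. dist (f (u k)) (f (v k))) + (\<Sum>k<m. dist (g (u k)) (g (v k))))"
      by (simp add: sum_distrib_left[symmetric] sum.distrib)
    also have "\<dots> < (\<bar>B\<bar> + 1) * (e' + e')"
      using uv d1(2)[of m u v] d2(2)[of m u v] by (intro mult_strict_left_mono add_strict_mono) auto
    also have "\<dots> = e" using e by (simp add: algebra_simps)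
    finally show ?thesis .
  qed
  then show "\<exists>\<delta>>0. \<forall>(m::nat) u v. (\<forall>k<m. u k \<le> v k \<and> {u k..v k} \<subseteq> S) \<and>
        (\<forall>k<m. \<forall>l<m. k \<noteq> l \<longrightarrow> {u k<..<v k} \<inter> {u l<..<v l} = {}) \<and>
        (\<Sum>k<m. v k - u k) < \<delta> \<longrightarrow> (\<Sum>k<m. dist (h (u k)) (h (v k))) < e"
    using d1(1) d2(1) by (intro exI[of _ "min d1 d2"]) auto
qed

lemma absolutely_continuous_on_ident: "absolutely_continuous_on S (\<lambda>t::real. t)"
  unfolding absolutely_continuous_on_def
proof (intro allI impI)
  fix e :: real assume "e > 0"
  have "(\<Sum>k<m. dist (u k) (v k)) = (\<Sum>k<m. v k - u k)"
    if "\<forall>k<m. u k \<le> v k \<and> {u k..v k} \<subseteq> S" for m and u v :: "nat \<Rightarrow> real"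
    using that by (intro sum.cong) (auto simp: dist_real_def)
  then show "\<exists>\<delta>>0. \<forall>(m::nat) u v. (\<forall>k<m. u k \<le> v k \<and> {u k..v k} \<subseteq> S) \<and>
        (\<forall>k<m. \<forall>l<m. k \<noteq> l \<longrightarrow> {u k<..<v k} \<inter> {u l<..<v l} = {}) \<and>
        (\<Sum>k<m. v k - u k) < \<delta> \<longrightarrow> (\<Sum>k<m. dist (u k) (v k)) < e"
    using \<open>e > 0\<close> by (intro exI[of _ e]) auto
qed

lemma lipschitz_on_imp_absolutely_continuous_on:
  fixes f :: "real \<Rightarrow> 'a::metric_space"
  assumes "B-lipschitz_on S f"
  shows "absolutely_continuous_on S f"
proof (rule absolutely_continuous_on_dominated
    [OF absolutely_continuous_on_ident absolutely_continuous_on_ident, where B = B])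
  fix u v assume "u \<in> S" "v \<in> S"
  then have "dist (f u) (f v) \<le> B * dist u v" by (rule lipschitz_onD[OF assms])
  also have "\<dots> \<le> B * (dist u v + dist u v)"
    by (intro mult_left_mono lipschitz_on_nonneg[OF assms]) simp
  finally show "dist (f u) (f v) \<le> B * (dist u v + dist u v)" .
qed

lemma absolutely_continuous_on_const: "absolutely_continuous_on S (\<lambda>t::real. c)"
  by (rule lipschitz_on_imp_absolutely_continuous_on[of 0]) (simp add: lipschitz_on_def)

lemma absolutely_continuous_on_add:
  fixes f g :: "real \<Rightarrow> 'a::real_normed_vector"
  assumes "absolutely_continuous_on S f" "absolutely_continuous_on S g"
  shows "absolutely_continuous_on S (\<lambda>t. f t + g t)"
  by (rule absolutely_continuous_on_dominated[OF assms, where B = 1]) (simp add: dist_triangle_add)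

lemma absolutely_continuous_on_diff:
  fixes f g :: "real \<Rightarrow> 'a::real_normed_vector"
  assumes "absolutely_continuous_on S f" "absolutely_continuous_on S g"
  shows "absolutely_continuous_on S (\<lambda>t. f t - g t)"
proof (rule absolutely_continuous_on_dominated[OF assms, where B = 1])
  fix u v
  show "dist (f u - g u) (f v - g v) \<le> 1 * (dist (f u) (f v) + dist (g u) (g v))"
    using norm_diff_triangle_ineq[of "f u" "g v" "f v" "g u"]
    by (simp add: dist_norm norm_minus_commute algebra_simps)
qed

lemma absolutely_continuous_on_imp_continuous_on:
  fixes f :: "real \<Rightarrow> 'a::metric_space"
  assumes "absolutely_continuous_on {a..b} f"
  shows "continuous_on {a..b} f"
  unfolding continuous_on_iff
proof (intro ballI allI impI)
  fix t and e :: real assume t: "t \<in> {a..b}" and "e > 0"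
  from assms \<open>e > 0\<close> obtain d where "d > 0" and d: "\<And>(m::nat) u v.
    \<lbrakk>\<forall>k<m. u k \<le> v k \<and> {u k..v k} \<subseteq> {a..b}; \<forall>k<m. \<forall>l<m. k \<noteq> l \<longrightarrow> {u k<..<v k} \<inter> {u l<..<v l} = {};
     (\<Sum>k<m. v k - u k) < d\<rbrakk> \<Longrightarrow> (\<Sum>k<m. dist (f (u k)) (f (v k))) < e"
    by (rule absolutely_continuous_onE) blast
  have "dist (f t') (f t) < e" if "t' \<in> {a..b}" "dist t' t < d" for t'
    using d[of 1 "\<lambda>_. min t t'" "\<lambda>_. max t t'"] that t
    by (cases "t \<le> t'") (auto simp: dist_real_def dist_commute)
  with \<open>d > 0\<close> show "\<exists>d>0. \<forall>t'\<in>{a..b}. dist t' t < d \<longrightarrow> dist (f t') (f t) < e" by blast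
qed

text \<open>On a compact interval both factors are bounded, so the increment of the product is
  dominated by those of the factors. On unbounded sets products may fail to be absolutely
  continuous, hence \<open>{a..b}\<close>.\<close>

lemma absolutely_continuous_on_bilinear:
  fixes f :: "real \<Rightarrow> 'a::real_normed_vector" and g :: "real \<Rightarrow> 'b::real_normed_vector"
    and h :: "'a \<Rightarrow> 'b \<Rightarrow> 'c::real_normed_vector"
  assumes h: "bounded_bilinear h"
    and f: "absolutely_continuous_on {a..b} f" and g: "absolutely_continuous_on {a..b} g"
  shows "absolutely_continuous_on {a..b} (\<lambda>t. h (f t) (g t))"
proof -
  interpret bounded_bilinear h by (rule h)
  have "bounded (f ` {a..b})" "bounded (g ` {a..b})"
    using f g absolutely_continuous_on_imp_continuous_on
      compact_continuous_image compact_imp_bounded by blast+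
  then obtain B1 B2 where B: "\<And>t. t \<in> {a..b} \<Longrightarrow> norm (f t) \<le> B1" "B1 > 0"
      "\<And>t. t \<in> {a..b} \<Longrightarrow> norm (g t) \<le> B2" "B2 > 0"
    unfolding bounded_pos by (metis imageI)
  obtain K where K: "\<And>a b. norm (h a b) \<le> norm a * norm b * K" "K > 0"
    using pos_bounded by blast
  show ?thesis
  proof (rule absolutely_continuous_on_dominated[OF f g, where B = "(B1 + B2) * K"])
    fix u v assume uv: "u \<in> {a..b}" "v \<in> {a..b}"
    have "h (f u) (g u) - h (f v) (g v) = h (f u - f v) (g u) + h (f v) (g u - g v)"
      by (simp add: diff_left diff_right)
    then have "dist (h (f u) (g u)) (h (f v) (g v))
      \<le> norm (f u - f v) * norm (g u) * K + norm (f v) * norm (g u - g v) * K"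
      unfolding dist_norm by (metis K(1) norm_triangle_mono)
    also have "\<dots> \<le> norm (f u - f v) * (B1 + B2) * K + (B1 + B2) * norm (g u - g v) * K"
      using B(1)[OF uv(2)] B(3)[OF uv(1)] B(2,4) K(2)
      by (intro add_mono mult_right_mono mult_left_mono) auto
    finally show "dist (h (f u) (g u)) (h (f v) (g v))
      \<le> (B1 + B2) * K * (dist (f u) (f v) + dist (g u) (g v))"
      by (simp add: dist_norm algebra_simps)
  qed
qed

lemma absolutely_continuous_on_bounded_linear:
  fixes f :: "real \<Rightarrow> 'a::real_normed_vector" and h :: "'a \<Rightarrow> 'b::real_normed_vector"
  assumes h: "bounded_linear h" and f: "absolutely_continuous_on S f"
  shows "absolutely_continuous_on S (\<lambda>t. h (f t))"
proof -
  interpret bounded_linear h by (rule h)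
  obtain K where K: "\<And>a. norm (h a) \<le> norm a * K" "K > 0"
    using pos_bounded by blast
  show ?thesis
  proof (rule absolutely_continuous_on_dominated[OF f f, where B = K])
    fix u v
    have "dist (h (f u)) (h (f v)) \<le> K * dist (f u) (f v)"
      using K(1)[of "f u - f v"] by (simp add: dist_norm diff mult.commute)
    also have "\<dots> \<le> K * (dist (f u) (f v) + dist (f u) (f v))"
      using K(2) by (intro mult_left_mono) auto
    finally show "dist (h (f u)) (h (f v)) \<le> K * (dist (f u) (f v) + dist (f u) (f v))" .
  qed
qed

section \<open>Integrating derivatives that exist almost everywhere\<close>

text \<open>Links sums over tagged intervals to Lebesgue measure: the intervals do not overlap, so
  their contents add up to the measure of their union.\<close>

lemma sum_content_tagged_partial_division_le:
  assumes p: "p tagged_partial_division_of S" and U: "U \<in> lmeasurable" "\<And>t k. (t, k) \<in> p \<Longrightarrow> k \<subseteq> U"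
  shows "(\<Sum>(t, k)\<in>p. measure lborel k) \<le> measure lebesgue U"
proof -
  have div: "snd ` p division_of \<Union>(snd ` p)"
    by (rule division_of_tagged_division[OF tagged_partial_division_of_Union_self[OF p]])
  \<comment> \<open>Different tags can carry the same interval only if it is degenerate and has
    content 0, so summing over intervals instead of pairs changes nothing.\<close>
  have "(\<Sum>(t, k)\<in>p. measure lborel k) = sum (measure lborel) (snd ` p)"
    by (rule sum.over_tagged_division_lemma[OF tagged_partial_division_of_Union_self[OF p]])
      (simp add: content_eq_0_interior)
  also have "\<dots> = (\<Sum>k\<in>snd ` p. measure lebesgue k)"
    by (intro sum.cong refl) (metis div division_ofD(4) measure_completion sets_lborel borel_closed closed_cbox)
  also have "\<dots> = measure lebesgue (\<Union>(snd ` p))"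
    by (rule content_division[OF div])
  also have "\<dots> \<le> measure lebesgue U"
    using U lmeasurable_division[OF div]
    by (intro measure_mono_fmeasurable) (auto dest: fmeasurableD, blast)
  finally show ?thesis .
qed

lemma negligible_outer_open:
  fixes Z :: "'a::euclidean_space set"
  assumes "negligible Z" "\<delta> > 0"
  obtains U where "open U" "Z \<subseteq> U" "U \<in> lmeasurable" "measure lebesgue U < \<delta>"
proof -
  have Z: "Z \<in> lmeasurable" "measure lebesgue Z = 0"
    using assms(1) negligible_imp_measurable negligible_imp_measure0 by auto
  obtain U where U: "open U" "Z \<subseteq> U" "U - Z \<in> lmeasurable" "emeasure lebesgue (U - Z) < ennreal \<delta>"
    using sets_lebesgue_outer_open[of Z \<delta>] Z(1) assms(2) by (auto simp: fmeasurableD)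
  have U': "U \<in> lmeasurable"
    using fmeasurable.Un[OF U(3) Z(1)] U(2) by (simp add: Un_absorb2)
  have "measure lebesgue (U - Z) < \<delta>"
    using U(3,4) assms(2) by (simp add: emeasure_eq_measure2 ennreal_less_iff)
  then have "measure lebesgue U < \<delta>"
    using measurable_measure_Diff[OF U' fmeasurableD[OF Z(1)] U(2)] Z(2) by simp
  with U U' show thesis using that by blast
qed

text \<open>A gauge separates the tags: at a point of differentiability the straddle estimate applies,
  whereas the intervals tagged in the exceptional null set lie in an open set of small measure, on
  which absolute continuity makes the increments small.\<close>

lemma has_integral_absolutely_continuous:
  fixes f :: "real \<Rightarrow> 'a::banach"
  assumes ab: "a \<le> b" and f: "absolutely_continuous_on {a..b} f" and Z: "negligible Z"
    and deriv: "\<And>t. t \<in> {a..b} - Z \<Longrightarrow> (f has_vector_derivative f' t) (at t within {a..b})"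
  shows "(f' has_integral f b - f a) {a..b}"
proof -
  \<comment> \<open>\<open>f'\<close> is arbitrary on \<open>Z\<close>. With the value 0 there, a
    term tagged in \<open>Z\<close> contributes exactly an increment of \<open>f\<close>; the change
    on a null set is undone at the end.\<close>
  define g where "g t = (if t \<in> Z then 0 else f' t)" for t
  have "(g has_integral f b - f a) {a..b}"
    unfolding has_integral_real
  proof (intro allI impI)
    fix e :: real assume "e > 0"
    \<comment> \<open>Adding 1 keeps the denominator positive when \<open>a = b\<close> and makes
      the estimate strict.\<close>
    define e' where "e' = e / (2 * (b - a + 1))"
    have e': "e' > 0" "e' * (b - a) < e / 2"
      using \<open>e > 0\<close> ab by (auto simp: e'_def field_simps)
    from f have "e / 2 > 0" using \<open>e > 0\<close> by simp
    from f this obtain \<delta> where "\<delta> > 0" and \<delta>: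
      "\<And>(Q::(real \<times> real set) set) u v. \<lbrakk>finite Q; \<And>k. k \<in> Q \<Longrightarrow> u k \<le> v k \<and> {u k..v k} \<subseteq> {a..b};
      \<And>k l. \<lbrakk>k \<in> Q; l \<in> Q; k \<noteq> l\<rbrakk> \<Longrightarrow> {u k<..<v k} \<inter> {u l<..<v l} = {};
      (\<Sum>k\<in>Q. v k - u k) < \<delta>\<rbrakk> \<Longrightarrow> (\<Sum>k\<in>Q. dist (f (u k)) (f (v k))) < e / 2"
      by (rule absolutely_continuous_on_finite_family) blast
    obtain U where U: "open U" "Z \<subseteq> U" "U \<in> lmeasurable" "measure lebesgue U < \<delta>"
      using Z \<open>\<delta> > 0\<close> by (rule negligible_outer_open)
    have "\<exists>d>0. t \<in> {a..b} - Z \<longrightarrow> (\<forall>y\<in>{a..b}. \<bar>y - t\<bar> < d \<longrightarrow>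
        norm (f y - f t - (y - t) *\<^sub>R f' t) \<le> e' * \<bar>y - t\<bar>)" for t
    proof (cases "t \<in> {a..b} - Z")
      case True
      from deriv[OF this] \<open>e' > 0\<close> obtain d where "d > 0"
        "\<forall>y\<in>{a..b}. norm (y - t) < d \<longrightarrow> norm (f y - f t - (y - t) *\<^sub>R f' t) \<le> e' * norm (y - t)"
        unfolding has_vector_derivative_def has_derivative_within_alt by blast
      then show ?thesis by auto
    qed (auto intro: exI[of _ 1])
    then obtain d where d: "\<And>t. d t > 0" "\<And>t y. \<lbrakk>t \<in> {a..b} - Z; y \<in> {a..b}; \<bar>y - t\<bar> < d t\<rbrakk> \<Longrightarrow>
        norm (f y - f t - (y - t) *\<^sub>R f' t) \<le> e' * \<bar>y - t\<bar>"
      by metis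
    define \<gamma> where "\<gamma> t = (if t \<in> Z then U else ball t (d t))" for t
    have gauge: "gauge \<gamma>"
      using U d(1) by (auto simp: gauge_def \<gamma>_def)
    have sum: "norm (sum (\<lambda>(t,k). measure lborel k *\<^sub>R g t) \<D> - (f b - f a)) < e"
      if D: "\<D> tagged_division_of {a..b}" and fine: "\<gamma> fine \<D>" for \<D>
    proof -
      note tag = tagged_division_ofD[OF D]
      define P where "P = {(t, k) \<in> \<D>. t \<in> Z}"
      have fin: "finite P" "finite \<D>" "P \<subseteq> \<D>" using tag(1) by (auto simp: P_def intro: finite_subset)
      have interval: "k = {Inf k..Sup k} \<and> Inf k \<le> t \<and> t \<le> Sup k \<and> k \<subseteq> {a..b} \<and> Inf k \<in> k \<and> Sup k \<in> k
          \<and> measure lborel k = Sup k - Inf k"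
        if tk: "(t, k) \<in> \<D>" for t k
      proof -
        obtain u v where "k = {u..v}" using tag(4)[OF tk] by (auto simp: cbox_interval)
        moreover have "t \<in> k" "k \<subseteq> {a..b}" using tag(2,3)[OF tk] by auto
        ultimately show ?thesis by auto
      qed
      define err where "err = (\<lambda>(t, k). measure lborel k *\<^sub>R g t - (f (Sup k) - f (Inf k)))"
      have good: "norm (err q) \<le> e' * measure lborel (snd q)" if "q \<in> \<D> - P" for q
      proof -
        obtain t k where q: "q = (t, k)" "(t, k) \<in> \<D>" "t \<notin> Z"
          using \<open>q \<in> \<D> - P\<close> by (cases q) (auto simp: P_def)
        note i = interval[OF q(2)]
        have "k \<subseteq> ball t (d t)" using fineD[OF fine q(2)] q(3) by (simp add: \<gamma>_def)
        then have near: "\<bar>Sup k - t\<bar> < d t" "\<bar>Inf k - t\<bar> < d t"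
          using i by (auto simp: dist_real_def abs_minus_commute)
        have t: "t \<in> {a..b} - Z" "Sup k \<in> {a..b}" "Inf k \<in> {a..b}" using i q by auto
        \<comment> \<open>The tag lies between the end points, so the Taylor errors at
          \<open>Inf k\<close> and \<open>Sup k\<close>, measured by the distances to
          \<open>t\<close>, add up to a multiple of the length of \<open>k\<close>; the value
          \<open>f t\<close> cancels.\<close>
        have "err q = (f (Inf k) - f t - (Inf k - t) *\<^sub>R f' t) - (f (Sup k) - f t - (Sup k - t) *\<^sub>R f' t)"
          using i q by (simp add: err_def g_def scaleR_left_diff_distrib)
        then have "norm (err q) \<le> e' * (\<bar>Inf k - t\<bar> + \<bar>Sup k - t\<bar>)"
          using d(2)[OF t(1) t(2) near(1)] d(2)[OF t(1) t(3) near(2)] norm_triangle_ineq4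
          by (smt (verit) distrib_left)
        also have "\<bar>Inf k - t\<bar> + \<bar>Sup k - t\<bar> = measure lborel (snd q)" using i q by auto
        finally show ?thesis .
      qed
      have "(\<Sum>q\<in>\<D> - P. norm (err q)) \<le> (\<Sum>q\<in>\<D> - P. e' * measure lborel (snd q))"
        by (intro sum_mono good)
      also have "\<dots> \<le> (\<Sum>q\<in>\<D>. e' * measure lborel (snd q))"
        using e' fin by (intro sum_mono2) auto
      also have "\<dots> = e' * (b - a)"
        using additive_content_tagged_division[of \<D> a b] D ab
        by (simp add: sum_distrib_left[symmetric] case_prod_unfold cbox_interval)
      finally have 1: "(\<Sum>q\<in>\<D> - P. norm (err q)) < e / 2" using e' by simp
      have Ppart: "P tagged_partial_division_of {a..b}"
        using tagged_partial_division_subset[OF _ fin(3)] D by (auto simp: tagged_division_of_def)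
      have "(\<Sum>q\<in>P. Sup (snd q) - Inf (snd q)) = (\<Sum>(t, k)\<in>P. measure lborel k)"
        using interval fin by (intro sum.cong) (auto simp: P_def)
      also have "\<dots> \<le> measure lebesgue U"
        using fine by (intro sum_content_tagged_partial_division_le[OF Ppart U(3)])
          (auto simp: P_def \<gamma>_def dest!: fineD[OF fine])
      also have "\<dots> < \<delta>" by (rule U(4))
      finally have "(\<Sum>q\<in>P. dist (f (Inf (snd q))) (f (Sup (snd q)))) < e / 2"
      proof (intro \<delta>)
        fix q r assume qr: "q \<in> P" "r \<in> P" "q \<noteq> r"
        then have "interior (snd q) \<inter> interior (snd r) = {}"
          using tag(5)[of "fst q" "snd q" "fst r" "snd r"] by (auto simp: P_def)
        moreover have "{Inf (snd q)<..<Sup (snd q)} = interior (snd q)" if "q \<in> P" for q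
        proof -
          have "snd q = {Inf (snd q)..Sup (snd q)}"
            using interval[of "fst q" "snd q"] that by (auto simp: P_def)
          then show ?thesis by (metis interior_atLeastAtMost_real)
        qed
        ultimately show "{Inf (snd q)<..<Sup (snd q)} \<inter> {Inf (snd r)<..<Sup (snd r)} = {}"
          using qr by simp
      next
        fix q assume "q \<in> P"
        then have "(fst q, snd q) \<in> \<D>" by (auto simp: P_def)
        from interval[OF this] have eq: "{Inf (snd q)..Sup (snd q)} = snd q"
          and "snd q \<subseteq> {a..b}" "Inf (snd q) \<le> Sup (snd q)" by auto
        then show "Inf (snd q) \<le> Sup (snd q) \<and> {Inf (snd q)..Sup (snd q)} \<subseteq> {a..b}"
          unfolding eq by blast
      qed (rule fin)
      moreover have "norm (err q) = dist (f (Inf (snd q))) (f (Sup (snd q)))" if "q \<in> P" for q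
        using that by (auto simp: P_def err_def g_def dist_norm norm_minus_commute)
      ultimately have 2: "(\<Sum>q\<in>P. norm (err q)) < e / 2" by simp
      have "sum (\<lambda>(t,k). measure lborel k *\<^sub>R g t) \<D> - (f b - f a) = sum err \<D>"
        unfolding additive_tagged_division_1[OF ab D, of f, symmetric] sum_subtractf[symmetric]
        by (intro sum.cong) (auto simp: err_def)
      also have "norm \<dots> \<le> (\<Sum>q\<in>\<D>. norm (err q))" by (rule norm_sum)
      also have "\<dots> = (\<Sum>q\<in>\<D> - P. norm (err q)) + (\<Sum>q\<in>P. norm (err q))"
        by (rule sum.subset_diff[OF fin(3,2)])
      also have "\<dots> < e" using 1 2 by simp
      finally show ?thesis .
    qed
    show "\<exists>\<gamma>. gauge \<gamma> \<and> (\<forall>\<D>. \<D> tagged_division_of {a..b} \<and> \<gamma> fine \<D> \<longrightarrow>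
        norm (sum (\<lambda>(t,k). measure lborel k *\<^sub>R g t) \<D> - (f b - f a)) < e)"
      by (intro exI[of _ \<gamma>] conjI gauge allI impI, elim conjE) (rule sum)
  qed
  then show ?thesis
    by (rule has_integral_spike[OF Z, rotated]) (simp add: g_def)
qed

section \<open>Integrals of piecewise continuous functions\<close>

text \<open>Continuity off a finite set gives measurability, and with the bound on a compact
  interval this gives integrability.\<close>

lemma integrable_on_piecewise_continuous:
  fixes f :: "real \<Rightarrow> 'a::euclidean_space"
  assumes S: "finite S" and f: "continuous_on ({a..b} - S) f"
    and B: "\<And>t. t \<in> {a..b} \<Longrightarrow> norm (f t) \<le> B"
  shows "f integrable_on {a..b}"
proof -
  \<comment> \<open>After extension by 0 the only possible discontinuities are \<open>S\<close> and
    the two end points, so measurability can be argued on the whole line.\<close>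
  define g where "g t = (if t \<in> {a..b} then f t else 0)" for t
  have op: "open ({a<..<b} - S)" "open (- {a..b})"
    using S by (auto intro!: open_Diff finite_imp_closed simp: open_Compl)
  have "continuous_on ({a<..<b} - S) g"
    using f by (rule continuous_on_eq[OF continuous_on_subset]) (auto simp: g_def)
  moreover have "continuous_on (- {a..b}) g"
    by (rule continuous_on_eq[OF continuous_on_const[of _ 0]]) (auto simp: g_def)
  ultimately have "continuous_on (({a<..<b} - S) \<union> - {a..b}) g"
    using op by (intro continuous_on_open_Un)
  then have "continuous_on (- (S \<union> {a, b})) g"
    by (rule continuous_on_subset) auto
  then have "g \<in> borel_measurable borel"
    using S by (intro borel_measurable_continuous_countable_exceptions[of "S \<union> {a, b}"])
      (auto intro: countable_finite)
  then have "g \<in> borel_measurable lebesgue"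
    by (simp add: borel_measurable_lebesgue_preimage_borel measurable_completion)
  then have "g \<in> borel_measurable (lebesgue_on {a..b})"
    by (rule measurable_restrict_space1)
  then have "g integrable_on {a..b}"
    by (rule measurable_bounded_by_integrable_imp_integrable[OF _ integrable_const_ivl[of B]])
      (use B in \<open>auto simp: g_def\<close>)
  then show ?thesis
    by (rule integrable_eq) (simp add: g_def)
qed

lemma integral_has_vector_derivative_piecewise_continuous:
  fixes f :: "real \<Rightarrow> 'a::euclidean_space"
  assumes S: "finite S" and f: "continuous_on ({a..b} - S) f" "f integrable_on {a..b}"
    and t: "t \<in> {a..b} - S"
  shows "((\<lambda>u. integral {a..u} f) has_vector_derivative f t) (at t within {a..b})"
proof -
  \<comment> \<open>A finite set is closed, so removing it does not affect limits at a point outside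
    it; continuity relative to the punctured interval becomes continuity within
    \<open>{a..b}\<close>.\<close>
  have "at t within ({a..b} - S) = at t within {a..b}"
    using t finite_imp_closed[OF S] by (intro at_within_nhd[of t "- S"]) auto
  then have "continuous (at t within {a..b} - {}) f"
    using f(1) t unfolding continuous_on_eq_continuous_within by (metis Diff_empty)
  from integral_has_vector_derivative_continuous_at[OF f(2) _ _ this] t show ?thesis by auto
qed

text \<open>Makes the integral term of the solution formula absolutely continuous.\<close>

lemma lipschitz_on_integral:
  fixes f :: "real \<Rightarrow> 'a::euclidean_space"
  assumes f: "f integrable_on {a..b}" and B: "\<And>t. t \<in> {a..b} \<Longrightarrow> norm (f t) \<le> B" "0 \<le> B"
  shows "B-lipschitz_on {a..b} (\<lambda>u. integral {a..u} f)"
proof (rule lipschitz_onI[OF _ B(2)])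
  have le: "dist (integral {a..u} f) (integral {a..v} f) \<le> B * dist u v"
    if "u \<in> {a..b}" "v \<in> {a..b}" "u \<le> v" for u v
  proof -
    have sub: "f integrable_on {u..v}" "f integrable_on {a..v}"
      using f that by (auto intro: integrable_subinterval_real)
    have "integral {a..v} f = integral {a..u} f + integral {u..v} f"
      using Henstock_Kurzweil_Integration.integral_combine[OF _ _ sub(2)] that by simp
    moreover have "norm (integral {u..v} f) \<le> B * (v - u)"
      using that B has_integral_bound_real[OF B(2) finite.emptyI integrable_integral[OF sub(1)]] by auto
    ultimately show ?thesis using that by (simp add: dist_norm dist_real_def norm_minus_commute)
  qed
  fix u v assume "u \<in> {a..b}" "v \<in> {a..b}"
  then show "dist (integral {a..u} f) (integral {a..v} f) \<le> B * dist u v"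
    using le[of u v] le[of v u] by (cases "u \<le> v") (auto simp: dist_commute)
qed

section \<open>Differential equations outside a null set, and matrix products\<close>

text \<open>An explicit exceptional set can be united with that of a second solution, as the product
  rule requires.\<close>

lemma ac_solutionE:
  assumes "ac_solution T G y"
  obtains Z where "negligible Z" "absolutely_continuous_on {0..T} y"
    "\<And>t. t \<in> {0..T} - Z \<Longrightarrow> (y has_vector_derivative G (y t) t) (at t within {0..T})"
proof -
  have "AE t in lebesgue. t \<in> {0..T} \<longrightarrow> (y has_vector_derivative G (y t) t) (at t within {0..T})"
    using assms by (simp add: ac_solution_def)
  then obtain Z where "Z \<in> null_sets lebesgue"
    "{t. \<not> (t \<in> {0..T} \<longrightarrow> (y has_vector_derivative G (y t) t) (at t within {0..T}))} \<subseteq> Z"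
    by (auto simp: eventually_ae_filter)
  with assms show thesis
    by (intro that[of Z]) (auto simp: negligible_iff_null_sets ac_solution_def)
qed

lemma ac_solutionI:
  assumes "negligible Z" "absolutely_continuous_on {0..T} y"
    "\<And>t. t \<in> {0..T} - Z \<Longrightarrow> (y has_vector_derivative G (y t) t) (at t within {0..T})"
  shows "ac_solution T G y"
  unfolding ac_solution_def
proof
  show "AE t\<in>{0..T} in lebesgue. (y has_vector_derivative G (y t) t) (at t within {0..T})"
    using assms by (intro AE_I'[of Z]) (auto simp: negligible_iff_null_sets)
qed (rule assms)

lemma bounded_bilinear_matrix_vector_mult:
  "bounded_bilinear ((*v) :: real^'n^'m \<Rightarrow> real^'n \<Rightarrow> real^'m)"
  unfolding bilinear_conv_bounded_bilinear[symmetric] bilinear_def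
  by (auto intro!: linearI simp: matrix_vector_right_distrib matrix_vector_mult_add_rdistrib
      scaleR_matrix_vector_assoc matrix_vector_mult_scaleR)

lemma bounded_linear_transpose: "bounded_linear (transpose :: real^'n^'m \<Rightarrow> real^'m^'n)"
  unfolding linear_conv_bounded_linear[symmetric]
  by (rule linearI) (simp_all add: transpose_def vec_eq_iff)

lemma bounded_bilinear_vector_matrix_mult:
  "bounded_bilinear (\<lambda>(A :: real^'n^'m) x. x v* A)"
proof -
  have "(\<lambda>(A :: real^'n^'m) x. x v* A) = (\<lambda>A. (*v) (transpose A))"
    by (simp add: fun_eq_iff)
  then show ?thesis
    using bounded_bilinear.comp1[OF bounded_bilinear_matrix_vector_mult bounded_linear_transpose]
    by simp
qed

section \<open>Linear systems and their adjoints\<close>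

locale linear_system =
  fixes T :: real and A \<Phi> \<Psi> :: "real \<Rightarrow> real ^ 'n ^ 'n"
  assumes T_pos: "0 < T"
    and \<Phi>: "ac_solution T (\<lambda>M t. A t ** M) \<Phi>" and \<Phi>_0: "\<Phi> 0 = mat 1"
    and \<Psi>: "ac_solution T (\<lambda>M t. - (transpose (A t) ** M)) \<Psi>" and \<Psi>_0: "\<Psi> 0 = mat 1"
begin

lemma ac_\<Phi>: "absolutely_continuous_on {0..T} \<Phi>" and ac_\<Psi>: "absolutely_continuous_on {0..T} \<Psi>"
  using \<Phi> \<Psi> by (auto simp: ac_solution_def)

lemma continuous_\<Phi>: "continuous_on {0..T} \<Phi>" and continuous_\<Psi>: "continuous_on {0..T} \<Psi>"
  using ac_\<Phi> ac_\<Psi> by (simp_all add: absolutely_continuous_on_imp_continuous_on)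

text \<open>\<open>z t v* \<Psi> t\<close> is the transpose of \<open>\<Psi> t\<close> applied to
  \<open>z t\<close>. Integrability of the integrand is part of the conclusion, because it is almost
  everywhere the derivative of an absolutely continuous function.\<close>

lemma duhamel:
  fixes r :: "real \<Rightarrow> real ^ 'n"
  assumes z: "ac_solution T (\<lambda>y t. A t *v y + r t) z" and t: "t \<in> {0..T}"
  shows "((\<lambda>\<tau>. r \<tau> v* \<Psi> \<tau>) has_integral z t v* \<Psi> t - z 0) {0..t}"
proof -
  obtain Z1 where Z1: "negligible Z1" "absolutely_continuous_on {0..T} \<Psi>" "\<And>t. t \<in> {0..T} - Z1 \<Longrightarrow>
      (\<Psi> has_vector_derivative - (transpose (A t) ** \<Psi> t)) (at t within {0..T})"
    using \<Psi> by (rule ac_solutionE) blast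
  obtain Z2 where Z2: "negligible Z2" "absolutely_continuous_on {0..T} z" "\<And>t. t \<in> {0..T} - Z2 \<Longrightarrow>
      (z has_vector_derivative A t *v z t + r t) (at t within {0..T})"
    using z by (rule ac_solutionE) blast
  have "absolutely_continuous_on {0..T} (\<lambda>t. z t v* \<Psi> t)"
    by (rule absolutely_continuous_on_bilinear[OF bounded_bilinear_vector_matrix_mult Z1(2) Z2(2)])
  then have ac: "absolutely_continuous_on {0..t} (\<lambda>t. z t v* \<Psi> t)"
    by (rule absolutely_continuous_on_subset) (use t in auto)
  have "((\<lambda>t. z t v* \<Psi> t) has_vector_derivative r \<tau> v* \<Psi> \<tau>) (at \<tau> within {0..t})"
    if \<tau>: "\<tau> \<in> {0..t} - (Z1 \<union> Z2)" for \<tau>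
  proof -
    have "\<tau> \<in> {0..T} - Z1" "\<tau> \<in> {0..T} - Z2" using \<tau> t by auto
    from bounded_bilinear.has_vector_derivative[OF bounded_bilinear_vector_matrix_mult
        Z1(3)[OF this(1)] Z2(3)[OF this(2)]]
    have "((\<lambda>t. z t v* \<Psi> t) has_vector_derivative
      (A \<tau> *v z \<tau> + r \<tau>) v* \<Psi> \<tau> + z \<tau> v* - (transpose (A \<tau>) ** \<Psi> \<tau>)) (at \<tau> within {0..T})" .
    \<comment> \<open>The derivative of \<open>\<Psi>\<close> is minus the transpose of
      \<open>A\<close> times \<open>\<Psi>\<close>, so its contribution cancels that of
      \<open>A \<tau> *v z \<tau>\<close>.\<close>
    moreover have "(A \<tau> *v z \<tau> + r \<tau>) v* \<Psi> \<tau> + z \<tau> v* - (transpose (A \<tau>) ** \<Psi> \<tau>) = r \<tau> v* \<Psi> \<tau>"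
    proof -
      interpret bb: bounded_bilinear "\<lambda>(A :: real^'n^'n) x. x v* A"
        by (rule bounded_bilinear_vector_matrix_mult)
      have "z \<tau> v* (transpose (A \<tau>) ** \<Psi> \<tau>) = (A \<tau> *v z \<tau>) v* \<Psi> \<tau>"
        by (simp flip: vector_matrix_mul_assoc)
      then show ?thesis by (simp add: bb.minus_left bb.add_right)
    qed
    ultimately show ?thesis
      using t by (auto intro: has_vector_derivative_within_subset)
  qed
  from has_integral_absolutely_continuous[OF _ ac negligible_Un[OF Z1(1) Z2(1)] this] t
  show ?thesis by (simp add: \<Psi>_0)
qed

text \<open>The added \<open>0\<close> is a vanishing inhomogeneity, which gives the homogeneous
  equation the form expected by \<open>duhamel\<close>.\<close>

lemma \<Phi>_vector_solution: "ac_solution T (\<lambda>y t. A t *v y + 0) (\<lambda>t. \<Phi> t *v v)"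
proof -
  obtain Z where Z: "negligible Z" "absolutely_continuous_on {0..T} \<Phi>" "\<And>t. t \<in> {0..T} - Z \<Longrightarrow>
      (\<Phi> has_vector_derivative A t ** \<Phi> t) (at t within {0..T})"
    using \<Phi> by (rule ac_solutionE) blast
  have bl: "bounded_linear (\<lambda>M :: real^'n^'n. M *v v)"
    by (rule bounded_bilinear.bounded_linear_left[OF bounded_bilinear_matrix_vector_mult])
  show ?thesis
  proof (rule ac_solutionI[OF Z(1)])
    show "absolutely_continuous_on {0..T} (\<lambda>t. \<Phi> t *v v)"
      by (rule absolutely_continuous_on_bounded_linear[OF bl Z(2)])
    show "((\<lambda>t. \<Phi> t *v v) has_vector_derivative A t *v (\<Phi> t *v v) + 0) (at t within {0..T})"
      if "t \<in> {0..T} - Z" for t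
      using bounded_linear.has_vector_derivative[OF bl Z(3)[OF that]]
      by (simp add: matrix_vector_mul_assoc)
  qed
qed

text \<open>For a homogeneous solution the integrand in \<open>duhamel\<close> is 0, so
  \<open>(\<Phi> t *v v) v* \<Psi> t\<close> keeps its initial value \<open>v\<close>.\<close>

lemma transpose_\<Psi>_\<Phi>:
  assumes "t \<in> {0..T}"
  shows "transpose (\<Psi> t) ** \<Phi> t = mat 1"
proof -
  have "(\<Phi> t *v v) v* \<Psi> t = v" for v
  proof -
    have "((\<lambda>_. 0) has_integral (\<Phi> t *v v) v* \<Psi> t - v) {0..t}"
      using duhamel[OF \<Phi>_vector_solution[of v] assms] by (simp add: \<Phi>_0)
    then show ?thesis using has_integral_unique[OF has_integral_0] by fastforce
  qed
  then show ?thesis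
    unfolding matrix_eq by (simp flip: matrix_vector_mul_assoc)
qed

text \<open>A left inverse of a square matrix is also a right inverse. This recovers
  \<open>z t\<close> from \<open>z t v* \<Psi> t\<close>.\<close>

lemma \<Phi>_transpose_\<Psi>: "t \<in> {0..T} \<Longrightarrow> \<Phi> t *v (v v* \<Psi> t) = v"
  using transpose_\<Psi>_\<Phi>[of t] matrix_left_right_inverse[of "transpose (\<Psi> t)" "\<Phi> t"]
  by (simp add: matrix_vector_mul_assoc flip: transpose_matrix_vector)

lemma adjoint_solution: "ac_solution T (\<lambda>q t. - (q v* A t)) (\<lambda>t. \<Psi> t *v v)"
proof -
  obtain Z where Z: "negligible Z" "absolutely_continuous_on {0..T} \<Psi>" "\<And>t. t \<in> {0..T} - Z \<Longrightarrow>
      (\<Psi> has_vector_derivative - (transpose (A t) ** \<Psi> t)) (at t within {0..T})"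
    using \<Psi> by (rule ac_solutionE) blast
  interpret bb: bounded_bilinear "\<lambda>(M :: real^'n^'n) x. M *v x"
    by (rule bounded_bilinear_matrix_vector_mult)
  have bl: "bounded_linear (\<lambda>M :: real^'n^'n. M *v v)"
    by (rule bb.bounded_linear_left)
  show ?thesis
  proof (rule ac_solutionI[OF Z(1)])
    show "absolutely_continuous_on {0..T} (\<lambda>t. \<Psi> t *v v)"
      by (rule absolutely_continuous_on_bounded_linear[OF bl Z(2)])
    show "((\<lambda>t. \<Psi> t *v v) has_vector_derivative - ((\<Psi> t *v v) v* A t)) (at t within {0..T})"
      if "t \<in> {0..T} - Z" for t
      using bounded_linear.has_vector_derivative[OF bl Z(3)[OF that]]
      by (simp add: bb.minus_left flip: matrix_vector_mul_assoc)
  qed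
qed

text \<open>\<open>q t v* \<Phi> t\<close> is conserved: its derivative vanishes almost everywhere,
  so it equals \<open>q 0\<close>. Inverting the transpose of \<open>\<Phi> t\<close> gives the
  formula.\<close>

lemma adjoint_solution_unique:
  assumes q: "ac_solution T (\<lambda>q t. - (q v* A t)) q" and t: "t \<in> {0..T}"
  shows "q t = \<Psi> t *v q 0"
proof -
  obtain Z1 where Z1: "negligible Z1" "absolutely_continuous_on {0..T} \<Phi>" "\<And>t. t \<in> {0..T} - Z1 \<Longrightarrow>
      (\<Phi> has_vector_derivative A t ** \<Phi> t) (at t within {0..T})"
    using \<Phi> by (rule ac_solutionE) blast
  obtain Z2 where Z2: "negligible Z2" "absolutely_continuous_on {0..T} q" "\<And>t. t \<in> {0..T} - Z2 \<Longrightarrow>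
      (q has_vector_derivative - (q t v* A t)) (at t within {0..T})"
    using q by (rule ac_solutionE) blast
  interpret bb: bounded_bilinear "\<lambda>(A :: real^'n^'n) x. x v* A"
    by (rule bounded_bilinear_vector_matrix_mult)
  have "absolutely_continuous_on {0..T} (\<lambda>t. q t v* \<Phi> t)"
    by (rule absolutely_continuous_on_bilinear[OF bounded_bilinear_vector_matrix_mult Z1(2) Z2(2)])
  then have ac: "absolutely_continuous_on {0..t} (\<lambda>t. q t v* \<Phi> t)"
    by (rule absolutely_continuous_on_subset) (use t in auto)
  have "((\<lambda>t. q t v* \<Phi> t) has_vector_derivative 0) (at \<tau> within {0..t})"
    if \<tau>: "\<tau> \<in> {0..t} - (Z1 \<union> Z2)" for \<tau>
  proof -
    have "\<tau> \<in> {0..T} - Z1" "\<tau> \<in> {0..T} - Z2" using \<tau> t by auto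
    from bb.has_vector_derivative[OF Z1(3)[OF this(1)] Z2(3)[OF this(2)]]
    have "((\<lambda>t. q t v* \<Phi> t) has_vector_derivative
      (- (q \<tau> v* A \<tau>)) v* \<Phi> \<tau> + q \<tau> v* (A \<tau> ** \<Phi> \<tau>)) (at \<tau> within {0..T})" .
    then have "((\<lambda>t. q t v* \<Phi> t) has_vector_derivative 0) (at \<tau> within {0..T})"
      by (simp add: bb.minus_right flip: vector_matrix_mul_assoc)
    then show ?thesis
      using t by (auto intro: has_vector_derivative_within_subset)
  qed
  from has_integral_absolutely_continuous[OF _ ac negligible_Un[OF Z1(1) Z2(1)] this] t
  have "((\<lambda>_. 0) has_integral q t v* \<Phi> t - q 0) {0..t}"
    by (simp add: \<Phi>_0)
  then have "q 0 = q t v* \<Phi> t"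
    using has_integral_unique[OF has_integral_0] by fastforce
  \<comment> \<open>The transpose of \<open>transpose_\<Psi>_\<Phi>\<close>, with left and right
    inverse exchanged.\<close>
  moreover have "\<Psi> t ** transpose (\<Phi> t) = mat 1"
    using transpose_\<Psi>_\<Phi>[OF t] matrix_left_right_inverse[of "transpose (\<Phi> t)" "\<Psi> t"]
    by (metis matrix_transpose_mul transpose_mat transpose_transpose)
  ultimately show ?thesis
    by (metis matrix_vector_mul_assoc matrix_vector_mul_lid transpose_matrix_vector)
qed

text \<open>Converse of \<open>duhamel\<close>: the formula does produce a solution. Continuity of
  \<open>r\<close> off a finite set makes the integral differentiable there, and
  \<open>\<Phi>_transpose_\<Psi>\<close> turns \<open>\<Phi> t\<close> times the derivative of the
  integral into \<open>r t\<close>.\<close>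

lemma variation_of_constants:
  assumes S: "finite S" and r: "continuous_on ({0..T} - S) r" "\<And>t. t \<in> {0..T} \<Longrightarrow> norm (r t) \<le> B"
  shows "(\<lambda>\<tau>. r \<tau> v* \<Psi> \<tau>) integrable_on {0..T}"
    and "ac_solution T (\<lambda>y t. A t *v y + r t)
      (\<lambda>t. \<Phi> t *v (v + integral {0..t} (\<lambda>\<tau>. r \<tau> v* \<Psi> \<tau>)))"
proof -
  let ?f = "\<lambda>\<tau>. r \<tau> v* \<Psi> \<tau>"
  interpret bv: bounded_bilinear "\<lambda>(A :: real^'n^'n) x. x v* A"
    by (rule bounded_bilinear_vector_matrix_mult)
  interpret bm: bounded_bilinear "\<lambda>(M :: real^'n^'n) x. M *v x"
    by (rule bounded_bilinear_matrix_vector_mult)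
  have f: "continuous_on ({0..T} - S) ?f"
    using r(1) continuous_\<Psi> by (auto intro!: bv.continuous_on elim: continuous_on_subset)
  obtain K where K: "K > 0" "\<And>t. t \<in> {0..T} \<Longrightarrow> norm (\<Psi> t) \<le> K"
    using compact_imp_bounded[OF compact_continuous_image[OF continuous_\<Psi>]]
    unfolding bounded_pos by (metis compact_Icc imageI)
  obtain K' where K': "K' > 0" "\<And>M v. norm (v v* M) \<le> norm (M :: real^'n^'n) * norm v * K'"
    using bv.pos_bounded by blast
  have B: "norm (?f t) \<le> K * \<bar>B\<bar> * K'" if "t \<in> {0..T}" for t
    by (rule order_trans[OF K'(2)]) (use K K' r(2) that in \<open>auto intro!: mult_mono order_trans[OF r(2)]\<close>)
  show int: "?f integrable_on {0..T}"
    by (rule integrable_on_piecewise_continuous[OF S f B])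
  obtain Z where Z: "negligible Z" "\<And>t. t \<in> {0..T} - Z \<Longrightarrow>
      (\<Phi> has_vector_derivative A t ** \<Phi> t) (at t within {0..T})"
    using \<Phi> by (rule ac_solutionE) blast
  let ?w = "\<lambda>t. v + integral {0..t} ?f"
  show "ac_solution T (\<lambda>y t. A t *v y + r t) (\<lambda>t. \<Phi> t *v ?w t)"
  proof (rule ac_solutionI)
    show "negligible (Z \<union> S)" using Z S by (simp add: negligible_finite)
    have "absolutely_continuous_on {0..T} ?w"
      using K K' by (intro absolutely_continuous_on_add absolutely_continuous_on_const
        lipschitz_on_imp_absolutely_continuous_on[OF lipschitz_on_integral[OF int B]]) auto
    then show "absolutely_continuous_on {0..T} (\<lambda>t. \<Phi> t *v ?w t)"
      by (rule absolutely_continuous_on_bilinear[OF bounded_bilinear_matrix_vector_mult ac_\<Phi>])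
    fix t assume t: "t \<in> {0..T} - (Z \<union> S)"
    then have "(?w has_vector_derivative ?f t) (at t within {0..T})"
      using integral_has_vector_derivative_piecewise_continuous[OF S f int, of t]
      by (auto intro: derivative_eq_intros)
    from bm.has_vector_derivative[OF Z(2) this, of] t
    show "((\<lambda>t. \<Phi> t *v ?w t) has_vector_derivative A t *v (\<Phi> t *v ?w t) + r t) (at t within {0..T})"
      by (simp add: \<Phi>_transpose_\<Psi> matrix_vector_mul_assoc add.commute)
  qed
qed

end

section \<open>Linearization along the trajectory\<close>

text \<open>Tube and Lipschitz bound are stated in the given norm, while the analysis is Euclidean.
  The upper constant makes \<open>N\<close> Lipschitz, hence continuous on the compact unit sphere,
  where its positive minimum is the lower constant.\<close>

lemma is_norm_equivalent:
  fixes N :: "'a::euclidean_space \<Rightarrow> real"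
  assumes N: "is_norm N"
  obtains m M where "0 < m" "0 < M" "\<And>v. m * norm v \<le> N v" "\<And>v. N v \<le> M * norm v"
proof -
  have nonneg: "0 \<le> N v" and zero: "N v = 0 \<longleftrightarrow> v = 0" and scale: "N (a *\<^sub>R v) = \<bar>a\<bar> * N v"
    and triangle: "N (v + w) \<le> N v + N w" for a v w
    using N by (auto simp: is_norm_def)
  have sum_le: "N (\<Sum>b\<in>S. f b) \<le> (\<Sum>b\<in>S. N (f b))" if "finite S" for S :: "'a set" and f
    using that
  proof induction
    case empty
    then show ?case using zero[of 0] by simp
  next
    case (insert b S)
    then show ?case using triangle[of "f b" "sum f S"] by simp
  qed
  define M where "M = (\<Sum>b\<in>Basis. N b) + 1"
  have M: "0 < M" using nonneg by (simp add: M_def add_nonneg_pos sum_nonneg)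
  have upper: "N v \<le> M * norm v" for v
  proof -
    have "N v = N (\<Sum>b\<in>Basis. (v \<bullet> b) *\<^sub>R b)" by (simp add: euclidean_representation)
    also have "\<dots> \<le> (\<Sum>b\<in>Basis. \<bar>v \<bullet> b\<bar> * N b)"
      using sum_le[OF finite_Basis, of "\<lambda>b. (v \<bullet> b) *\<^sub>R b"] by (simp add: scale)
    also have "\<dots> \<le> (\<Sum>b\<in>Basis. norm v * N b)"
      by (intro sum_mono mult_right_mono Basis_le_norm nonneg)
    also have "\<dots> \<le> M * norm v" by (simp add: M_def sum_distrib_left algebra_simps)
    finally show ?thesis .
  qed
  have "M-lipschitz_on UNIV N"
  proof (rule lipschitz_onI)
    fix v w
    have "N v \<le> N w + N (v - w)" "N w \<le> N v + N (w - v)"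
      using triangle[of w "v - w"] triangle[of v "w - v"] by auto
    moreover have "N (w - v) = N (v - w)" using scale[of "-1" "v - w"] by simp
    ultimately show "dist (N v) (N w) \<le> M * dist v w"
      using upper[of "v - w"] by (simp add: dist_norm abs_le_iff)
  qed (use M in simp)
  then have cont: "continuous_on (sphere 0 1) N"
    using lipschitz_on_continuous_on continuous_on_subset by blast
  have "sphere (0::'a) 1 \<noteq> {}" by simp
  then obtain u where u: "u \<in> sphere 0 1" "\<And>v. v \<in> sphere 0 1 \<Longrightarrow> N u \<le> N v"
    using continuous_attains_inf[OF compact_sphere _ cont] by blast
  have "u \<noteq> 0" using u(1) by auto
  then have m: "0 < N u" using nonneg zero by (metis less_eq_real_def)
  have lower: "N u * norm v \<le> N v" for v
  proof (cases "v = 0")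
    case False
    have "N u \<le> N (v /\<^sub>R norm v)" using False by (intro u) simp
    then show ?thesis using False by (simp add: scale field_simps)
  qed (simp add: nonneg)
  show thesis by (rule that[OF m M lower upper])
qed

text \<open>What later arguments use of the smoothness assumption, in the Euclidean norm and
  relative to \<open>x\<close>. The last clause bounds the Lipschitz constant of the Taylor error,
  not merely its size, because the contraction argument compares two perturbations.\<close>

definition linearizable ::
    "real set \<Rightarrow> (real \<Rightarrow> real ^ 'n) \<Rightarrow> real \<Rightarrow> real \<Rightarrow> (real ^ 'n \<Rightarrow> real \<Rightarrow> real ^ 'n) \<Rightarrow> bool" where
  "linearizable S x r L F \<longleftrightarrow>
     continuous_on (S \<times> cball 0 r) (\<lambda>(t, z). F (x t + z) t) \<and>
     continuous_on S (jacobian_along F x) \<and>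
     (\<forall>t\<in>S. \<forall>\<delta>\<le>r. \<forall>z\<in>cball 0 \<delta>. \<forall>w\<in>cball 0 \<delta>.
        norm (F (x t + z) t - F (x t + w) t - jacobian_along F x t *v (z - w)) \<le> L * \<delta> * norm (z - w))"

lemma linearizable_subset:
  "linearizable S x r L F \<Longrightarrow> R \<subseteq> S \<Longrightarrow> q \<le> r \<Longrightarrow> linearizable R x q L F"
  unfolding linearizable_def
  by (intro conjI; (elim conjE continuous_on_subset)?) (auto simp: subset_iff)

text \<open>A Euclidean ball of radius \<open>\<rho> / M\<close> fits into the given ball.
  Converting the Jacobian bound costs a factor \<open>M\<close> for each of the two norms on the
  right and \<open>1 / m\<close> for the one on the left. The absolute value covers either sign of
  \<open>L\<close>.\<close>

lemma linearizable_if_smooth: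
  fixes F :: "real ^ 'n \<Rightarrow> real \<Rightarrow> real ^ 'n"
  assumes N: "0 < m" "0 < M" "\<And>v. m * norm v \<le> N v" "\<And>v. N v \<le> M * norm v"
    and \<rho>: "0 < \<rho>" and x: "continuous_on S x"
    and diff: "continuously_differentiable_on (\<lambda>(z, t). F z t) (tube N S x \<rho>)"
    and lip: "uniformly_lipschitz_jacobian_on_tube N S x \<rho> L F"
  shows "linearizable S x (\<rho> / M) (\<bar>L\<bar> * M\<^sup>2 / m) F"
proof -
  let ?r = "\<rho> / M" and ?L = "\<bar>L\<bar> * M\<^sup>2 / m"
  have r: "0 < ?r" using N \<rho> by simp
  have sub: "cball c ?r \<subseteq> norm_cball N c \<rho>" for c
  proof
    fix y assume "y \<in> cball c ?r"
    then have "M * norm (y - c) \<le> \<rho>"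
      using N by (simp add: dist_norm norm_minus_commute field_simps)
    then show "y \<in> norm_cball N c \<rho>"
      using N(4)[of "y - c"] by (simp add: norm_cball_def)
  qed
  obtain G where G: "\<And>t z. t \<in> S \<Longrightarrow> z \<in> norm_cball N (x t) \<rho> \<Longrightarrow>
      ((\<lambda>y. F y t) has_derivative (\<lambda>h. G z t *v h)) (at z within norm_cball N (x t) \<rho>)"
    and Glip: "\<And>t z w h. t \<in> S \<Longrightarrow> z \<in> norm_cball N (x t) \<rho> \<Longrightarrow> w \<in> norm_cball N (x t) \<rho> \<Longrightarrow>
      N ((G z t - G w t) *v h) \<le> L * N (z - w) * N h"
    using lip unfolding uniformly_lipschitz_jacobian_on_tube_def by blast
  have Glip': "norm ((G z t - G w t) *v h) \<le> ?L * norm (z - w) * norm h"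
    if "t \<in> S" "z \<in> norm_cball N (x t) \<rho>" "w \<in> norm_cball N (x t) \<rho>" for t z w h
  proof -
    have pos: "0 \<le> N v" for v using N(1) N(3)[of v] by (meson mult_nonneg_nonneg norm_ge_zero order_trans less_imp_le)
    have "m * norm ((G z t - G w t) *v h) \<le> L * N (z - w) * N h"
      using N(3) Glip[OF that] order_trans by blast
    also have "\<dots> \<le> \<bar>L\<bar> * (M * norm (z - w)) * (M * norm h)"
      using pos N by (intro mult_mono) auto
    finally show ?thesis using N(1) by (simp add: field_simps power2_eq_square)
  qed
  \<comment> \<open>The assumption takes derivatives relative to the ball,
    \<open>jacobian_along\<close> in the full space; they agree at the centre, which is an interior
    point.\<close>
  have centre: "at (x t) within norm_cball N (x t) \<rho> = at (x t)" for t
  proof (rule at_within_interior)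
    have "ball (x t) ?r \<subseteq> norm_cball N (x t) \<rho>"
      using sub ball_subset_cball by blast
    then show "x t \<in> interior (norm_cball N (x t) \<rho>)"
      using r by (meson centre_in_ball interiorI open_ball)
  qed
  have in_ball: "x t \<in> norm_cball N (x t) \<rho>" for t
    using sub[of "x t"] r by auto
  have derG: "((\<lambda>y. F y t) has_derivative (\<lambda>h. G (x t) t *v h)) (at (x t))" if "t \<in> S" for t
    using G[OF that in_ball] by (simp add: centre)
  have J: "jacobian_along F x t = G (x t) t" if "t \<in> S" for t
    unfolding jacobian_along_def jacobian_def
    using frechet_derivative_at[OF derG[OF that], symmetric] by simp
  obtain f' where f': "\<And>q. q \<in> tube N S x \<rho> \<Longrightarrow>
      ((\<lambda>(z, t). F z t) has_derivative blinfun_apply (f' q)) (at q within tube N S x \<rho>)"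
    and contf': "continuous_on (tube N S x \<rho>) f'"
    using diff unfolding continuously_differentiable_on_def by blast
  have contF: "continuous_on (tube N S x \<rho>) (\<lambda>(z, t). F z t)"
    using f' by (rule has_derivative_continuous_on)
  have "continuous_on (S \<times> cball 0 ?r) ((\<lambda>(z, t). F z t) \<circ> (\<lambda>(t, z). (x t + z, t)))"
  proof (rule continuous_on_compose)
    show "continuous_on (S \<times> cball 0 ?r) (\<lambda>(t, z). (x t + z, t))"
      unfolding case_prod_unfold
      by (intro continuous_intros continuous_on_compose2[OF x]) auto
    show "continuous_on ((\<lambda>(t, z). (x t + z, t)) ` (S \<times> cball 0 ?r)) (\<lambda>(z, t). F z t)"
    proof (rule continuous_on_subset[OF contF], clarify)
      fix t z assume "t \<in> S" "z \<in> cball (0 :: real^'n) ?r"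
      then have "x t + z \<in> cball (x t) ?r" by (simp add: dist_norm)
      with \<open>t \<in> S\<close> show "(x t + z, t) \<in> tube N S x \<rho>" using sub[of "x t"] by (auto simp: tube_def)
    qed
  qed
  then have 1: "continuous_on (S \<times> cball 0 ?r) (\<lambda>(t, z). F (x t + z) t)"
    by (simp add: comp_def case_prod_unfold)
  \<comment> \<open>The Lipschitz bound compares Jacobians at equal times only. Continuity in time
    comes from the joint derivative \<open>f'\<close>, whose restriction to spatial directions is
    the Jacobian.\<close>
  have Gf': "G (x t) t *v h = f' (x t, t) (h, 0)" if t: "t \<in> S" for t h
  proof -
    have "((\<lambda>(z, t). F z t) \<circ> (\<lambda>y. (y, t)) has_derivative f' (x t, t) \<circ> (\<lambda>h. (h, 0)))
      (at (x t) within norm_cball N (x t) \<rho>)"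
    proof (rule diff_chain_within)
      show "((\<lambda>y. (y, t)) has_derivative (\<lambda>h. (h, 0))) (at (x t) within norm_cball N (x t) \<rho>)"
        by (intro derivative_eq_intros) auto
      have "(\<lambda>y. (y, t)) ` norm_cball N (x t) \<rho> \<subseteq> tube N S x \<rho>"
        using t by (auto simp: tube_def)
      then show "((\<lambda>(z, t). F z t) has_derivative f' (x t, t))
        (at (x t, t) within (\<lambda>y. (y, t)) ` norm_cball N (x t) \<rho>)"
        using t in_ball by (intro has_derivative_subset[OF f']) (auto simp: tube_def)
    qed
    then have "((\<lambda>y. F y t) has_derivative (\<lambda>h. f' (x t, t) (h, 0))) (at (x t))"
      by (simp add: comp_def centre)
    from has_derivative_unique[OF derG[OF t] this] show ?thesis by metis
  qed
  have "continuous_on S (\<lambda>t. f' (x t, t))"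
    by (rule continuous_on_compose2[OF contf', of _ "\<lambda>t. (x t, t)"])
      (use x in_ball in \<open>auto intro!: continuous_intros simp: tube_def\<close>)
  then have "continuous_on S (\<lambda>t. \<chi> i j. f' (x t, t) (axis j 1, 0) $ i)"
    by (intro continuous_intros)
  moreover have "jacobian_along F x t = (\<chi> i j. f' (x t, t) (axis j 1, 0) $ i)" if "t \<in> S" for t
    using that by (simp add: J Gf'[symmetric] matrix_vector_mult_basis column_def vec_eq_iff)
  ultimately have 2: "continuous_on S (jacobian_along F x)"
    by (simp cong: continuous_on_cong_simp)
  have 3: "norm (F (x t + z) t - F (x t + w) t - jacobian_along F x t *v (z - w)) \<le> ?L * \<delta> * norm (z - w)"
    if t: "t \<in> S" and \<delta>: "\<delta> \<le> ?r" and zw: "z \<in> cball 0 \<delta>" "w \<in> cball 0 \<delta>" for t \<delta> z w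
  proof -
    have \<delta>': "cball (x t) \<delta> \<subseteq> norm_cball N (x t) \<rho>" using sub \<delta> by (meson order_trans subset_cball)
    \<comment> \<open>Mean value inequality for \<open>F\<close> minus its linear part at the
      centre: the derivative of this difference is \<open>G y t - G (x t) t\<close>, of order
      \<open>\<delta>\<close> on the ball.\<close>
    have "norm ((F (x t + z) t - G (x t) t *v (x t + z)) - (F (x t + w) t - G (x t) t *v (x t + w)))
      \<le> ?L * \<delta> * norm ((x t + z) - (x t + w))"
    proof (rule differentiable_bound[OF convex_cball[of "x t" \<delta>]])
      fix y assume y: "y \<in> cball (x t) \<delta>"
      then have y': "y \<in> norm_cball N (x t) \<rho>" using \<delta>' by auto
      have "((\<lambda>y. F y t) has_derivative (\<lambda>h. G y t *v h)) (at y within cball (x t) \<delta>)"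
        using has_derivative_subset[OF G[OF t y'] \<delta>'] .
      moreover have "((\<lambda>y. G (x t) t *v y) has_derivative (\<lambda>h. G (x t) t *v h)) (at y within cball (x t) \<delta>)"
        by (rule bounded_linear_imp_has_derivative) (rule matrix_vector_mul_bounded_linear)
      ultimately show "((\<lambda>y. F y t - G (x t) t *v y) has_derivative (\<lambda>h. (G y t - G (x t) t) *v h))
          (at y within cball (x t) \<delta>)"
        by (simp add: matrix_vector_mult_diff_rdistrib has_derivative_diff)
      show "onorm (\<lambda>h. (G y t - G (x t) t) *v h) \<le> ?L * \<delta>"
      proof (rule onorm_le)
        fix h
        have "norm ((G y t - G (x t) t) *v h) \<le> ?L * norm (y - x t) * norm h"
          by (rule Glip'[OF t y' in_ball])
        also have "\<dots> \<le> ?L * \<delta> * norm h"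
          using y N by (intro mult_right_mono mult_left_mono) (auto simp: dist_norm norm_minus_commute)
        finally show "norm ((G y t - G (x t) t) *v h) \<le> ?L * \<delta> * norm h" .
      qed
    qed (use zw in \<open>auto simp: dist_norm\<close>)
    then show ?thesis by (simp add: J[OF t] algebra_simps)
  qed
  from 1 2 3 show ?thesis unfolding linearizable_def by blast
qed

lemma continuous_on_Icc_norm_bound:
  fixes f :: "real \<Rightarrow> 'a::real_normed_vector"
  assumes "continuous_on {a..b} f"
  obtains B where "0 < B" "\<And>t. t \<in> {a..b} \<Longrightarrow> norm (f t) \<le> B"
  using compact_imp_bounded[OF compact_continuous_image[OF assms compact_Icc]]
  by (auto simp: bounded_pos)

lemma continuous_on_if_less:
  fixes f g :: "real \<Rightarrow> 'a::topological_space"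
  assumes f: "continuous_on {a..c} f" and g: "continuous_on {c..b} g"
  shows "continuous_on ({a..b} - {c}) (\<lambda>t. if t < c then f t else g t)"
proof -
  let ?h = "\<lambda>t. if t < c then f t else g t"
  have split: "{a..b} - {c} = ({a..b} \<inter> {..<c}) \<union> ({a..b} \<inter> {c<..})" by auto
  show ?thesis
    unfolding split
  proof (rule continuous_on_Un_local_open)
    show "continuous_on ({a..b} \<inter> {..<c}) ?h"
      by (rule continuous_on_eq[OF continuous_on_subset[OF f]]) auto
    show "continuous_on ({a..b} \<inter> {c<..}) ?h"
      by (rule continuous_on_eq[OF continuous_on_subset[OF g]]) auto
    show "openin (top_of_set ({a..b} \<inter> {..<c} \<union> {a..b} \<inter> {c<..})) ({a..b} \<inter> {..<c})"
      unfolding openin_open by (rule exI[of _ "{..<c}"]) auto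
    show "openin (top_of_set ({a..b} \<inter> {..<c} \<union> {a..b} \<inter> {c<..})) ({a..b} \<inter> {c<..})"
      unfolding openin_open by (rule exI[of _ "{c<..}"]) auto
  qed
qed

lemma linearizable_continuous_on_comp:
  assumes F: "linearizable S x r L F" and z: "continuous_on R z" "\<And>t. t \<in> R \<Longrightarrow> norm (z t) \<le> r"
    and R: "R \<subseteq> S"
  shows "continuous_on R (\<lambda>t. F (x t + z t) t)"
proof -
  have "continuous_on (S \<times> cball 0 r) (\<lambda>(t, z). F (x t + z) t)"
    using F by (simp add: linearizable_def)
  then have "continuous_on R (\<lambda>t. (\<lambda>(t, z). F (x t + z) t) (t, z t))"
    by (rule continuous_on_compose2[where f = "\<lambda>t. (t, z t)"])
      (use z R in \<open>auto intro!: continuous_intros\<close>)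
  then show ?thesis by simp
qed

lemma linearizableD:
  assumes "linearizable S x r L F" "t \<in> S" "\<delta> \<le> r" "norm z \<le> \<delta>" "norm w \<le> \<delta>"
  shows "norm (F (x t + z) t - F (x t + w) t - jacobian_along F x t *v (z - w)) \<le> L * \<delta> * norm (z - w)"
  using assms unfolding linearizable_def by simp

section \<open>The remainder when the switch point moves\<close>

text \<open>The two time intervals overlap in \<open>{s - r..s + r}\<close>, so either vector field
  can be used between \<open>s\<close> and any \<open>\<sigma>\<close> within distance
  \<open>r\<close>.\<close>

locale switched_linearization =
  fixes T s r L :: real and F\<^sub>0 F\<^sub>1 :: "real ^ 'n \<Rightarrow> real \<Rightarrow> real ^ 'n"
    and x :: "real \<Rightarrow> real ^ 'n" and \<Phi> \<Psi> :: "real \<Rightarrow> real ^ 'n ^ 'n"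
  assumes r: "0 < r" "{s - r..s + r} \<subseteq> {0..T}" and L: "0 \<le> L"
    and lin\<^sub>0: "linearizable {0..s + r} x r L F\<^sub>0"
    and lin\<^sub>1: "linearizable {s - r..T} x r L F\<^sub>1"
    and x: "ac_solution T (switched F\<^sub>0 F\<^sub>1 s) x"
    and fundamental: "linear_system T (jacobian_along (switched F\<^sub>0 F\<^sub>1 s) x) \<Phi> \<Psi>"
begin

abbreviation A :: "real \<Rightarrow> real ^ 'n ^ 'n" where
  "A \<equiv> jacobian_along (switched F\<^sub>0 F\<^sub>1 s) x"

sublocale linear_system T A \<Phi> \<Psi>
  by (rule fundamental)

lemma A_eq: "A t = (if t < s then jacobian_along F\<^sub>0 x t else jacobian_along F\<^sub>1 x t)"
  by (simp add: jacobian_along_def switched_def)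

text \<open>Collects two errors: that of the Taylor expansion and that of using the other vector
  field between the switch points. The linear part keeps its switch at \<open>s\<close> for every
  \<open>\<sigma>\<close>, so one pair \<open>\<Phi>\<close>, \<open>\<Psi>\<close> serves all
  perturbations.\<close>

definition remainder :: "real \<Rightarrow> real ^ 'n \<Rightarrow> real \<Rightarrow> real ^ 'n" where
  "remainder \<sigma> z t = switched F\<^sub>0 F\<^sub>1 \<sigma> (x t + z) t - switched F\<^sub>0 F\<^sub>1 s (x t) t - A t *v z"

definition gap :: "real \<Rightarrow> real ^ 'n" where
  "gap t = F\<^sub>0 (x t) t - F\<^sub>1 (x t) t"

text \<open>Half-open to match the test \<open>t < \<sigma>\<close> in \<open>switched\<close>; the
  identity \<open>remainder_0\<close> then holds at the end points too.\<close>

definition between :: "real \<Rightarrow> real \<Rightarrow> real" where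
  "between \<sigma> = indicator {min s \<sigma>..<max s \<sigma>}"

lemma between_nonneg: "0 \<le> between \<sigma> t"
  by (simp add: between_def)

lemma has_integral_between:
  assumes "\<bar>\<sigma> - s\<bar> \<le> r"
  shows "(between \<sigma> has_integral \<bar>\<sigma> - s\<bar>) {0..T}"
proof -
  have sub: "{min s \<sigma>..max s \<sigma>} \<subseteq> {0..T}"
  proof -
    have "s - r \<le> min s \<sigma>" "max s \<sigma> \<le> s + r" using assms r(1) by auto
    then have "{min s \<sigma>..max s \<sigma>} \<subseteq> {s - r..s + r}" by simp
    with r(2) show ?thesis by (rule order_trans[rotated])
  qed
  have "((\<lambda>_. 1) has_integral \<bar>\<sigma> - s\<bar>) {min s \<sigma>..max s \<sigma>}"
    using has_integral_const_real[of "1::real" "min s \<sigma>" "max s \<sigma>"] by (auto simp: min_def max_def)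
  then have "((\<lambda>t. if t \<in> {min s \<sigma>..max s \<sigma>} then 1 else 0) has_integral \<bar>\<sigma> - s\<bar>) {0..T}"
    by (simp only: has_integral_restrict[OF sub])
  then show ?thesis
    by (rule has_integral_spike_finite[of "{max s \<sigma>}", rotated 2])
      (auto simp: between_def indicator_def)
qed

text \<open>On \<open>x\<close> itself there is no Taylor error. The sign tells which field replaces
  the other: \<open>F\<^sub>0\<close> if the switch is late, \<open>F\<^sub>1\<close> if it is
  early.\<close>

lemma remainder_0:
  assumes "\<bar>\<sigma> - s\<bar> \<le> r"
  shows "remainder \<sigma> 0 t = (sgn (\<sigma> - s) * between \<sigma> t) *\<^sub>R gap t"
  by (auto simp: remainder_def between_def gap_def switched_def indicator_def sgn_real_def)

lemma near_switch:
  assumes "\<bar>\<sigma> - s\<bar> \<le> r" "t \<in> {min s \<sigma>..<max s \<sigma>}"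
  shows "t \<in> {s - r..s + r}"
  using assms by (auto simp: min_def max_def split: if_splits)

lemma jacobian_gap_bound:
  obtains K where "0 \<le> K" "\<And>t v. t \<in> {s - r..s + r} \<Longrightarrow>
    norm (jacobian_along F\<^sub>0 x t *v v - jacobian_along F\<^sub>1 x t *v v) \<le> K * norm v"
proof -
  have "continuous_on {s - r..s + r} (\<lambda>t. jacobian_along F\<^sub>0 x t - jacobian_along F\<^sub>1 x t)"
    using lin\<^sub>0 lin\<^sub>1 r unfolding linearizable_def
    by (intro continuous_on_diff; elim conjE continuous_on_subset) auto
  then obtain B where B: "0 < B"
    "\<And>t. t \<in> {s - r..s + r} \<Longrightarrow> norm (jacobian_along F\<^sub>0 x t - jacobian_along F\<^sub>1 x t) \<le> B"
    by (rule continuous_on_Icc_norm_bound) blast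
  obtain B' where B': "0 < B'" "\<And>(M :: real^'n^'n) v. norm (M *v v) \<le> norm M * norm v * B'"
    using bounded_bilinear.pos_bounded[OF bounded_bilinear_matrix_vector_mult] by blast
  show thesis
  proof (rule that[of "B * B'"])
    fix t v assume "t \<in> {s - r..s + r}"
    then have "norm ((jacobian_along F\<^sub>0 x t - jacobian_along F\<^sub>1 x t) *v v) \<le> B * norm v * B'"
      using B' B by (intro order_trans[OF B'(2)] mult_right_mono) auto
    then show "norm (jacobian_along F\<^sub>0 x t *v v - jacobian_along F\<^sub>1 x t *v v) \<le> B * B' * norm v"
      by (simp add: matrix_vector_mult_diff_rdistrib algebra_simps)
  qed (use B B' in simp)
qed

lemma continuous_gap: "continuous_on {s - r..s + r} gap"
proof -
  have "continuous_on {s - r..s + r} (\<lambda>t. F\<^sub>0 (x t + 0) t - F\<^sub>1 (x t + 0) t)"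
    using r by (intro continuous_on_diff linearizable_continuous_on_comp[OF lin\<^sub>0]
      linearizable_continuous_on_comp[OF lin\<^sub>1]) (auto intro!: continuous_intros)
  then show ?thesis by (simp add: gap_def[abs_def])
qed

lemma gap_bound:
  obtains B where "0 \<le> B" "\<And>t. t \<in> {s - r..s + r} \<Longrightarrow> norm (gap t) \<le> B"
  using continuous_gap by (rule continuous_on_Icc_norm_bound) (use that less_imp_le in blast)

text \<open>Outside the interval between the switch points the active field and \<open>A\<close>
  belong together, and the Taylor bound applies. Inside it \<open>A\<close> is the Jacobian of the
  other field; the difference of the Jacobians, bounded by \<open>K\<close>, is the extra
  term.\<close>

lemma remainder_lipschitz:
  obtains K where "0 \<le> K" "\<And>\<sigma> t \<delta> z w. \<lbrakk>\<bar>\<sigma> - s\<bar> \<le> r; t \<in> {0..T}; \<delta> \<le> r; norm z \<le> \<delta>; norm w \<le> \<delta>\<rbrakk> \<Longrightarrow>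
    norm (remainder \<sigma> z t - remainder \<sigma> w t) \<le> (L * \<delta> + K * between \<sigma> t) * norm (z - w)"
proof -
  obtain K where K: "0 \<le> K" "\<And>t v. t \<in> {s - r..s + r} \<Longrightarrow>
    norm (jacobian_along F\<^sub>0 x t *v v - jacobian_along F\<^sub>1 x t *v v) \<le> K * norm v"
    by (rule jacobian_gap_bound) blast
  show thesis
  proof (rule that[OF K(1)])
    fix \<sigma> t \<delta> and z w :: "real^'n"
    assume \<sigma>: "\<bar>\<sigma> - s\<bar> \<le> r" and t: "t \<in> {0..T}" and \<delta>: "\<delta> \<le> r" and zw: "norm z \<le> \<delta>" "norm w \<le> \<delta>"
    have lin: "norm (F\<^sub>0 (x t + z) t - F\<^sub>0 (x t + w) t - jacobian_along F\<^sub>0 x t *v (z - w))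
        \<le> L * \<delta> * norm (z - w)" if "t < max s \<sigma>"
      using that \<sigma> t by (intro linearizableD[OF lin\<^sub>0 _ \<delta> zw]) auto
    have lin': "norm (F\<^sub>1 (x t + z) t - F\<^sub>1 (x t + w) t - jacobian_along F\<^sub>1 x t *v (z - w))
        \<le> L * \<delta> * norm (z - w)" if "\<not> t < min s \<sigma>"
      using that \<sigma> t by (intro linearizableD[OF lin\<^sub>1 _ \<delta> zw]) auto
    have diff: "remainder \<sigma> z t - remainder \<sigma> w t =
        switched F\<^sub>0 F\<^sub>1 \<sigma> (x t + z) t - switched F\<^sub>0 F\<^sub>1 \<sigma> (x t + w) t - A t *v (z - w)"
      by (simp add: remainder_def matrix_vector_mult_diff_distrib)
    consider "t < min s \<sigma>" | "\<not> t < max s \<sigma>" | "t \<in> {min s \<sigma>..<max s \<sigma>}" "s \<le> t" |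
       "t \<in> {min s \<sigma>..<max s \<sigma>}" "t < s" by force
    then show "norm (remainder \<sigma> z t - remainder \<sigma> w t) \<le> (L * \<delta> + K * between \<sigma> t) * norm (z - w)"
    proof cases
      case 1
      then show ?thesis
        using lin by (auto simp: diff switched_def A_eq between_def)
    next
      case 2
      then show ?thesis
        using lin' by (auto simp: diff switched_def A_eq between_def)
    next
      case 3
      have "remainder \<sigma> z t - remainder \<sigma> w t =
          (F\<^sub>0 (x t + z) t - F\<^sub>0 (x t + w) t - jacobian_along F\<^sub>0 x t *v (z - w))
          + (jacobian_along F\<^sub>0 x t *v (z - w) - jacobian_along F\<^sub>1 x t *v (z - w))"
        using 3 by (auto simp: diff switched_def A_eq)
      also have "norm \<dots> \<le> L * \<delta> * norm (z - w) + K * norm (z - w)"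
        using 3 by (intro norm_triangle_mono lin K near_switch[OF \<sigma>]) auto
      finally show ?thesis using 3 by (simp add: between_def distrib_right)
    next
      case 4
      have "remainder \<sigma> z t - remainder \<sigma> w t =
          (F\<^sub>1 (x t + z) t - F\<^sub>1 (x t + w) t - jacobian_along F\<^sub>1 x t *v (z - w))
          - (jacobian_along F\<^sub>0 x t *v (z - w) - jacobian_along F\<^sub>1 x t *v (z - w))"
        using 4 by (auto simp: diff switched_def A_eq)
      also have "norm \<dots> \<le> L * \<delta> * norm (z - w) + K * norm (z - w)"
        using 4 by (intro order_trans[OF norm_triangle_ineq4 add_mono] lin' K near_switch[OF \<sigma>]) auto
      finally show ?thesis using 4 by (simp add: between_def distrib_right)
    qed
  qed
qed

lemma continuous_remainder:
  assumes \<sigma>: "\<bar>\<sigma> - s\<bar> \<le> r" and z: "continuous_on {0..T} z" "\<And>t. t \<in> {0..T} \<Longrightarrow> norm (z t) \<le> r"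
  shows "continuous_on ({0..T} - {s, \<sigma>}) (\<lambda>t. remainder \<sigma> (z t) t)"
proof -
  have switched: "continuous_on ({0..T} - {c}) (\<lambda>t. switched F\<^sub>0 F\<^sub>1 c (x t + y t) t)"
    if "\<bar>c - s\<bar> \<le> r" "continuous_on {0..T} y" "\<And>t. t \<in> {0..T} \<Longrightarrow> norm (y t) \<le> r" for c y
    unfolding switched_def
    using that r by (intro continuous_on_if_less linearizable_continuous_on_comp[OF lin\<^sub>0]
      linearizable_continuous_on_comp[OF lin\<^sub>1]) (auto elim!: continuous_on_subset)
  have "continuous_on ({0..T} - {s}) A"
    unfolding A_eq[abs_def] using lin\<^sub>0 lin\<^sub>1 r unfolding linearizable_def
    by (intro continuous_on_if_less; elim conjE continuous_on_subset) auto
  then have "continuous_on ({0..T} - {s}) (\<lambda>t. A t *v z t)"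
    using z(1) by (intro bounded_bilinear.continuous_on[OF bounded_bilinear_matrix_vector_mult])
      (auto elim: continuous_on_subset)
  moreover have "continuous_on ({0..T} - {s}) (\<lambda>t. switched F\<^sub>0 F\<^sub>1 s (x t) t)"
    using r switched[of s "\<lambda>_. 0"] by simp
  moreover have "continuous_on ({0..T} - {\<sigma>}) (\<lambda>t. switched F\<^sub>0 F\<^sub>1 \<sigma> (x t + z t) t)"
    using \<sigma> z by (intro switched)
  ultimately show ?thesis
    unfolding remainder_def by (intro continuous_on_diff; (elim continuous_on_subset)?; auto)
qed

lemma remainder_bound:
  obtains K B where "0 \<le> K" "0 \<le> B"
    "\<And>\<sigma> t \<delta> z w. \<lbrakk>\<bar>\<sigma> - s\<bar> \<le> r; t \<in> {0..T}; \<delta> \<le> r; norm z \<le> \<delta>; norm w \<le> \<delta>\<rbrakk> \<Longrightarrow>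
      norm (remainder \<sigma> z t - remainder \<sigma> w t) \<le> (L * \<delta> + K * between \<sigma> t) * norm (z - w)"
    "\<And>\<sigma> t \<delta> z. \<lbrakk>\<bar>\<sigma> - s\<bar> \<le> r; t \<in> {0..T}; \<delta> \<le> r; norm z \<le> \<delta>\<rbrakk> \<Longrightarrow>
      norm (remainder \<sigma> z t) \<le> L * \<delta> * norm z + B * between \<sigma> t"
    "\<And>\<sigma> t. \<lbrakk>\<bar>\<sigma> - s\<bar> \<le> r; t \<in> {0..T}\<rbrakk> \<Longrightarrow> norm (remainder \<sigma> 0 t) \<le> B * between \<sigma> t"
proof -
  obtain K where K: "0 \<le> K" "\<And>\<sigma> t \<delta> z w. \<lbrakk>\<bar>\<sigma> - s\<bar> \<le> r; t \<in> {0..T}; \<delta> \<le> r; norm z \<le> \<delta>; norm w \<le> \<delta>\<rbrakk> \<Longrightarrow>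
    norm (remainder \<sigma> z t - remainder \<sigma> w t) \<le> (L * \<delta> + K * between \<sigma> t) * norm (z - w)"
    by (rule remainder_lipschitz) blast
  obtain M where M: "0 \<le> M" "\<And>t. t \<in> {s - r..s + r} \<Longrightarrow> norm (gap t) \<le> M"
    by (rule gap_bound) blast
  have zero: "norm (remainder \<sigma> 0 t) \<le> M * between \<sigma> t" if "\<bar>\<sigma> - s\<bar> \<le> r" for \<sigma> t
  proof (cases "t \<in> {min s \<sigma>..<max s \<sigma>}")
    case True
    then show ?thesis
      using M(2)[OF near_switch[OF that True]]
      by (auto simp: remainder_0[OF that] between_def abs_mult sgn_real_def)
  qed (auto simp: remainder_0[OF that] between_def)
  show thesis
  \<comment> \<open>\<open>M\<close> bounds the jump of the vector fields, and \<open>K * r\<close>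
    the Jacobian mismatch, as \<open>norm z \<le> r\<close>.\<close>
  proof (rule that[of K "M + K * r"])
    fix \<sigma> t \<delta> and z :: "real^'n"
    assume *: "\<bar>\<sigma> - s\<bar> \<le> r" "t \<in> {0..T}" "\<delta> \<le> r" "norm z \<le> \<delta>"
    have "norm (remainder \<sigma> z t) \<le> norm (remainder \<sigma> z t - remainder \<sigma> 0 t) + norm (remainder \<sigma> 0 t)"
      by (metis diff_add_cancel norm_triangle_ineq)
    also have "\<dots> \<le> (L * \<delta> + K * between \<sigma> t) * norm z + M * between \<sigma> t"
      using K(2)[OF *(1-4), of 0] zero[OF *(1), of t] *(4) norm_ge_zero[of z] by auto
    also have "\<dots> = L * \<delta> * norm z + (M + K * norm z) * between \<sigma> t"
      by (simp add: algebra_simps)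
    also have "\<dots> \<le> L * \<delta> * norm z + (M + K * r) * between \<sigma> t"
      using * K(1) by (intro add_left_mono mult_right_mono mult_left_mono between_nonneg) auto
    finally show "norm (remainder \<sigma> z t) \<le> L * \<delta> * norm z + (M + K * r) * between \<sigma> t" .
  next
    fix \<sigma> t assume "\<bar>\<sigma> - s\<bar> \<le> r"
    then have "norm (remainder \<sigma> 0 t) \<le> M * between \<sigma> t" by (rule zero)
    also have "\<dots> \<le> (M + K * r) * between \<sigma> t"
      using K(1) r(1) by (intro mult_right_mono between_nonneg) auto
    finally show "norm (remainder \<sigma> 0 t) \<le> (M + K * r) * between \<sigma> t" .
  qed (use K M r in auto)
qed

subsection \<open>A priori bound for perturbed solutions\<close>

lemma perturbation_solution:
  assumes "ac_solution T (switched F\<^sub>0 F\<^sub>1 \<sigma>) y"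
  shows "ac_solution T (\<lambda>v t. A t *v v + remainder \<sigma> (y t - x t) t) (\<lambda>t. y t - x t)"
proof -
  obtain Z where Z: "negligible Z" "absolutely_continuous_on {0..T} y" "\<And>t. t \<in> {0..T} - Z \<Longrightarrow>
      (y has_vector_derivative switched F\<^sub>0 F\<^sub>1 \<sigma> (y t) t) (at t within {0..T})"
    using assms by (rule ac_solutionE) blast
  obtain Z' where Z': "negligible Z'" "absolutely_continuous_on {0..T} x" "\<And>t. t \<in> {0..T} - Z' \<Longrightarrow>
      (x has_vector_derivative switched F\<^sub>0 F\<^sub>1 s (x t) t) (at t within {0..T})"
    using x by (rule ac_solutionE) blast
  show ?thesis
  proof (rule ac_solutionI)
    show "negligible (Z \<union> Z')" using Z Z' by (simp add: negligible_Un)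
    show "absolutely_continuous_on {0..T} (\<lambda>t. y t - x t)"
      using Z Z' by (simp add: absolutely_continuous_on_diff)
    fix t assume "t \<in> {0..T} - (Z \<union> Z')"
    then have "t \<in> {0..T} - Z" "t \<in> {0..T} - Z'" by auto
    from has_vector_derivative_diff[OF Z(3)[OF this(1)] Z'(3)[OF this(2)]]
    show "((\<lambda>t. y t - x t) has_vector_derivative
        A t *v (y t - x t) + remainder \<sigma> (y t - x t) t) (at t within {0..T})"
      by (simp add: remainder_def)
  qed
qed

lemma fundamental_bounds:
  obtains k\<^sub>\<Phi> k\<^sub>\<Psi> where "1 \<le> k\<^sub>\<Phi>" "1 \<le> k\<^sub>\<Psi>" "\<And>t v. t \<in> {0..T} \<Longrightarrow> norm (\<Phi> t *v v) \<le> k\<^sub>\<Phi> * norm v"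
    "\<And>t v. t \<in> {0..T} \<Longrightarrow> norm (v v* \<Psi> t) \<le> k\<^sub>\<Psi> * norm v"
proof -
  obtain B\<^sub>1 where B\<^sub>1: "0 < B\<^sub>1" "\<And>t. t \<in> {0..T} \<Longrightarrow> norm (\<Phi> t) \<le> B\<^sub>1"
    using continuous_\<Phi> by (rule continuous_on_Icc_norm_bound) blast
  obtain B\<^sub>2 where B\<^sub>2: "0 < B\<^sub>2" "\<And>t. t \<in> {0..T} \<Longrightarrow> norm (\<Psi> t) \<le> B\<^sub>2"
    using continuous_\<Psi> by (rule continuous_on_Icc_norm_bound) blast
  obtain C\<^sub>1 where C\<^sub>1: "0 < C\<^sub>1" "\<And>(M :: real^'n^'n) v. norm (M *v v) \<le> norm M * norm v * C\<^sub>1"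
    using bounded_bilinear.pos_bounded[OF bounded_bilinear_matrix_vector_mult] by blast
  obtain C\<^sub>2 where C\<^sub>2: "0 < C\<^sub>2" "\<And>(M :: real^'n^'n) v. norm (v v* M) \<le> norm M * norm v * C\<^sub>2"
    using bounded_bilinear.pos_bounded[OF bounded_bilinear_vector_matrix_mult] by blast
  show thesis
  proof (rule that[of "max 1 (B\<^sub>1 * C\<^sub>1)" "max 1 (B\<^sub>2 * C\<^sub>2)"])
    fix t and v :: "real^'n" assume t: "t \<in> {0..T}"
    have "norm (\<Phi> t *v v) \<le> B\<^sub>1 * norm v * C\<^sub>1"
      using B\<^sub>1 C\<^sub>1 t by (intro order_trans[OF C\<^sub>1(2)] mult_right_mono) auto
    also have "\<dots> = (B\<^sub>1 * C\<^sub>1) * norm v" by simp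
    also have "\<dots> \<le> max 1 (B\<^sub>1 * C\<^sub>1) * norm v" by (intro mult_right_mono) auto
    finally show "norm (\<Phi> t *v v) \<le> max 1 (B\<^sub>1 * C\<^sub>1) * norm v" .
    have "norm (v v* \<Psi> t) \<le> B\<^sub>2 * norm v * C\<^sub>2"
      using B\<^sub>2 C\<^sub>2 t by (intro order_trans[OF C\<^sub>2(2)] mult_right_mono) auto
    also have "\<dots> = (B\<^sub>2 * C\<^sub>2) * norm v" by simp
    also have "\<dots> \<le> max 1 (B\<^sub>2 * C\<^sub>2) * norm v" by (intro mult_right_mono) auto
    finally show "norm (v v* \<Psi> t) \<le> max 1 (B\<^sub>2 * C\<^sub>2) * norm v" .
  qed auto
qed

text \<open>Separates the two orders of magnitude: a bound valid at all times costs the factor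
  \<open>T\<close>, one active only between the switch points costs
  \<open>\<bar>\<sigma> - s\<bar>\<close>.\<close>

lemma has_integral_norm_bound_between:
  fixes f :: "real \<Rightarrow> 'a::euclidean_space"
  assumes f: "(f has_integral v) {0..t}" and t: "t \<in> {0..T}" and \<sigma>: "\<bar>\<sigma> - s\<bar> \<le> r"
    and ab: "0 \<le> a" "0 \<le> b" "\<And>\<tau>. \<tau> \<in> {0..t} \<Longrightarrow> norm (f \<tau>) \<le> a + b * between \<sigma> \<tau>"
  shows "norm v \<le> a * T + b * \<bar>\<sigma> - s\<bar>"
proof -
  let ?g = "\<lambda>\<tau>. a + b * between \<sigma> \<tau>"
  have "((\<lambda>_. a) has_integral a * T) {0..T}"
    using has_integral_const_real[of a 0 T] T_pos by (simp add: mult.commute)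
  from has_integral_add[OF this has_integral_mult_right[OF has_integral_between[OF \<sigma>], of b]]
  have g: "(?g has_integral (a * T + b * \<bar>\<sigma> - s\<bar>)) {0..T}" .
  have g': "?g integrable_on {0..t}"
    by (rule integrable_subinterval_real[OF has_integral_integrable[OF g]]) (use t in simp)
  have "norm (integral {0..t} f) \<le> integral {0..t} ?g"
    using f g' ab(3) by (intro integral_norm_bound_integral) auto
  also have "\<dots> \<le> integral {0..T} ?g"
    using t g g' ab(1,2) by (intro integral_subset_le) (auto intro!: add_nonneg_nonneg mult_nonneg_nonneg between_nonneg)
  finally show ?thesis using f g by (simp add: integral_unique)
qed

text \<open>For the continuity argument in \<open>perturbation_bound\<close>: up to the first time
  at which the level is reached, estimates valid inside the ball still apply.\<close>

lemma first_exit: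
  fixes g :: "real \<Rightarrow> real"
  assumes g: "continuous_on {0..T} g" and start: "g 0 < \<delta>" and t: "t \<in> {0..T}" "\<delta> \<le> g t"
  obtains u where "u \<in> {0..T}" "g u = \<delta>" "\<And>\<tau>. \<tau> \<in> {0..u} \<Longrightarrow> g \<tau> \<le> \<delta>"
proof -
  let ?S = "{\<tau> \<in> {0..T}. g \<tau> \<in> {\<delta>..}}"
  have S: "closed ?S" "?S \<noteq> {}" "bdd_below ?S"
    using t continuous_closed_preimage[OF g closed_atLeastAtMost closed_atLeast, of \<delta>]
    by (auto simp: vimage_def Int_def)
  define u where "u = Inf ?S"
  have u: "u \<in> {0..T}" "\<delta> \<le> g u"
    using closed_contains_Inf[OF S(2,3,1)] by (auto simp: u_def)
  have before: "g \<tau> < \<delta>" if "0 \<le> \<tau>" "\<tau> < u" for \<tau>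
  proof (rule ccontr)
    assume "\<not> g \<tau> < \<delta>"
    then have "\<tau> \<in> ?S" using that u by auto
    from cInf_lower[OF this S(3)] that show False by (simp add: u_def)
  qed
  have "continuous_on {0..u} g" using g u by (auto elim: continuous_on_subset)
  then obtain \<tau> where "0 \<le> \<tau>" "\<tau> \<le> u" "g \<tau> = \<delta>"
    using IVT'[of g 0 \<delta> u] start u by auto
  then have "g u = \<delta>" using before[of \<tau>] by (cases "\<tau> = u") auto
  with u(1) before show thesis by (intro that[of u]) (auto simp: less_le)
qed

text \<open>The solution \<open>y\<close> is not known to stay where the remainder is controlled. Up
  to a first exit from the ball of radius \<open>\<delta>\<close> the estimate \<open>step\<close>
  gives less than \<open>\<delta>\<close>, so there is no exit. Then the maximal deviation is at
  most \<open>c\<^sub>1 * \<bar>\<sigma> - s\<bar>\<close> plus half of itself.\<close>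

lemma perturbation_bound:
  obtains \<eta> c' where "0 < \<eta>" "0 \<le> c'" "\<eta> \<le> r" "c' * \<eta> \<le> r"
    "\<And>\<sigma> y t. \<lbrakk>\<bar>\<sigma> - s\<bar> < \<eta>; ac_solution T (switched F\<^sub>0 F\<^sub>1 \<sigma>) y; norm (y 0 - x 0) \<le> c * \<bar>\<sigma> - s\<bar>; t \<in> {0..T}\<rbrakk>
      \<Longrightarrow> norm (y t - x t) \<le> c' * \<bar>\<sigma> - s\<bar>"
proof -
  obtain k\<^sub>\<Phi> k\<^sub>\<Psi> where k: "1 \<le> k\<^sub>\<Phi>" "1 \<le> k\<^sub>\<Psi>" "\<And>t v. t \<in> {0..T} \<Longrightarrow> norm (\<Phi> t *v v) \<le> k\<^sub>\<Phi> * norm v"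
    "\<And>t v. t \<in> {0..T} \<Longrightarrow> norm (v v* \<Psi> t) \<le> k\<^sub>\<Psi> * norm v"
    by (rule fundamental_bounds) blast
  obtain B where B: "0 \<le> B" "\<And>\<sigma> t \<delta> z. \<lbrakk>\<bar>\<sigma> - s\<bar> \<le> r; t \<in> {0..T}; \<delta> \<le> r; norm z \<le> \<delta>\<rbrakk> \<Longrightarrow>
      norm (remainder \<sigma> z t) \<le> L * \<delta> * norm z + B * between \<sigma> t"
    by (rule remainder_bound) blast
  \<comment> \<open>\<open>\<kappa> * \<delta>\<close> is the factor with which a deviation
    reproduces itself through \<open>duhamel\<close>; \<open>\<delta>\<close> is chosen to make it
    at most 1/2.\<close>
  define \<kappa> where "\<kappa> = k\<^sub>\<Phi> * k\<^sub>\<Psi> * L * T"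
  have "0 \<le> \<kappa>" using k L T_pos by (simp add: \<kappa>_def)
  define \<delta> where "\<delta> = min r (1 / (2 * (\<kappa> + 1)))"
  have \<delta>: "0 < \<delta>" "\<delta> \<le> r" using r(1) \<open>0 \<le> \<kappa>\<close> by (auto simp: \<delta>_def)
  have "\<delta> * (2 * (\<kappa> + 1)) \<le> 1 / (2 * (\<kappa> + 1)) * (2 * (\<kappa> + 1))"
    using \<open>0 \<le> \<kappa>\<close> by (intro mult_right_mono) (auto simp: \<delta>_def)
  then have \<kappa>\<delta>: "\<kappa> * \<delta> \<le> 1 / 2" using \<open>0 \<le> \<kappa>\<close> \<delta>(1) by (simp add: algebra_simps)
  \<comment> \<open>Contribution of the initial value and of the jump, passed through
    \<open>\<Phi>\<close>. The sign of \<open>c\<close> is unknown, hence the absolute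
    value.\<close>
  define c\<^sub>1 where "c\<^sub>1 = k\<^sub>\<Phi> * (\<bar>c\<bar> + k\<^sub>\<Psi> * B)"
  have c\<^sub>1: "0 \<le> c\<^sub>1" "\<bar>c\<bar> \<le> c\<^sub>1"
  proof -
    have "\<bar>c\<bar> \<le> \<bar>c\<bar> + k\<^sub>\<Psi> * B" using k B by simp
    also have "\<dots> \<le> c\<^sub>1"
      using mult_right_mono[OF k(1), of "\<bar>c\<bar> + k\<^sub>\<Psi> * B"] k(2) B(1) by (simp add: c\<^sub>1_def)
    finally show "\<bar>c\<bar> \<le> c\<^sub>1" .
    then show "0 \<le> c\<^sub>1" by linarith
  qed
  \<comment> \<open>The added 1 makes \<open>2 * c\<^sub>1 * \<eta> < \<delta>\<close> strict, as
    the exit argument needs.\<close>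
  define \<eta> where "\<eta> = min r (\<delta> / (2 * (c\<^sub>1 + 1)))"
  have \<eta>: "0 < \<eta>" "\<eta> \<le> r" using r(1) \<delta> c\<^sub>1 by (auto simp: \<eta>_def)
  have "\<eta> * (2 * (c\<^sub>1 + 1)) \<le> \<delta> / (2 * (c\<^sub>1 + 1)) * (2 * (c\<^sub>1 + 1))"
    using c\<^sub>1 by (intro mult_right_mono) (auto simp: \<eta>_def)
  then have "\<eta> * (2 * (c\<^sub>1 + 1)) \<le> \<delta>" using c\<^sub>1 by simp
  then have c\<^sub>1\<eta>: "2 * c\<^sub>1 * \<eta> < \<delta>" using \<eta>(1) by (simp add: algebra_simps)
  have main: "norm (y t - x t) \<le> 2 * c\<^sub>1 * \<bar>\<sigma> - s\<bar>"
    if \<sigma>: "\<bar>\<sigma> - s\<bar> < \<eta>" and y: "ac_solution T (switched F\<^sub>0 F\<^sub>1 \<sigma>) y"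
      and y0: "norm (y 0 - x 0) \<le> c * \<bar>\<sigma> - s\<bar>" and t: "t \<in> {0..T}" for \<sigma> y t
  proof -
    define z where "z t = y t - x t" for t
    have \<sigma>r: "\<bar>\<sigma> - s\<bar> \<le> r" using \<sigma> \<eta> by simp
    have sol: "ac_solution T (\<lambda>v t. A t *v v + remainder \<sigma> (z t) t) z"
      using perturbation_solution[OF y] by (simp add: z_def[abs_def])
    have contz: "continuous_on {0..T} (\<lambda>t. norm (z t))"
      using sol unfolding ac_solution_def
      by (intro continuous_on_norm absolutely_continuous_on_imp_continuous_on) simp
    \<comment> \<open>\<open>\<mu>\<close> is kept apart from \<open>\<delta>\<close>: the exit
      argument takes \<open>\<mu> = \<delta>\<close>, the final bound takes the maximal
      deviation.\<close>
    have step: "norm (z u) \<le> c\<^sub>1 * \<bar>\<sigma> - s\<bar> + \<mu> / 2"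
      if u: "u \<in> {0..T}" and \<mu>: "0 \<le> \<mu>" "\<mu> \<le> \<delta>" "\<And>\<tau>. \<tau> \<in> {0..u} \<Longrightarrow> norm (z \<tau>) \<le> \<mu>" for u \<mu>
    proof -
      have "norm (z u v* \<Psi> u - z 0) \<le> (k\<^sub>\<Psi> * (L * \<delta> * \<mu>)) * T + (k\<^sub>\<Psi> * B) * \<bar>\<sigma> - s\<bar>"
      proof (rule has_integral_norm_bound_between[OF duhamel[OF sol u] u \<sigma>r])
        fix \<tau> assume \<tau>: "\<tau> \<in> {0..u}"
        then have \<tau>T: "\<tau> \<in> {0..T}" using u by auto
        have "norm (remainder \<sigma> (z \<tau>) \<tau> v* \<Psi> \<tau>) \<le> k\<^sub>\<Psi> * norm (remainder \<sigma> (z \<tau>) \<tau>)"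
          by (rule k(4)[OF \<tau>T])
        also have "\<dots> \<le> k\<^sub>\<Psi> * (L * \<delta> * norm (z \<tau>) + B * between \<sigma> \<tau>)"
          using \<mu>(2) \<mu>(3)[OF \<tau>] \<delta> k(2) by (intro mult_left_mono B(2)[OF \<sigma>r \<tau>T]) auto
        also have "\<dots> \<le> k\<^sub>\<Psi> * (L * \<delta> * \<mu> + B * between \<sigma> \<tau>)"
          using \<mu>(3)[OF \<tau>] L \<delta> k(2) by (intro mult_left_mono add_right_mono) auto
        finally show "norm (remainder \<sigma> (z \<tau>) \<tau> v* \<Psi> \<tau>)
            \<le> k\<^sub>\<Psi> * (L * \<delta> * \<mu>) + k\<^sub>\<Psi> * B * between \<sigma> \<tau>"
          by (simp add: algebra_simps)
      qed (use k L \<delta> \<mu> B in auto)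
      moreover have "norm (z u v* \<Psi> u) \<le> norm (z u v* \<Psi> u - z 0) + norm (z 0)"
        by (metis diff_add_cancel norm_triangle_ineq)
      moreover have "norm (z 0) \<le> \<bar>c\<bar> * \<bar>\<sigma> - s\<bar>"
        using y0 unfolding z_def by (rule order_trans) (intro mult_right_mono; simp)
      ultimately have "norm (z u v* \<Psi> u)
          \<le> \<bar>c\<bar> * \<bar>\<sigma> - s\<bar> + (k\<^sub>\<Psi> * (L * \<delta> * \<mu>)) * T + (k\<^sub>\<Psi> * B) * \<bar>\<sigma> - s\<bar>"
        by linarith
      then have "k\<^sub>\<Phi> * norm (z u v* \<Psi> u)
          \<le> k\<^sub>\<Phi> * (\<bar>c\<bar> * \<bar>\<sigma> - s\<bar> + (k\<^sub>\<Psi> * (L * \<delta> * \<mu>)) * T + (k\<^sub>\<Psi> * B) * \<bar>\<sigma> - s\<bar>)"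
        using k(1) by (intro mult_left_mono) auto
      also have "\<dots> = c\<^sub>1 * \<bar>\<sigma> - s\<bar> + (\<kappa> * \<delta>) * \<mu>"
        by (simp add: c\<^sub>1_def \<kappa>_def algebra_simps)
      also have "\<dots> \<le> c\<^sub>1 * \<bar>\<sigma> - s\<bar> + (1 / 2) * \<mu>"
        using \<kappa>\<delta> \<mu> by (intro add_left_mono mult_right_mono) auto
      finally show ?thesis
        using k(3)[OF u, of "z u v* \<Psi> u"] by (simp add: \<Phi>_transpose_\<Psi>[OF u])
    qed
    have c\<^sub>1\<sigma>: "2 * c\<^sub>1 * \<bar>\<sigma> - s\<bar> < \<delta>"
      by (rule le_less_trans[OF _ c\<^sub>1\<eta>]) (use \<sigma> c\<^sub>1 in \<open>auto intro: mult_left_mono\<close>)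
    have start: "norm (z 0) < \<delta>"
    proof -
      have "norm (z 0) \<le> c\<^sub>1 * \<bar>\<sigma> - s\<bar>"
        using y0 unfolding z_def by (rule order_trans) (use c\<^sub>1 in \<open>intro mult_right_mono; simp\<close>)
      moreover have "0 \<le> c\<^sub>1 * \<bar>\<sigma> - s\<bar>" using c\<^sub>1 by simp
      ultimately show ?thesis using c\<^sub>1\<sigma> by linarith
    qed
    have small: "norm (z t) < \<delta>" if t: "t \<in> {0..T}" for t
    proof (rule ccontr)
      assume "\<not> norm (z t) < \<delta>"
      then obtain u where u: "u \<in> {0..T}" "norm (z u) = \<delta>" "\<And>\<tau>. \<tau> \<in> {0..u} \<Longrightarrow> norm (z \<tau>) \<le> \<delta>"
        using first_exit[OF contz start t] by (metis not_less)
      from step[OF u(1) _ order_refl u(3)] u(2) \<delta>(1) c\<^sub>1\<sigma> show False by auto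
    qed
    obtain u where u: "u \<in> {0..T}" "\<And>\<tau>. \<tau> \<in> {0..T} \<Longrightarrow> norm (z \<tau>) \<le> norm (z u)"
      using continuous_attains_sup[OF compact_Icc _ contz] T_pos by auto
    have "norm (z u) \<le> c\<^sub>1 * \<bar>\<sigma> - s\<bar> + norm (z u) / 2"
      using u small[OF u(1)] by (intro step) auto
    with u(2)[OF t] show ?thesis by (simp add: z_def)
  qed
  show thesis
  proof (rule that[of \<eta> "2 * c\<^sub>1"])
    show "norm (y t - x t) \<le> 2 * c\<^sub>1 * \<bar>\<sigma> - s\<bar>"
      if "\<bar>\<sigma> - s\<bar> < \<eta>" "ac_solution T (switched F\<^sub>0 F\<^sub>1 \<sigma>) y" "norm (y 0 - x 0) \<le> c * \<bar>\<sigma> - s\<bar>" "t \<in> {0..T}"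
      for \<sigma> y t
      using that by (rule main)
  qed (use \<eta> c\<^sub>1 c\<^sub>1\<eta> \<delta> in auto)
qed

subsection \<open>Expansion of the objective\<close>

lemma adjoint_inner: "(\<Psi> t *v v) \<bullet> w = v \<bullet> (w v* \<Psi> t)"
  by (metis dot_lmul_matrix inner_commute)

text \<open>\<open>q\<close> plays the role of \<open>p 0\<close>. Replacing the deviation by 0 in
  the remainder costs only second order in \<open>\<bar>\<sigma> - s\<bar>\<close>: the deviation is
  of first order, and its coefficient is itself of first order except on the short interval. The
  jump term that is left is compared with its value at \<open>s\<close> by continuity.\<close>

lemma pairing_expansion:
  assumes "0 < \<epsilon>"
  obtains \<eta> where "0 < \<eta>"
    "\<And>\<sigma> y. \<lbrakk>\<bar>\<sigma> - s\<bar> < \<eta>; ac_solution T (switched F\<^sub>0 F\<^sub>1 \<sigma>) y; norm (y 0 - x 0) \<le> c * \<bar>\<sigma> - s\<bar>\<rbrakk> \<Longrightarrow>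
      \<bar>(\<Psi> T *v q) \<bullet> (y T - x T) - q \<bullet> (y 0 - x 0) - (\<sigma> - s) * ((\<Psi> s *v q) \<bullet> gap s)\<bar> \<le> \<epsilon> * \<bar>\<sigma> - s\<bar>"
proof -
  obtain \<eta>\<^sub>1 c' where \<eta>\<^sub>1: "0 < \<eta>\<^sub>1" "0 \<le> c'" "\<eta>\<^sub>1 \<le> r" "c' * \<eta>\<^sub>1 \<le> r"
    and c': "\<And>\<sigma> y t. \<lbrakk>\<bar>\<sigma> - s\<bar> < \<eta>\<^sub>1; ac_solution T (switched F\<^sub>0 F\<^sub>1 \<sigma>) y; norm (y 0 - x 0) \<le> c * \<bar>\<sigma> - s\<bar>;
      t \<in> {0..T}\<rbrakk> \<Longrightarrow> norm (y t - x t) \<le> c' * \<bar>\<sigma> - s\<bar>"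
    by (rule perturbation_bound) blast
  obtain k\<^sub>\<Psi> where k: "1 \<le> k\<^sub>\<Psi>" "\<And>t v. t \<in> {0..T} \<Longrightarrow> norm (v v* \<Psi> t) \<le> k\<^sub>\<Psi> * norm v"
    by (rule fundamental_bounds) blast
  obtain K where K: "0 \<le> K" "\<And>\<sigma> t \<delta> z w. \<lbrakk>\<bar>\<sigma> - s\<bar> \<le> r; t \<in> {0..T}; \<delta> \<le> r; norm z \<le> \<delta>; norm w \<le> \<delta>\<rbrakk> \<Longrightarrow>
      norm (remainder \<sigma> z t - remainder \<sigma> w t) \<le> (L * \<delta> + K * between \<sigma> t) * norm (z - w)"
    by (rule remainder_lipschitz) blast
  \<comment> \<open>Pairing of the adjoint solution with the jump; \<open>\<phi> s\<close> becomes
    the difference of the Hamiltonians.\<close>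
  define \<phi> where "\<phi> t = q \<bullet> (gap t v* \<Psi> t)" for t
  have cont: "continuous_on {s - r..s + r} \<phi>"
    unfolding \<phi>_def using continuous_\<Psi> continuous_gap r(2)
    by (intro continuous_on_inner continuous_on_const
      bounded_bilinear.continuous_on[OF bounded_bilinear_vector_matrix_mult])
      (auto elim: continuous_on_subset)
  have "s \<in> {s - r..s + r}" "0 < \<epsilon> / 2" using r(1) assms by auto
  then obtain d where d: "0 < d" "\<And>t. \<lbrakk>t \<in> {s - r..s + r}; \<bar>t - s\<bar> < d\<rbrakk> \<Longrightarrow> \<bar>\<phi> t - \<phi> s\<bar> < \<epsilon> / 2"
    using cont[unfolded continuous_on_iff dist_real_def, THEN bspec, THEN spec, THEN mp] by blast
  define k where "k = norm q * k\<^sub>\<Psi>"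
  have "0 \<le> k" using k(1) by (simp add: k_def)
  \<comment> \<open>Coefficient of the quadratic error once
    \<open>\<mu> = c' * \<bar>\<sigma> - s\<bar>\<close> is inserted. The choice of
    \<open>\<eta>\<close> makes this error at most
    \<open>\<epsilon> / 2 * \<bar>\<sigma> - s\<bar>\<close>; the other half is left for the
    variation of \<open>\<phi>\<close>.\<close>
  define W where "W = k * L * c' * c' * T + k * K * c'"
  have "0 \<le> W" using \<open>0 \<le> k\<close> L \<eta>\<^sub>1 K T_pos by (simp add: W_def)
  define \<eta> where "\<eta> = min (min \<eta>\<^sub>1 d) (\<epsilon> / (2 * (W + 1)))"
  have \<eta>: "0 < \<eta>" "\<eta> \<le> \<eta>\<^sub>1" "\<eta> \<le> d" "\<eta> \<le> \<epsilon> / (2 * (W + 1))"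
    using \<eta>\<^sub>1 d assms \<open>0 \<le> W\<close> by (auto simp: \<eta>_def)
  have "\<eta> * (2 * (W + 1)) \<le> \<epsilon> / (2 * (W + 1)) * (2 * (W + 1))"
    using \<open>0 \<le> W\<close> \<eta>(4) by (intro mult_right_mono) auto
  then have "\<eta> * (2 * (W + 1)) \<le> \<epsilon>" using \<open>0 \<le> W\<close> by simp
  then have W\<eta>: "W * \<eta> \<le> \<epsilon> / 2" using \<eta>(1) by (simp add: algebra_simps)
  show thesis
  proof (rule that[OF \<eta>(1)])
    fix \<sigma> y assume \<sigma>: "\<bar>\<sigma> - s\<bar> < \<eta>" and y: "ac_solution T (switched F\<^sub>0 F\<^sub>1 \<sigma>) y"
      and y0: "norm (y 0 - x 0) \<le> c * \<bar>\<sigma> - s\<bar>"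
    define z where "z t = y t - x t" for t
    define \<mu> where "\<mu> = c' * \<bar>\<sigma> - s\<bar>"
    have \<sigma>r: "\<bar>\<sigma> - s\<bar> \<le> r" using \<sigma> \<eta> \<eta>\<^sub>1 by simp
    have z: "norm (z t) \<le> \<mu>" if "t \<in> {0..T}" for t
      using c'[OF _ y y0 that] \<sigma> \<eta> by (simp add: z_def \<mu>_def)
    have "\<mu> \<le> c' * \<eta>\<^sub>1" unfolding \<mu>_def using \<sigma> \<eta> \<eta>\<^sub>1 by (intro mult_left_mono) auto
    then have \<mu>: "0 \<le> \<mu>" "\<mu> \<le> r" using \<eta>\<^sub>1 by (auto simp: \<mu>_def)
    have sol: "ac_solution T (\<lambda>v t. A t *v v + remainder \<sigma> (z t) t) z"
      using perturbation_solution[OF y] by (simp add: z_def[abs_def])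
    have T: "T \<in> {0..T}" using T_pos by simp
    have 1: "((\<lambda>t. q \<bullet> (remainder \<sigma> (z t) t v* \<Psi> t)) has_integral q \<bullet> (z T v* \<Psi> T - z 0)) {0..T}"
      using has_integral_linear[OF duhamel[OF sol T] bounded_linear_inner_right[of q]]
      by (simp add: comp_def)
    \<comment> \<open>Reference integral with \<open>\<phi>\<close> frozen at \<open>s\<close>; its
      value is exactly the main term.\<close>
    have 2: "((\<lambda>t. sgn (\<sigma> - s) * \<phi> s * between \<sigma> t) has_integral sgn (\<sigma> - s) * \<phi> s * \<bar>\<sigma> - s\<bar>) {0..T}"
      by (rule has_integral_mult_right[OF has_integral_between[OF \<sigma>r]])
    have "sgn (\<sigma> - s) * \<phi> s * \<bar>\<sigma> - s\<bar> = (\<sigma> - s) * \<phi> s"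
      by (simp add: sgn_real_def)
    with has_integral_diff[OF 1 2]
    have "((\<lambda>t. q \<bullet> (remainder \<sigma> (z t) t v* \<Psi> t) - sgn (\<sigma> - s) * \<phi> s * between \<sigma> t) has_integral
        q \<bullet> (z T v* \<Psi> T - z 0) - (\<sigma> - s) * \<phi> s) {0..T}"
      by simp
    then have "norm (q \<bullet> (z T v* \<Psi> T - z 0) - (\<sigma> - s) * \<phi> s)
        \<le> k * (L * \<mu> * \<mu>) * T + (k * K * \<mu> + \<epsilon> / 2) * \<bar>\<sigma> - s\<bar>"
    proof (rule has_integral_norm_bound_between[OF _ T \<sigma>r])
      fix t assume t: "t \<in> {0..T}"
      let ?v = "remainder \<sigma> (z t) t - remainder \<sigma> 0 t"
      interpret bv: bounded_bilinear "\<lambda>(M :: real^'n^'n) v. v v* M"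
        by (rule bounded_bilinear_vector_matrix_mult)
      have "remainder \<sigma> (z t) t = ?v + (sgn (\<sigma> - s) * between \<sigma> t) *\<^sub>R gap t"
        by (simp add: remainder_0[OF \<sigma>r])
      then have "q \<bullet> (remainder \<sigma> (z t) t v* \<Psi> t) = q \<bullet> (?v v* \<Psi> t) + sgn (\<sigma> - s) * between \<sigma> t * \<phi> t"
        by (metis bv.add_right bv.scaleR_right inner_add_right inner_scaleR_right \<phi>_def)
      then have eq: "q \<bullet> (remainder \<sigma> (z t) t v* \<Psi> t) - sgn (\<sigma> - s) * \<phi> s * between \<sigma> t =
          q \<bullet> (?v v* \<Psi> t) + sgn (\<sigma> - s) * between \<sigma> t * (\<phi> t - \<phi> s)"
        by (simp add: algebra_simps)
      have "norm ?v \<le> (L * \<mu> + K * between \<sigma> t) * \<mu>"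
      proof -
        have "norm ?v \<le> (L * \<mu> + K * between \<sigma> t) * norm (z t)"
          using K(2)[OF \<sigma>r t \<mu>(2) z[OF t], of 0] \<mu>(1) by simp
        also have "\<dots> \<le> (L * \<mu> + K * between \<sigma> t) * \<mu>"
          using z[OF t] L \<mu>(1) K(1) between_nonneg by (intro mult_left_mono) auto
        finally show ?thesis .
      qed
      then have "norm q * norm (?v v* \<Psi> t) \<le> norm q * (k\<^sub>\<Psi> * ((L * \<mu> + K * between \<sigma> t) * \<mu>))"
        using k(1) by (intro mult_left_mono order_trans[OF k(2)[OF t]]) auto
      then have b1: "norm (q \<bullet> (?v v* \<Psi> t)) \<le> k * (L * \<mu> * \<mu>) + k * K * \<mu> * between \<sigma> t"
        using Cauchy_Schwarz_ineq2[of q "?v v* \<Psi> t"] by (simp add: k_def algebra_simps)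
      have b2: "norm (sgn (\<sigma> - s) * between \<sigma> t * (\<phi> t - \<phi> s)) \<le> \<epsilon> / 2 * between \<sigma> t"
      proof (cases "t \<in> {min s \<sigma>..<max s \<sigma>}")
        case True
        then have "\<bar>t - s\<bar> < d" using \<sigma> \<eta> by (auto simp: min_def max_def split: if_splits)
        with d(2)[OF near_switch[OF \<sigma>r True]] True assms show ?thesis
          by (auto simp: between_def abs_mult sgn_real_def)
      qed (simp add: between_def)
      show "norm (q \<bullet> (remainder \<sigma> (z t) t v* \<Psi> t) - sgn (\<sigma> - s) * \<phi> s * between \<sigma> t)
          \<le> k * (L * \<mu> * \<mu>) + (k * K * \<mu> + \<epsilon> / 2) * between \<sigma> t"
        unfolding eq using norm_triangle_mono[OF b1 b2] by (simp add: algebra_simps)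
    qed (use \<open>0 \<le> k\<close> K L \<mu> assms in auto)
    also have "\<dots> = W * \<bar>\<sigma> - s\<bar> * \<bar>\<sigma> - s\<bar> + \<epsilon> / 2 * \<bar>\<sigma> - s\<bar>"
      by (simp add: W_def \<mu>_def algebra_simps)
    also have "\<dots> \<le> \<epsilon> / 2 * \<bar>\<sigma> - s\<bar> + \<epsilon> / 2 * \<bar>\<sigma> - s\<bar>"
    proof (intro add_right_mono mult_right_mono)
      have "W * \<bar>\<sigma> - s\<bar> \<le> W * \<eta>" using \<sigma> \<open>0 \<le> W\<close> by (intro mult_left_mono) auto
      with W\<eta> show "W * \<bar>\<sigma> - s\<bar> \<le> \<epsilon> / 2" by linarith
    qed simp
    finally have "norm (q \<bullet> (z T v* \<Psi> T - z 0) - (\<sigma> - s) * \<phi> s) \<le> \<epsilon> * \<bar>\<sigma> - s\<bar>"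
      by simp
    moreover have "q \<bullet> (z T v* \<Psi> T - z 0) = (\<Psi> T *v q) \<bullet> (y T - x T) - q \<bullet> (y 0 - x 0)"
      by (simp only: adjoint_inner z_def inner_diff_right[of q "(y T - x T) v* \<Psi> T"])
    moreover have "\<phi> s = (\<Psi> s *v q) \<bullet> gap s" by (simp only: adjoint_inner \<phi>_def)
    ultimately show "\<bar>(\<Psi> T *v q) \<bullet> (y T - x T) - q \<bullet> (y 0 - x 0) - (\<sigma> - s) * ((\<Psi> s *v q) \<bullet> gap s)\<bar>
        \<le> \<epsilon> * \<bar>\<sigma> - s\<bar>"
      by simp
  qed
qed

text \<open>The two conditions on \<open>q\<close> are what the boundary conditions provide for the
  costate; they reduce the first-order change of \<open>C\<close> to
  \<open>pairing_expansion\<close>. Since \<open>nhds s\<close> includes \<open>s\<close>, the a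
  priori bound at \<open>\<sigma> = s\<close> forces \<open>X s T = x T\<close>.\<close>

lemma objective_derivative:
  assumes C: "(C has_derivative C') (at (x T))"
    and X: "\<forall>\<^sub>F \<sigma> in nhds s. ac_solution T (switched F\<^sub>0 F\<^sub>1 \<sigma>) (X \<sigma>) \<and> norm (X \<sigma> 0 - x 0) \<le> c * \<bar>\<sigma> - s\<bar> \<and>
      q \<bullet> (X \<sigma> 0 - x 0) = 0 \<and> C' (X \<sigma> T - x T) = (\<Psi> T *v q) \<bullet> (X \<sigma> T - x T)"
  shows "X s T = x T"
    and "((\<lambda>\<sigma>. C (X \<sigma> T)) has_real_derivative (\<Psi> s *v q) \<bullet> gap s) (at s)"
proof -
  obtain d\<^sub>0 where d\<^sub>0: "0 < d\<^sub>0" and "\<And>\<sigma>. \<bar>\<sigma> - s\<bar> < d\<^sub>0 \<Longrightarrow>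
      ac_solution T (switched F\<^sub>0 F\<^sub>1 \<sigma>) (X \<sigma>) \<and> norm (X \<sigma> 0 - x 0) \<le> c * \<bar>\<sigma> - s\<bar> \<and>
      q \<bullet> (X \<sigma> 0 - x 0) = 0 \<and> C' (X \<sigma> T - x T) = (\<Psi> T *v q) \<bullet> (X \<sigma> T - x T)"
    using X unfolding eventually_nhds_metric dist_real_def by blast
  then have sol: "ac_solution T (switched F\<^sub>0 F\<^sub>1 \<sigma>) (X \<sigma>)" "norm (X \<sigma> 0 - x 0) \<le> c * \<bar>\<sigma> - s\<bar>"
      "q \<bullet> (X \<sigma> 0 - x 0) = 0" "C' (X \<sigma> T - x T) = (\<Psi> T *v q) \<bullet> (X \<sigma> T - x T)"
    if "\<bar>\<sigma> - s\<bar> < d\<^sub>0" for \<sigma>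
    using that by auto
  obtain \<eta>\<^sub>1 c' where \<eta>\<^sub>1: "0 < \<eta>\<^sub>1" "0 \<le> c'"
    and c': "\<And>\<sigma> y t. \<lbrakk>\<bar>\<sigma> - s\<bar> < \<eta>\<^sub>1; ac_solution T (switched F\<^sub>0 F\<^sub>1 \<sigma>) y; norm (y 0 - x 0) \<le> c * \<bar>\<sigma> - s\<bar>;
      t \<in> {0..T}\<rbrakk> \<Longrightarrow> norm (y t - x t) \<le> c' * \<bar>\<sigma> - s\<bar>"
    by (rule perturbation_bound) blast
  have bound: "norm (X \<sigma> T - x T) \<le> c' * \<bar>\<sigma> - s\<bar>" if "\<bar>\<sigma> - s\<bar> < min d\<^sub>0 \<eta>\<^sub>1" for \<sigma>
    using that T_pos by (intro c' sol) auto
  show Xs: "X s T = x T" using bound[of s] d\<^sub>0 \<eta>\<^sub>1 by simp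
  let ?D = "(\<Psi> s *v q) \<bullet> gap s"
  show "((\<lambda>\<sigma>. C (X \<sigma> T)) has_real_derivative ?D) (at s)"
    unfolding has_field_derivative_def has_derivative_at_alt
  proof (intro conjI allI impI)
    fix e :: real assume "0 < e"
    then have "0 < e / 2" "0 < e / (2 * (c' + 1))" using \<eta>\<^sub>1 by auto
    obtain \<eta>\<^sub>2 where \<eta>\<^sub>2: "0 < \<eta>\<^sub>2" "\<And>\<sigma> y. \<lbrakk>\<bar>\<sigma> - s\<bar> < \<eta>\<^sub>2; ac_solution T (switched F\<^sub>0 F\<^sub>1 \<sigma>) y;
        norm (y 0 - x 0) \<le> c * \<bar>\<sigma> - s\<bar>\<rbrakk> \<Longrightarrow>
        \<bar>(\<Psi> T *v q) \<bullet> (y T - x T) - q \<bullet> (y 0 - x 0) - (\<sigma> - s) * ?D\<bar> \<le> e / 2 * \<bar>\<sigma> - s\<bar>"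
      by (rule pairing_expansion[OF \<open>0 < e / 2\<close>]) blast
    obtain d where d: "0 < d" "\<And>v. norm (v - x T) < d \<Longrightarrow>
        norm (C v - C (x T) - C' (v - x T)) \<le> e / (2 * (c' + 1)) * norm (v - x T)"
      using C \<open>0 < e / (2 * (c' + 1))\<close> unfolding has_derivative_at_alt by blast
    \<comment> \<open>The last entry keeps \<open>X \<sigma> T\<close> where \<open>C\<close> is
      approximated by its derivative; \<open>c' + 1\<close> avoids division by 0.\<close>
    define \<eta> where "\<eta> = min (min (min d\<^sub>0 \<eta>\<^sub>1) \<eta>\<^sub>2) (d / (c' + 1))"
    have "0 < \<eta>" using d\<^sub>0 \<eta>\<^sub>1 \<eta>\<^sub>2 d by (simp add: \<eta>_def)
    moreover have "norm (C (X \<sigma> T) - C (X s T) - ?D * (\<sigma> - s)) \<le> e * norm (\<sigma> - s)"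
      if "norm (\<sigma> - s) < \<eta>" for \<sigma>
    proof -
      have \<sigma>: "\<bar>\<sigma> - s\<bar> < d\<^sub>0" "\<bar>\<sigma> - s\<bar> < min d\<^sub>0 \<eta>\<^sub>1" "\<bar>\<sigma> - s\<bar> < \<eta>\<^sub>2" "\<bar>\<sigma> - s\<bar> < d / (c' + 1)"
        using that by (auto simp: \<eta>_def)
      let ?z = "X \<sigma> T - x T"
      have "c' * \<bar>\<sigma> - s\<bar> \<le> (c' + 1) * \<bar>\<sigma> - s\<bar>" by (intro mult_right_mono) auto
      moreover have "(c' + 1) * \<bar>\<sigma> - s\<bar> < d" using \<sigma>(4) \<eta>\<^sub>1 by (simp add: field_simps)
      ultimately have z: "norm ?z \<le> (c' + 1) * \<bar>\<sigma> - s\<bar>" "norm ?z < d"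
        using bound[OF \<sigma>(2)] by auto
      have "norm (C (X \<sigma> T) - C (x T) - C' ?z) \<le> e / (2 * (c' + 1)) * norm ?z"
        by (rule d(2)[OF z(2)])
      also have "\<dots> \<le> e / (2 * (c' + 1)) * ((c' + 1) * \<bar>\<sigma> - s\<bar>)"
        using \<open>0 < e / (2 * (c' + 1))\<close> z(1) by (intro mult_left_mono) auto
      also have "\<dots> = e / 2 * \<bar>\<sigma> - s\<bar>" using \<eta>\<^sub>1 by (simp add: field_simps)
      finally have 1: "norm (C (X \<sigma> T) - C (x T) - C' ?z) \<le> e / 2 * \<bar>\<sigma> - s\<bar>" .
      have 2: "\<bar>C' ?z - (\<sigma> - s) * ?D\<bar> \<le> e / 2 * \<bar>\<sigma> - s\<bar>"
        using \<eta>\<^sub>2(2)[OF \<sigma>(3) sol(1,2)[OF \<sigma>(1)]] sol(3,4)[OF \<sigma>(1)] by simp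
      have "C (X \<sigma> T) - C (X s T) - ?D * (\<sigma> - s)
          = (C (X \<sigma> T) - C (x T) - C' ?z) + (C' ?z - (\<sigma> - s) * ?D)"
        by (simp add: Xs)
      also have "norm \<dots> \<le> e / 2 * \<bar>\<sigma> - s\<bar> + e / 2 * \<bar>\<sigma> - s\<bar>"
        using 1 2 by (intro norm_triangle_mono) auto
      finally show ?thesis by simp
    qed
    ultimately show "\<exists>d>0. \<forall>\<sigma>. norm (\<sigma> - s) < d \<longrightarrow>
        norm (C (X \<sigma> T) - C (X s T) - ?D * (\<sigma> - s)) \<le> e * norm (\<sigma> - s)"
      by blast
  qed (rule bounded_linear_mult_right)
qed

subsection \<open>Existence of perturbed solutions\<close>

text \<open>The initial value \<open>Q v\<close> depends on the full integral \<open>v\<close>, since it has to be chosen so that the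
  boundary condition at \<open>T\<close> holds.\<close>

definition duhamel_map :: "real ^ 'n ^ 'n \<Rightarrow> (real \<Rightarrow> real ^ 'n) \<Rightarrow> real \<Rightarrow> real ^ 'n" where
  "duhamel_map Q f t = \<Phi> t *v (Q *v integral {0..T} (\<lambda>\<tau>. f \<tau> v* \<Psi> \<tau>) + integral {0..t} (\<lambda>\<tau>. f \<tau> v* \<Psi> \<tau>))"

text \<open>The map is linear in \<open>f\<close>, so a bound on differences serves twice: for the
  contraction property and, with \<open>g = 0\<close>, for the image of the zero
  perturbation.\<close>

lemma duhamel_map_bound:
  obtains \<kappa> where "0 \<le> \<kappa>" "\<And>f g \<sigma> a b t. \<lbrakk>\<bar>\<sigma> - s\<bar> \<le> r; 0 \<le> a; 0 \<le> b;
      (\<lambda>\<tau>. f \<tau> v* \<Psi> \<tau>) integrable_on {0..T}; (\<lambda>\<tau>. g \<tau> v* \<Psi> \<tau>) integrable_on {0..T};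
      \<And>\<tau>. \<tau> \<in> {0..T} \<Longrightarrow> norm (f \<tau> - g \<tau>) \<le> a + b * between \<sigma> \<tau>; t \<in> {0..T}\<rbrakk> \<Longrightarrow>
      norm (duhamel_map Q f t - duhamel_map Q g t) \<le> \<kappa> * (a * T + b * \<bar>\<sigma> - s\<bar>)"
proof -
  obtain k\<^sub>\<Phi> k\<^sub>\<Psi> where k: "1 \<le> k\<^sub>\<Phi>" "1 \<le> k\<^sub>\<Psi>" "\<And>t v. t \<in> {0..T} \<Longrightarrow> norm (\<Phi> t *v v) \<le> k\<^sub>\<Phi> * norm v"
    "\<And>t v. t \<in> {0..T} \<Longrightarrow> norm (v v* \<Psi> t) \<le> k\<^sub>\<Psi> * norm v"
    by (rule fundamental_bounds) blast
  have "bounded_linear ((*v) Q)" by (rule matrix_vector_mul_bounded_linear)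
  then obtain k\<^sub>Q where kQ: "0 < k\<^sub>Q" "\<And>v. norm (Q *v v) \<le> norm v * k\<^sub>Q"
    using bounded_linear.pos_bounded by blast
  show thesis
  \<comment> \<open>\<open>k\<^sub>Q\<close> comes from the initial value, which depends on the full
    integral, and the 1 from the integral up to \<open>t\<close>.\<close>
  proof (rule that[of "k\<^sub>\<Phi> * ((k\<^sub>Q + 1) * k\<^sub>\<Psi>)"])
    show "0 \<le> k\<^sub>\<Phi> * ((k\<^sub>Q + 1) * k\<^sub>\<Psi>)" using k kQ by simp
    fix f g \<sigma> a b t
    assume \<sigma>: "\<bar>\<sigma> - s\<bar> \<le> r" and ab: "0 \<le> a" "0 \<le> b"
      and f: "(\<lambda>\<tau>. f \<tau> v* \<Psi> \<tau>) integrable_on {0..T}" and g: "(\<lambda>\<tau>. g \<tau> v* \<Psi> \<tau>) integrable_on {0..T}"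
      and le: "\<And>\<tau>. \<tau> \<in> {0..T} \<Longrightarrow> norm (f \<tau> - g \<tau>) \<le> a + b * between \<sigma> \<tau>" and t: "t \<in> {0..T}"
    interpret bv: bounded_bilinear "\<lambda>(M :: real^'n^'n) v. v v* M"
      by (rule bounded_bilinear_vector_matrix_mult)
    define D where "D u = integral {0..u} (\<lambda>\<tau>. f \<tau> v* \<Psi> \<tau>) - integral {0..u} (\<lambda>\<tau>. g \<tau> v* \<Psi> \<tau>)" for u
    let ?X = "a * T + b * \<bar>\<sigma> - s\<bar>"
    have D: "norm (D u) \<le> k\<^sub>\<Psi> * ?X" if u: "u \<in> {0..T}" for u
    proof -
      have "(\<lambda>\<tau>. f \<tau> v* \<Psi> \<tau>) integrable_on {0..u}" "(\<lambda>\<tau>. g \<tau> v* \<Psi> \<tau>) integrable_on {0..u}"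
        using f g u by (auto intro: integrable_subinterval_real)
      then have "((\<lambda>\<tau>. f \<tau> v* \<Psi> \<tau> - g \<tau> v* \<Psi> \<tau>) has_integral D u) {0..u}"
        unfolding D_def by (intro has_integral_diff integrable_integral)
      then have "norm (D u) \<le> k\<^sub>\<Psi> * a * T + k\<^sub>\<Psi> * b * \<bar>\<sigma> - s\<bar>"
      proof (rule has_integral_norm_bound_between[OF _ u \<sigma>])
        fix \<tau> assume "\<tau> \<in> {0..u}"
        then have \<tau>: "\<tau> \<in> {0..T}" using u by auto
        have "norm (f \<tau> v* \<Psi> \<tau> - g \<tau> v* \<Psi> \<tau>) \<le> k\<^sub>\<Psi> * norm (f \<tau> - g \<tau>)"
          using k(4)[OF \<tau>, of "f \<tau> - g \<tau>"] by (simp add: bv.diff_right)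
        also have "\<dots> \<le> k\<^sub>\<Psi> * (a + b * between \<sigma> \<tau>)"
          using k(2) by (intro mult_left_mono le[OF \<tau>]) auto
        finally show "norm (f \<tau> v* \<Psi> \<tau> - g \<tau> v* \<Psi> \<tau>) \<le> k\<^sub>\<Psi> * a + k\<^sub>\<Psi> * b * between \<sigma> \<tau>"
          by (simp add: algebra_simps)
      qed (use ab k in auto)
      then show ?thesis by (simp add: algebra_simps)
    qed
    have "duhamel_map Q f t - duhamel_map Q g t = \<Phi> t *v (Q *v D T + D t)"
      by (simp add: duhamel_map_def D_def algebra_simps)
    also have "norm \<dots> \<le> k\<^sub>\<Phi> * norm (Q *v D T + D t)" by (rule k(3)[OF t])
    also have "norm (Q *v D T + D t) \<le> norm (D T) * k\<^sub>Q + norm (D t)"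
      by (intro norm_triangle_mono kQ order_refl)
    also have "\<dots> \<le> k\<^sub>\<Psi> * ?X * k\<^sub>Q + k\<^sub>\<Psi> * ?X"
      using kQ(1) T_pos t by (intro add_mono mult_right_mono D) auto
    finally show "norm (duhamel_map Q f t - duhamel_map Q g t) \<le> k\<^sub>\<Phi> * ((k\<^sub>Q + 1) * k\<^sub>\<Psi>) * ?X"
      using k(1) by (simp add: algebra_simps)
  qed
qed

lemma remainder_duhamel:
  assumes \<sigma>: "\<bar>\<sigma> - s\<bar> \<le> r" and z: "continuous_on {0..T} z" "\<And>t. t \<in> {0..T} \<Longrightarrow> norm (z t) \<le> r"
  shows "(\<lambda>\<tau>. remainder \<sigma> (z \<tau>) \<tau> v* \<Psi> \<tau>) integrable_on {0..T}"
    and "ac_solution T (\<lambda>v t. A t *v v + remainder \<sigma> (z t) t) (duhamel_map Q (\<lambda>\<tau>. remainder \<sigma> (z \<tau>) \<tau>))"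
proof -
  obtain B where B: "0 \<le> B" "\<And>\<sigma> t \<delta> z. \<lbrakk>\<bar>\<sigma> - s\<bar> \<le> r; t \<in> {0..T}; \<delta> \<le> r; norm z \<le> \<delta>\<rbrakk> \<Longrightarrow>
      norm (remainder \<sigma> z t) \<le> L * \<delta> * norm z + B * between \<sigma> t"
    by (rule remainder_bound) blast
  have bound: "norm (remainder \<sigma> (z t) t) \<le> L * r * r + B * 1" if t: "t \<in> {0..T}" for t
  proof -
    have "norm (remainder \<sigma> (z t) t) \<le> L * r * norm (z t) + B * between \<sigma> t"
      by (rule B(2)[OF \<sigma> t order_refl z(2)[OF t]])
    also have "\<dots> \<le> L * r * r + B * 1"
      using z(2)[OF t] L r(1) B(1) by (intro add_mono mult_left_mono) (auto simp: between_def indicator_def)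
    finally show ?thesis .
  qed
  note * = variation_of_constants[OF _ continuous_remainder[OF \<sigma> z] bound]
  show "(\<lambda>\<tau>. remainder \<sigma> (z \<tau>) \<tau> v* \<Psi> \<tau>) integrable_on {0..T}"
    by (rule *(1)) auto
  show "ac_solution T (\<lambda>v t. A t *v v + remainder \<sigma> (z t) t) (duhamel_map Q (\<lambda>\<tau>. remainder \<sigma> (z \<tau>) \<tau>))"
    unfolding duhamel_map_def by (rule *(2)) auto
qed

text \<open>Banach's theorem in a closed ball of bounded continuous functions. With contraction
  factor 1/2 the fixed point is at most twice as large as the image of 0, which is
  \<open>\<kappa> * B * \<bar>\<sigma> - s\<bar>\<close> at most; hence the constant
  \<open>2 * (\<kappa> * B)\<close>.\<close>

lemma duhamel_fixed_point:
  obtains \<eta> c where "0 < \<eta>" "\<eta> \<le> r" "0 \<le> c"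
    "\<And>\<sigma>. \<bar>\<sigma> - s\<bar> < \<eta> \<Longrightarrow> \<exists>z. continuous_on {0..T} z \<and>
      (\<forall>t\<in>{0..T}. norm (z t) \<le> r \<and> norm (z t) \<le> c * \<bar>\<sigma> - s\<bar> \<and>
        z t = duhamel_map Q (\<lambda>\<tau>. remainder \<sigma> (z \<tau>) \<tau>) t)"
proof -
  obtain \<kappa> where \<kappa>: "0 \<le> \<kappa>" "\<And>f g \<sigma> a b t. \<lbrakk>\<bar>\<sigma> - s\<bar> \<le> r; 0 \<le> a; 0 \<le> b;
      (\<lambda>\<tau>. f \<tau> v* \<Psi> \<tau>) integrable_on {0..T}; (\<lambda>\<tau>. g \<tau> v* \<Psi> \<tau>) integrable_on {0..T};
      \<And>\<tau>. \<tau> \<in> {0..T} \<Longrightarrow> norm (f \<tau> - g \<tau>) \<le> a + b * between \<sigma> \<tau>; t \<in> {0..T}\<rbrakk> \<Longrightarrow>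
      norm (duhamel_map Q f t - duhamel_map Q g t) \<le> \<kappa> * (a * T + b * \<bar>\<sigma> - s\<bar>)"
    by (rule duhamel_map_bound[of Q]) blast
  obtain K B where K: "0 \<le> K" "\<And>\<sigma> t \<delta> z w. \<lbrakk>\<bar>\<sigma> - s\<bar> \<le> r; t \<in> {0..T}; \<delta> \<le> r; norm z \<le> \<delta>; norm w \<le> \<delta>\<rbrakk> \<Longrightarrow>
      norm (remainder \<sigma> z t - remainder \<sigma> w t) \<le> (L * \<delta> + K * between \<sigma> t) * norm (z - w)"
    and B: "0 \<le> B" "\<And>\<sigma> t. \<lbrakk>\<bar>\<sigma> - s\<bar> \<le> r; t \<in> {0..T}\<rbrakk> \<Longrightarrow> norm (remainder \<sigma> 0 t) \<le> B * between \<sigma> t"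
    by (rule remainder_bound) blast
  have small: "\<exists>\<epsilon>>0. \<epsilon> \<le> b \<and> a * \<epsilon> \<le> b'" if "0 \<le> a" "0 < b" "0 < b'" for a b b' :: real
  proof (intro exI conjI)
    show "0 < min b (b' / (a + 1))" "min b (b' / (a + 1)) \<le> b" using that by auto
    have "a * min b (b' / (a + 1)) \<le> a * (b' / (a + 1))"
      using that by (intro mult_left_mono) auto
    also have "\<dots> \<le> b'" using that by (simp add: field_simps)
    finally show "a * min b (b' / (a + 1)) \<le> b'" .
  qed
  obtain \<delta> where \<delta>: "0 < \<delta>" "\<delta> \<le> r" "\<kappa> * L * T * \<delta> \<le> 1 / 4"
    using small[of "\<kappa> * L * T" r "1 / 4"] \<kappa>(1) L T_pos r(1) by auto
  \<comment> \<open>One inequality for two aims: the \<open>K\<close> part adds at most 1/4 to the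
    contraction factor, and the \<open>B / \<delta>\<close> part keeps the image inside the ball of
    radius \<open>\<delta>\<close>.\<close>
  obtain \<eta> where \<eta>: "0 < \<eta>" "\<eta> \<le> r" "\<kappa> * (K + 2 * B / \<delta>) * \<eta> \<le> 1 / 4"
    using small[of "\<kappa> * (K + 2 * B / \<delta>)" r "1 / 4"] \<kappa>(1) K(1) B(1) \<delta>(1) r(1) by auto
  show thesis
  proof (rule that[OF \<eta>(1,2), of "2 * (\<kappa> * B)"])
    fix \<sigma> assume \<sigma>: "\<bar>\<sigma> - s\<bar> < \<eta>"
    then have \<sigma>r: "\<bar>\<sigma> - s\<bar> \<le> r" using \<eta> by simp
    have "\<kappa> * (K + 2 * B / \<delta>) * \<bar>\<sigma> - s\<bar> \<le> \<kappa> * (K + 2 * B / \<delta>) * \<eta>"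
      using \<sigma> \<kappa>(1) K(1) B(1) \<delta>(1) by (intro mult_left_mono) auto
    moreover have "\<kappa> * (K + 2 * B / \<delta>) * \<bar>\<sigma> - s\<bar> = \<kappa> * K * \<bar>\<sigma> - s\<bar> + 2 * (\<kappa> * B * \<bar>\<sigma> - s\<bar>) / \<delta>"
      by (simp add: algebra_simps)
    moreover have "0 \<le> \<kappa> * K * \<bar>\<sigma> - s\<bar>" "0 \<le> 2 * (\<kappa> * B * \<bar>\<sigma> - s\<bar>) / \<delta>"
      using \<kappa>(1) K(1) B(1) \<delta>(1) by auto
    ultimately have \<sigma>K: "\<kappa> * K * \<bar>\<sigma> - s\<bar> \<le> 1 / 4" and "2 * (\<kappa> * B * \<bar>\<sigma> - s\<bar>) / \<delta> \<le> 1 / 4"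
      using \<eta>(3) by linarith+
    then have \<sigma>B: "\<kappa> * B * \<bar>\<sigma> - s\<bar> \<le> \<delta> / 2" using \<delta>(1) by (simp add: field_simps)
    define \<Lambda> where "\<Lambda> z = duhamel_map Q (\<lambda>\<tau>. remainder \<sigma> (z \<tau>) \<tau>)" for z
    let ?S = "cball (0 :: real \<Rightarrow>\<^sub>C (real^'n)) \<delta>"
    have in_S: "norm (apply_bcontfun z t) \<le> \<delta>" if "z \<in> ?S" for z t
      using norm_bounded[of z t] that by auto
    \<comment> \<open>The complete space consists of functions on the whole line, so the image is
      continued by constants outside \<open>{0..T}\<close>.\<close>
    define \<Gamma> where "\<Gamma> z = Bcontfun (\<lambda>t. \<Lambda> (apply_bcontfun z) (clamp 0 T t))" for z
    have clamp: "clamp 0 T t \<in> {0..T}" for t :: real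
      using clamp_in_interval[of 0 T t] T_pos by (simp add: cbox_interval)
    have clamp_id: "clamp 0 T t = t" if "t \<in> {0..T}" for t :: real
      using clamp_cancel_cbox[of t 0 T] that by (simp add: cbox_interval)
    have \<Gamma>: "apply_bcontfun (\<Gamma> z) t = \<Lambda> z (clamp 0 T t)" if z: "z \<in> ?S" for z t
    proof -
      have "ac_solution T (\<lambda>v t. A t *v v + remainder \<sigma> (z t) t) (\<Lambda> z)"
        unfolding \<Lambda>_def using in_S[OF z] \<delta>(2) order_trans by (intro remainder_duhamel(2)[OF \<sigma>r]) auto
      then have cont: "continuous_on {0..T} (\<Lambda> z)"
        unfolding ac_solution_def by (intro absolutely_continuous_on_imp_continuous_on) simp
      then have "bounded (\<Lambda> z ` {0..T})"
        by (intro compact_imp_bounded compact_continuous_image) auto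
      with cont have "(\<lambda>t. \<Lambda> z (clamp 0 T t)) \<in> bcontfun"
        unfolding bcontfun_def using clamp_continuous_on[of 0 T "\<Lambda> z"] clamp_bounded[of "\<Lambda> z" 0 T]
        by (simp add: cbox_interval)
      then show ?thesis by (simp add: \<Gamma>_def Bcontfun_inverse)
    qed
    have lip: "norm (\<Lambda> z t - \<Lambda> w t) \<le> 1 / 2 * dist z w"
      if z: "z \<in> ?S" and w: "w \<in> ?S" and t: "t \<in> {0..T}" for z w t
    proof -
      have "norm (\<Lambda> z t - \<Lambda> w t) \<le> \<kappa> * (L * \<delta> * dist z w * T + K * dist z w * \<bar>\<sigma> - s\<bar>)"
        unfolding \<Lambda>_def
      proof (rule \<kappa>(2)[OF \<sigma>r])
        fix \<tau> assume \<tau>: "\<tau> \<in> {0..T}"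
        have "norm (remainder \<sigma> (z \<tau>) \<tau> - remainder \<sigma> (w \<tau>) \<tau>) \<le> (L * \<delta> + K * between \<sigma> \<tau>) * norm (z \<tau> - w \<tau>)"
          by (rule K(2)[OF \<sigma>r \<tau> \<delta>(2) in_S[OF z] in_S[OF w]])
        also have "\<dots> \<le> (L * \<delta> + K * between \<sigma> \<tau>) * dist z w"
          using dist_bounded[of z \<tau> w] L \<delta>(1) K(1) between_nonneg
          by (intro mult_left_mono) (auto simp: dist_norm)
        finally show "norm (remainder \<sigma> (z \<tau>) \<tau> - remainder \<sigma> (w \<tau>) \<tau>)
            \<le> L * \<delta> * dist z w + K * dist z w * between \<sigma> \<tau>"
          by (simp add: algebra_simps)
      next
        show "(\<lambda>\<tau>. remainder \<sigma> (z \<tau>) \<tau> v* \<Psi> \<tau>) integrable_on {0..T}"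
          using in_S[OF z] \<delta>(2) order_trans by (intro remainder_duhamel(1)[OF \<sigma>r]) auto
        show "(\<lambda>\<tau>. remainder \<sigma> (w \<tau>) \<tau> v* \<Psi> \<tau>) integrable_on {0..T}"
          using in_S[OF w] \<delta>(2) order_trans by (intro remainder_duhamel(1)[OF \<sigma>r]) auto
      qed (use L \<delta>(1) K(1) t in auto)
      also have "\<dots> = (\<kappa> * L * T * \<delta> + \<kappa> * K * \<bar>\<sigma> - s\<bar>) * dist z w"
        by (simp add: algebra_simps)
      also have "\<dots> \<le> 1 / 2 * dist z w"
        using \<delta>(3) \<sigma>K by (intro mult_right_mono) auto
      finally show ?thesis .
    qed
    have zero: "(0 :: real \<Rightarrow>\<^sub>C (real^'n)) \<in> ?S" using \<delta>(1) by simp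
    have \<Lambda>0: "norm (\<Lambda> (0 :: real \<Rightarrow>\<^sub>C (real^'n)) t) \<le> \<kappa> * B * \<bar>\<sigma> - s\<bar>" if t: "t \<in> {0..T}" for t
    proof -
      \<comment> \<open>\<open>\<kappa>\<close> bounds differences only, so the zero inhomogeneity
        serves as comparison.\<close>
      have "duhamel_map Q (\<lambda>_. 0) t = 0" by (simp add: duhamel_map_def)
      moreover have "norm (\<Lambda> (0 :: real \<Rightarrow>\<^sub>C (real^'n)) t - duhamel_map Q (\<lambda>_. 0) t) \<le> \<kappa> * (0 * T + B * \<bar>\<sigma> - s\<bar>)"
        unfolding \<Lambda>_def
      proof (rule \<kappa>(2)[OF \<sigma>r])
        show "(\<lambda>\<tau>. remainder \<sigma> ((0 :: real \<Rightarrow>\<^sub>C (real^'n)) \<tau>) \<tau> v* \<Psi> \<tau>) integrable_on {0..T}"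
          using in_S[OF zero] \<delta>(2) order_trans by (intro remainder_duhamel(1)[OF \<sigma>r]) auto
      qed (use B \<sigma>r t in auto)
      ultimately show ?thesis by simp
    qed
    have "\<exists>!z\<in>?S. \<Gamma> z = z"
    proof (rule Banach_fix)
      show "complete ?S" by (simp add: complete_eq_closed)
      show contr: "dist (\<Gamma> z) (\<Gamma> w) \<le> 1 / 2 * dist z w" if "z \<in> ?S" "w \<in> ?S" for z w
        using that lip[OF that clamp] by (intro dist_bound) (simp add: \<Gamma> dist_norm)
      show "\<Gamma> ` ?S \<subseteq> ?S"
      proof clarify
        fix z assume z: "z \<in> ?S"
        have "norm (\<Gamma> z t) \<le> \<delta>" for t
        proof -
          have "norm (\<Gamma> z t) \<le> norm (\<Lambda> z (clamp 0 T t) - \<Lambda> (0 :: real \<Rightarrow>\<^sub>C (real^'n)) (clamp 0 T t))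
              + norm (\<Lambda> (0 :: real \<Rightarrow>\<^sub>C (real^'n)) (clamp 0 T t))"
            unfolding \<Gamma>[OF z] by (metis diff_add_cancel norm_triangle_ineq)
          also have "\<dots> \<le> 1 / 2 * dist z 0 + \<kappa> * B * \<bar>\<sigma> - s\<bar>"
            by (intro add_mono lip[OF z zero clamp] \<Lambda>0[OF clamp])
          also have "\<dots> \<le> \<delta>" using z \<sigma>B by (simp add: dist_commute)
          finally show ?thesis .
        qed
        then show "\<Gamma> z \<in> ?S" by (simp add: norm_bound)
      qed
    qed (use \<delta>(1) in auto)
    then obtain z where z: "z \<in> ?S" "\<Gamma> z = z" by blast
    have fixed: "apply_bcontfun z t = \<Lambda> z t" if "t \<in> {0..T}" for t
      using \<Gamma>[OF z(1), of t] z(2) clamp_id[OF that] by simp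
    have "norm (z t) \<le> 1 / 2 * norm z + \<kappa> * B * \<bar>\<sigma> - s\<bar>" for t
    proof -
      have "norm (z t) \<le> norm (\<Lambda> z (clamp 0 T t) - \<Lambda> (0 :: real \<Rightarrow>\<^sub>C (real^'n)) (clamp 0 T t))
          + norm (\<Lambda> (0 :: real \<Rightarrow>\<^sub>C (real^'n)) (clamp 0 T t))"
        using \<Gamma>[OF z(1), of t] z(2) by (metis diff_add_cancel norm_triangle_ineq)
      also have "\<dots> \<le> 1 / 2 * dist z 0 + \<kappa> * B * \<bar>\<sigma> - s\<bar>"
        by (intro add_mono lip[OF z(1) zero clamp] \<Lambda>0[OF clamp])
      finally show ?thesis by simp
    qed
    then have "norm z \<le> 1 / 2 * norm z + \<kappa> * B * \<bar>\<sigma> - s\<bar>" by (rule norm_bound)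
    then have bound: "norm (z t) \<le> 2 * (\<kappa> * B) * \<bar>\<sigma> - s\<bar>" for t
      using norm_bounded[of z t] by simp
    show "\<exists>z. continuous_on {0..T} z \<and>
      (\<forall>t\<in>{0..T}. norm (z t) \<le> r \<and> norm (z t) \<le> 2 * (\<kappa> * B) * \<bar>\<sigma> - s\<bar> \<and>
        z t = duhamel_map Q (\<lambda>\<tau>. remainder \<sigma> (z \<tau>) \<tau>) t)"
    proof (intro exI[of _ "apply_bcontfun z"] conjI ballI bound)
      show "norm (z t) \<le> r" for t using in_S[OF z(1)] \<delta>(2) by (rule order_trans)
      show "z t = duhamel_map Q (\<lambda>\<tau>. remainder \<sigma> (z \<tau>) \<tau>) t" if "t \<in> {0..T}" for t
        using fixed[OF that] by (simp only: \<Lambda>_def)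
    qed simp
  qed (use \<kappa> B in auto)
qed

text \<open>\<open>Q\<close> is still arbitrary. The end point formulas, with \<open>v\<close> the
  full integral, show how it enters, so that the boundary conditions can select it later.\<close>

lemma perturbed_solution_exists:
  obtains \<eta> c where "0 < \<eta>"
    "\<And>\<sigma>. \<bar>\<sigma> - s\<bar> < \<eta> \<Longrightarrow> \<exists>y v. ac_solution T (switched F\<^sub>0 F\<^sub>1 \<sigma>) y \<and> norm (y 0 - x 0) \<le> c * \<bar>\<sigma> - s\<bar> \<and>
      y 0 - x 0 = Q *v v \<and> y T - x T = \<Phi> T *v (Q *v v + v)"
proof -
  obtain \<eta> c where \<eta>: "0 < \<eta>" "\<eta> \<le> r" and c: "0 \<le> c"
    and ex: "\<And>\<sigma>. \<bar>\<sigma> - s\<bar> < \<eta> \<Longrightarrow> \<exists>z. continuous_on {0..T} z \<and>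
      (\<forall>t\<in>{0..T}. norm (z t) \<le> r \<and> norm (z t) \<le> c * \<bar>\<sigma> - s\<bar> \<and>
        z t = duhamel_map Q (\<lambda>\<tau>. remainder \<sigma> (z \<tau>) \<tau>) t)"
    by (rule duhamel_fixed_point[of Q]) blast
  show thesis
  proof (rule that[OF \<eta>(1), of c])
    fix \<sigma> assume \<sigma>: "\<bar>\<sigma> - s\<bar> < \<eta>"
    then have \<sigma>r: "\<bar>\<sigma> - s\<bar> \<le> r" using \<eta> by simp
    obtain z where z: "continuous_on {0..T} z" "\<And>t. t \<in> {0..T} \<Longrightarrow> norm (z t) \<le> r"
      "\<And>t. t \<in> {0..T} \<Longrightarrow> norm (z t) \<le> c * \<bar>\<sigma> - s\<bar>"
      "\<And>t. t \<in> {0..T} \<Longrightarrow> z t = duhamel_map Q (\<lambda>\<tau>. remainder \<sigma> (z \<tau>) \<tau>) t"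
      using ex[OF \<sigma>] by blast
    define z' where "z' = duhamel_map Q (\<lambda>\<tau>. remainder \<sigma> (z \<tau>) \<tau>)"
    define v where "v = integral {0..T} (\<lambda>\<tau>. remainder \<sigma> (z \<tau>) \<tau> v* \<Psi> \<tau>)"
    have sol: "ac_solution T (\<lambda>v t. A t *v v + remainder \<sigma> (z t) t) z'"
      unfolding z'_def by (rule remainder_duhamel(2)[OF \<sigma>r z(1)]) (rule z(2))
    obtain Z where Z: "negligible Z" "absolutely_continuous_on {0..T} z'" "\<And>t. t \<in> {0..T} - Z \<Longrightarrow>
        (z' has_vector_derivative A t *v z' t + remainder \<sigma> (z t) t) (at t within {0..T})"
      using sol by (rule ac_solutionE) blast
    obtain Z' where Z': "negligible Z'" "absolutely_continuous_on {0..T} x" "\<And>t. t \<in> {0..T} - Z' \<Longrightarrow>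
        (x has_vector_derivative switched F\<^sub>0 F\<^sub>1 s (x t) t) (at t within {0..T})"
      using x by (rule ac_solutionE) blast
    have "ac_solution T (switched F\<^sub>0 F\<^sub>1 \<sigma>) (\<lambda>t. x t + z' t)"
    proof (rule ac_solutionI)
      show "negligible (Z \<union> Z')" using Z Z' by (simp add: negligible_Un)
      show "absolutely_continuous_on {0..T} (\<lambda>t. x t + z' t)"
        using Z Z' by (simp add: absolutely_continuous_on_add)
      fix t assume "t \<in> {0..T} - (Z \<union> Z')"
      then have t: "t \<in> {0..T} - Z" "t \<in> {0..T} - Z'" by auto
      \<comment> \<open>\<open>z\<close> and \<open>z'\<close> agree on \<open>{0..T}\<close>, so
        the remainder along \<open>z\<close> is the remainder along \<open>z'\<close>, and the
        equation closes up.\<close>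
      have "switched F\<^sub>0 F\<^sub>1 s (x t) t + (A t *v z' t + remainder \<sigma> (z t) t) = switched F\<^sub>0 F\<^sub>1 \<sigma> (x t + z' t) t"
        using z(4)[of t] t by (simp add: remainder_def z'_def)
      with has_vector_derivative_add[OF Z'(3)[OF t(2)] Z(3)[OF t(1)]]
      show "((\<lambda>t. x t + z' t) has_vector_derivative switched F\<^sub>0 F\<^sub>1 \<sigma> (x t + z' t) t) (at t within {0..T})"
        by simp
    qed
    moreover have "z' 0 = Q *v v" "z' T = \<Phi> T *v (Q *v v + v)"
      by (simp_all add: z'_def duhamel_map_def v_def \<Phi>_0)
    moreover have "norm (z' 0) \<le> c * \<bar>\<sigma> - s\<bar>"
      using z(3,4)[of 0] T_pos by (simp add: z'_def)
    ultimately show "\<exists>y v. ac_solution T (switched F\<^sub>0 F\<^sub>1 \<sigma>) y \<and> norm (y 0 - x 0) \<le> c * \<bar>\<sigma> - s\<bar> \<and>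
      y 0 - x 0 = Q *v v \<and> y T - x T = \<Phi> T *v (Q *v v + v)"
      by (intro exI[of _ "\<lambda>t. x t + z' t"] exI[of _ v]) auto
  qed
qed

end

section \<open>The derivative with respect to the switch point\<close>

text \<open>The inverse of the submatrix is padded with zeros to a full matrix. Being a right
  inverse gives solvability, being a left inverse gives injectivity on vectors supported in
  \<open>S\<close>.\<close>

lemma invertible_submatrixE:
  fixes A :: "real ^ 'n ^ 'n"
  assumes "invertible_submatrix R S A"
  obtains G :: "real ^ 'n ^ 'n" where "\<And>u i. i \<in> R \<Longrightarrow> (A *v (G *v u)) $ i = u $ i"
    "\<And>u j. j \<notin> S \<Longrightarrow> (G *v u) $ j = 0"
    "\<And>w. \<lbrakk>\<And>j. j \<notin> S \<Longrightarrow> w $ j = 0; \<And>i. i \<in> R \<Longrightarrow> (A *v w) $ i = 0\<rbrakk> \<Longrightarrow> w = 0"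
proof -
  obtain B :: "'n \<Rightarrow> 'n \<Rightarrow> real" where
    right: "\<And>i k. \<lbrakk>i \<in> R; k \<in> R\<rbrakk> \<Longrightarrow> (\<Sum>j\<in>S. A $ i $ j * B j k) = (if i = k then 1 else 0)" and
    left: "\<And>j l. \<lbrakk>j \<in> S; l \<in> S\<rbrakk> \<Longrightarrow> (\<Sum>i\<in>R. B j i * A $ i $ l) = (if j = l then 1 else 0)"
    using assms unfolding invertible_submatrix_def by blast
  define G :: "real ^ 'n ^ 'n" where "G = (\<chi> j k. if j \<in> S \<and> k \<in> R then B j k else 0)"
  have G: "(G *v u) $ j = (if j \<in> S then \<Sum>k\<in>R. B j k * u $ k else 0)" for u j
  proof (cases "j \<in> S")
    case True
    have "(G *v u) $ j = (\<Sum>k\<in>UNIV. if k \<in> R then B j k * u $ k else 0)"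
      unfolding matrix_vector_mult_def using True by (auto simp: G_def intro!: sum.cong)
    then show ?thesis using True by (simp add: sum.If_cases)
  qed (simp add: G_def matrix_vector_mult_def)
  have mult: "(A *v w) $ i = (\<Sum>j\<in>S. A $ i $ j * w $ j)" if "\<And>j. j \<notin> S \<Longrightarrow> w $ j = 0" for w i
    unfolding matrix_vector_mult_def using that by (auto intro!: sum.mono_neutral_right)
  show thesis
  proof (rule that)
    show "(G *v u) $ j = 0" if "j \<notin> S" for u j using that by (simp add: G)
    show "(A *v (G *v u)) $ i = u $ i" if i: "i \<in> R" for u i
    proof -
      have "(A *v (G *v u)) $ i = (\<Sum>j\<in>S. \<Sum>k\<in>R. A $ i $ j * B j k * u $ k)"
        by (subst mult) (auto simp: G sum_distrib_left mult.assoc)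
      also have "\<dots> = (\<Sum>k\<in>R. (\<Sum>j\<in>S. A $ i $ j * B j k) * u $ k)"
        by (subst sum.swap) (simp add: sum_distrib_right)
      also have "\<dots> = (\<Sum>k\<in>R. if i = k then u $ k else 0)"
        using i by (intro sum.cong) (auto simp: right)
      also have "\<dots> = u $ i" using i by simp
      finally show ?thesis .
    qed
    fix w assume supp: "\<And>j. j \<notin> S \<Longrightarrow> w $ j = 0" and zero: "\<And>i. i \<in> R \<Longrightarrow> (A *v w) $ i = 0"
    have "w $ j = 0" if j: "j \<in> S" for j
    proof -
      have "w $ j = (\<Sum>l\<in>S. if j = l then w $ l else 0)" using j by simp
      also have "\<dots> = (\<Sum>l\<in>S. (\<Sum>i\<in>R. B j i * A $ i $ l) * w $ l)"
        using j by (intro sum.cong) (auto simp: left)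
      also have "\<dots> = (\<Sum>i\<in>R. B j i * (\<Sum>l\<in>S. A $ i $ l * w $ l))"
        by (simp add: sum_distrib_right sum_distrib_left mult.assoc) (rule sum.swap)
      also have "\<dots> = 0" using zero by (simp add: mult[OF supp, symmetric])
      finally show ?thesis .
    qed
    with supp show "w = 0" by (metis vec_eq_iff zero_index)
  qed
qed

lemma partial_derivative_eq:
  assumes "(C has_derivative C') (at z)"
  shows "partial_derivative C i z = C' (axis i 1)"
proof -
  interpret bounded_linear C' by (rule has_derivative_bounded_linear[OF assms])
  have "((\<lambda>h. z + h *\<^sub>R axis i 1) has_derivative (\<lambda>h. h *\<^sub>R axis i 1)) (at 0)"
    by (auto intro!: derivative_eq_intros)
  moreover have "(C has_derivative C') (at (z + 0 *\<^sub>R axis i 1))" using assms by simp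
  ultimately have "((\<lambda>h. C (z + h *\<^sub>R axis i 1)) has_derivative (\<lambda>h. C' (h *\<^sub>R axis i 1))) (at 0)"
    by (rule has_derivative_compose)
  moreover have "(\<lambda>h. C' (h *\<^sub>R axis i 1)) = (*) (C' (axis i 1))"
    by (simp add: fun_eq_iff scaleR)
  ultimately have "((\<lambda>h. C (z + h *\<^sub>R axis i 1)) has_field_derivative C' (axis i 1)) (at 0)"
    by (simp add: has_field_derivative_def)
  then show ?thesis unfolding partial_derivative_def by (rule DERIV_imp_deriv)
qed

lemma linear_functional_eq_inner:
  fixes f :: "real ^ 'n \<Rightarrow> real"
  assumes "linear f"
  shows "f w = (\<chi> i. f (axis i 1)) \<bullet> w"
proof -
  have "f w = f (\<Sum>i\<in>UNIV. w $ i *\<^sub>R axis i 1)"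
    using basis_expansion[of w] by (simp add: scalar_mult_eq_scaleR)
  also have "\<dots> = (\<Sum>i\<in>UNIV. w $ i * f (axis i 1))"
    by (simp add: linear_sum[OF assms] linear_cmul[OF assms])
  finally show ?thesis by (simp add: inner_vec_def mult.commute)
qed

lemma norm_restrict_vec_le: "norm (restrict_vec S v) \<le> norm v"
  unfolding norm_vec_def L2_set_def
  by (auto intro!: real_sqrt_le_mono sum_mono simp: restrict_vec_def)

text \<open>\<open>\<rho> / M\<close> is the radius of the Euclidean balls, while
  \<open>\<rho>\<close> limits the times at which both fields are given; \<open>r\<close> has to
  respect both.\<close>

lemma switched_linearization_if_smooth:
  fixes x :: "real \<Rightarrow> real ^ 'n"
  assumes N: "0 < m" "0 < M" "\<And>v. m * norm v \<le> N v" "\<And>v. N v \<le> M * norm v"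
    and x: "ac_solution T (switched F\<^sub>0 F\<^sub>1 s) x"
    and smooth: "dynamics_smoothness N T s x F\<^sub>0 F\<^sub>1 \<rho> L"
    and fundamental: "linear_system T (jacobian_along (switched F\<^sub>0 F\<^sub>1 s) x) \<Phi> \<Psi>"
  shows "switched_linearization T s (min \<rho> (\<rho> / M)) (\<bar>L\<bar> * M\<^sup>2 / m) F\<^sub>0 F\<^sub>1 x \<Phi> \<Psi>"
proof -
  have \<rho>: "0 < \<rho>" "{s - \<rho>..s + \<rho>} \<subseteq> {0..T}" using smooth by (auto simp: dynamics_smoothness_def)
  then have \<rho>': "0 \<le> s - \<rho>" "s + \<rho> \<le> T" by auto
  have cont: "continuous_on {0..T} x"
    using x absolutely_continuous_on_imp_continuous_on by (auto simp: ac_solution_def)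
  have "linearizable {0..s + \<rho>} x (\<rho> / M) (\<bar>L\<bar> * M\<^sup>2 / m) F\<^sub>0"
    using smooth \<rho>' by (intro linearizable_if_smooth[OF N \<rho>(1)] continuous_on_subset[OF cont])
      (auto simp: dynamics_smoothness_def)
  moreover have "linearizable {s - \<rho>..T} x (\<rho> / M) (\<bar>L\<bar> * M\<^sup>2 / m) F\<^sub>1"
    using smooth \<rho>' by (intro linearizable_if_smooth[OF N \<rho>(1)] continuous_on_subset[OF cont])
      (auto simp: dynamics_smoothness_def)
  ultimately show ?thesis
    using \<rho> \<rho>' N x fundamental
    by (intro switched_linearization.intro) (auto elim!: linearizable_subset)
qed

text \<open>Uniqueness of perturbed solutions is not asserted, so the derivative is stated for every
  family \<open>X\<close> with the linear bound; the first conjunct shows that such families exist.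
  \<open>C (X s T) = C (x T)\<close> makes the derivative the limit of the difference quotients
  based at \<open>x\<close>.\<close>

theorem theorem5p1:
  fixes N :: "real ^ 'n \<Rightarrow> real"
    and T s \<rho> L :: real
    and I E J F :: "'n set"
    and b\<^sub>I b\<^sub>E :: "real ^ 'n"
    and F\<^sub>0 F\<^sub>1 :: "real ^ 'n \<Rightarrow> real \<Rightarrow> real ^ 'n"
    and x :: "real \<Rightarrow> real ^ 'n"
    and C :: "real ^ 'n \<Rightarrow> real"
    and \<Phi> \<Psi> :: "real \<Rightarrow> real ^ 'n ^ 'n"
  assumes N: "is_norm N"
    and s: "0 < T" "s \<in> {0<..<T}"
    and card_eq: "card I + card E = CARD('n)"
    and complements: "J = - I" "F = - E"
    and x: "bvp_solution T (switched F\<^sub>0 F\<^sub>1 s) I E b\<^sub>I b\<^sub>E x"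
    and smooth: "dynamics_smoothness N T s x F\<^sub>0 F\<^sub>1 \<rho> L"
    and C: "continuously_differentiable_on C UNIV"
    and \<Phi>: "ac_solution T (\<lambda>M t. jacobian_along (switched F\<^sub>0 F\<^sub>1 s) x t ** M) \<Phi>"
      "\<Phi> 0 = mat 1"
    and \<Psi>: "ac_solution T (\<lambda>M t. - (transpose (jacobian_along (switched F\<^sub>0 F\<^sub>1 s) x t) ** M)) \<Psi>"
      "\<Psi> 0 = mat 1"
    and \<Phi>_inv: "invertible_submatrix E J (\<Phi> T)"
    and \<Psi>_inv: "invertible_submatrix F I (\<Psi> T)"
  shows
    "(\<exists>c. \<forall>\<^sub>F \<sigma> in nhds s. \<exists>y. bvp_solution T (switched F\<^sub>0 F\<^sub>1 \<sigma>) I E b\<^sub>I b\<^sub>E y \<and>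
        N (restrict_vec J (y 0 - x 0)) \<le> c * \<bar>\<sigma> - s\<bar>) \<and>
     (\<exists>p. costate T (switched F\<^sub>0 F\<^sub>1 s) C J F x p \<and>
       (\<forall>q. costate T (switched F\<^sub>0 F\<^sub>1 s) C J F x q \<longrightarrow> (\<forall>t\<in>{0..T}. q t = p t)) \<and>
       (\<forall>X c. (\<forall>\<^sub>F \<sigma> in nhds s. bvp_solution T (switched F\<^sub>0 F\<^sub>1 \<sigma>) I E b\<^sub>I b\<^sub>E (X \<sigma>) \<and>
           N (restrict_vec J (X \<sigma> 0 - x 0)) \<le> c * \<bar>\<sigma> - s\<bar>) \<longrightarrow>
         C (X s T) = C (x T) \<and>
         ((\<lambda>\<sigma>. C (X \<sigma> T)) has_real_derivative
            hamiltonian F\<^sub>0 (x s) (p s) s - hamiltonian F\<^sub>1 (x s) (p s) s) (at s)))"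
proof -
  obtain m M where mM: "0 < m" "0 < M" "\<And>v. m * norm v \<le> N v" "\<And>v. N v \<le> M * norm v"
    by (rule is_norm_equivalent[OF N]) blast
  have sol: "ac_solution T (switched F\<^sub>0 F\<^sub>1 s) x" using x by (simp add: bvp_solution_def)
  have xI: "x 0 $ i = b\<^sub>I $ i" if "i \<in> I" for i using x that by (simp add: bvp_solution_def)
  have xE: "x T $ i = b\<^sub>E $ i" if "i \<in> E" for i using x that by (simp add: bvp_solution_def)
  have fundamental: "linear_system T (jacobian_along (switched F\<^sub>0 F\<^sub>1 s) x) \<Phi> \<Psi>"
    using s(1) \<Phi> \<Psi> by (intro linear_system.intro)
  interpret switched_linearization T s "min \<rho> (\<rho> / M)" "\<bar>L\<bar> * M\<^sup>2 / m" F\<^sub>0 F\<^sub>1 x \<Phi> \<Psi>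
    by (rule switched_linearization_if_smooth[OF mM sol smooth fundamental])
  obtain G :: "real ^ 'n ^ 'n" where
    G: "\<And>u i. i \<in> E \<Longrightarrow> (\<Phi> T *v (G *v u)) $ i = u $ i" "\<And>u j. j \<notin> J \<Longrightarrow> (G *v u) $ j = 0"
    by (rule invertible_submatrixE[OF \<Phi>_inv]) blast
  obtain G' :: "real ^ 'n ^ 'n" where
    G': "\<And>u i. i \<in> F \<Longrightarrow> (\<Psi> T *v (G' *v u)) $ i = u $ i" "\<And>u j. j \<notin> I \<Longrightarrow> (G' *v u) $ j = 0"
    and kernel: "\<And>w. \<lbrakk>\<And>j. j \<notin> I \<Longrightarrow> w $ j = 0; \<And>i. i \<in> F \<Longrightarrow> (\<Psi> T *v w) $ i = 0\<rbrakk> \<Longrightarrow> w = 0"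
    by (rule invertible_submatrixE[OF \<Psi>_inv]) blast
  obtain C' where C': "(C has_derivative C') (at (x T))"
    using C unfolding continuously_differentiable_on_def by auto
  define d where "d = (\<chi> i. C' (axis i 1))"
  \<comment> \<open>Initial value of the costate: supported in \<open>I\<close>, so that its
    components in \<open>J\<close> vanish, and with the prescribed components in \<open>F\<close> at
    time \<open>T\<close>.\<close>
  define q where "q = G' *v d"
  define p where "p t = \<Psi> t *v q" for t
  have pT: "p T $ i = d $ i" if "i \<in> F" for i using G'(1)[OF that] by (simp add: p_def q_def)
  have p0: "p 0 $ i = 0" if "i \<notin> I" for i using G'(2)[OF that] by (simp add: p_def q_def \<Psi>_0)
  have d: "partial_derivative C i (x T) = d $ i" for i
    by (simp add: partial_derivative_eq[OF C'] d_def)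
  have p: "costate T (switched F\<^sub>0 F\<^sub>1 s) C J F x p"
    using adjoint_solution[of q] pT p0 by (simp add: costate_def complements d p_def[abs_def])
  moreover have "q' t = p t" if q': "costate T (switched F\<^sub>0 F\<^sub>1 s) C J F x q'" and t: "t \<in> {0..T}" for q' t
  proof -
    have eq: "q' t = \<Psi> t *v q' 0" if "t \<in> {0..T}" for t
      using q' that by (intro adjoint_solution_unique) (simp_all add: costate_def)
    \<comment> \<open>The difference of two initial costates is supported in \<open>I\<close>, and
      \<open>\<Psi> T\<close> maps it to a vector vanishing on \<open>F\<close>.\<close>
    have "q' 0 - q = 0"
    proof (rule kernel)
      show "(q' 0 - q) $ j = 0" if "j \<notin> I" for j
        using q' p0[OF that] that by (simp add: costate_def complements p_def \<Psi>_0)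
      have "\<Psi> T *v (q' 0 - q) = q' T - p T"
        using eq[of T] T_pos by (simp add: p_def algebra_simps)
      then show "(\<Psi> T *v (q' 0 - q)) $ i = 0" if "i \<in> F" for i
        using q' pT[OF that] that by (simp add: costate_def d)
    qed
    then show ?thesis using eq[OF t] by (simp add: p_def)
  qed
  moreover have "C (X s T) = C (x T) \<and> ((\<lambda>\<sigma>. C (X \<sigma> T)) has_real_derivative
      hamiltonian F\<^sub>0 (x s) (p s) s - hamiltonian F\<^sub>1 (x s) (p s) s) (at s)"
    if X: "\<forall>\<^sub>F \<sigma> in nhds s. bvp_solution T (switched F\<^sub>0 F\<^sub>1 \<sigma>) I E b\<^sub>I b\<^sub>E (X \<sigma>) \<and>
           N (restrict_vec J (X \<sigma> 0 - x 0)) \<le> c * \<bar>\<sigma> - s\<bar>" for X c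
  proof -
    have X': "\<forall>\<^sub>F \<sigma> in nhds s. ac_solution T (switched F\<^sub>0 F\<^sub>1 \<sigma>) (X \<sigma>) \<and>
      norm (X \<sigma> 0 - x 0) \<le> c / m * \<bar>\<sigma> - s\<bar> \<and>
      q \<bullet> (X \<sigma> 0 - x 0) = 0 \<and> C' (X \<sigma> T - x T) = (\<Psi> T *v q) \<bullet> (X \<sigma> T - x T)"
      using X
    proof (eventually_elim, elim conjE, intro conjI)
      fix \<sigma>
      assume bvp: "bvp_solution T (switched F\<^sub>0 F\<^sub>1 \<sigma>) I E b\<^sub>I b\<^sub>E (X \<sigma>)"
        and c: "N (restrict_vec J (X \<sigma> 0 - x 0)) \<le> c * \<bar>\<sigma> - s\<bar>"
      show "ac_solution T (switched F\<^sub>0 F\<^sub>1 \<sigma>) (X \<sigma>)" using bvp by (simp add: bvp_solution_def)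
      have I: "(X \<sigma> 0 - x 0) $ i = 0" if "i \<in> I" for i
        using bvp xI that by (simp add: bvp_solution_def)
      have E: "(X \<sigma> T - x T) $ i = 0" if "i \<in> E" for i
        using bvp xE that by (simp add: bvp_solution_def)
      \<comment> \<open>The initial deviation vanishes on \<open>I\<close>, so the bound on its
        components in \<open>J\<close> controls the whole vector.\<close>
      have "restrict_vec J (X \<sigma> 0 - x 0) = X \<sigma> 0 - x 0"
        using I by (auto simp: restrict_vec_def complements vec_eq_iff)
      then have "m * norm (X \<sigma> 0 - x 0) \<le> c * \<bar>\<sigma> - s\<bar>"
        using mM(3)[of "X \<sigma> 0 - x 0"] c by simp
      then show "norm (X \<sigma> 0 - x 0) \<le> c / m * \<bar>\<sigma> - s\<bar>"
        using mM(1) by (simp add: field_simps)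
      \<comment> \<open>Complementary supports: \<open>q\<close> vanishes outside \<open>I\<close>,
        the initial deviation on \<open>I\<close>.\<close>
      have "q $ i * (X \<sigma> 0 - x 0) $ i = 0" for i
        using I[of i] p0[of i] by (cases "i \<in> I") (auto simp: p_def \<Psi>_0)
      then show "q \<bullet> (X \<sigma> 0 - x 0) = 0" by (simp only: inner_vec_def inner_real_def sum.neutral_const)
      have "C' (X \<sigma> T - x T) = d \<bullet> (X \<sigma> T - x T)"
        unfolding d_def by (rule linear_functional_eq_inner[OF has_derivative_linear[OF C']])
      \<comment> \<open>\<open>d\<close> and \<open>p T\<close> agree on \<open>F\<close>, and the
        terminal deviation vanishes on the complement \<open>E\<close>.\<close>
      also have "\<dots> = p T \<bullet> (X \<sigma> T - x T)"
        unfolding inner_vec_def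
      proof (rule sum.cong[OF refl])
        fix i show "d $ i \<bullet> (X \<sigma> T - x T) $ i = p T $ i \<bullet> (X \<sigma> T - x T) $ i"
          using E[of i] pT[of i] by (cases "i \<in> E") (auto simp: complements)
      qed
      finally show "C' (X \<sigma> T - x T) = (\<Psi> T *v q) \<bullet> (X \<sigma> T - x T)" by (simp add: p_def)
    qed
    from objective_derivative[OF C' X'] show ?thesis
      by (simp add: hamiltonian_def gap_def p_def inner_diff_right)
  qed
  moreover have "\<exists>c. \<forall>\<^sub>F \<sigma> in nhds s. \<exists>y. bvp_solution T (switched F\<^sub>0 F\<^sub>1 \<sigma>) I E b\<^sub>I b\<^sub>E y \<and>
      N (restrict_vec J (y 0 - x 0)) \<le> c * \<bar>\<sigma> - s\<bar>"
  proof -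
    interpret bm: bounded_bilinear "(*v) :: real^'n^'n \<Rightarrow> real^'n \<Rightarrow> real^'n"
      by (rule bounded_bilinear_matrix_vector_mult)
    \<comment> \<open>Chosen so that the components in \<open>E\<close> of
      \<open>\<Phi> T *v (Q *v v + v)\<close> cancel, as \<open>\<Phi> T\<close> undoes
      \<open>G\<close> there; the range of \<open>G\<close> is supported in \<open>J\<close>, so the
      initial data on \<open>I\<close> stay untouched.\<close>
    define Q where "Q = - (G ** \<Phi> T)"
    have Q: "Q *v v = - (G *v (\<Phi> T *v v))" for v
      by (simp add: Q_def bm.minus_left matrix_vector_mul_assoc)
    obtain \<eta> c where "0 < \<eta>" and ex: "\<And>\<sigma>. \<bar>\<sigma> - s\<bar> < \<eta> \<Longrightarrow> \<exists>y v. ac_solution T (switched F\<^sub>0 F\<^sub>1 \<sigma>) y \<and>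
        norm (y 0 - x 0) \<le> c * \<bar>\<sigma> - s\<bar> \<and> y 0 - x 0 = Q *v v \<and> y T - x T = \<Phi> T *v (Q *v v + v)"
      by (rule perturbed_solution_exists[of Q]) blast
    have "\<exists>y. bvp_solution T (switched F\<^sub>0 F\<^sub>1 \<sigma>) I E b\<^sub>I b\<^sub>E y \<and>
        N (restrict_vec J (y 0 - x 0)) \<le> M * c * \<bar>\<sigma> - s\<bar>" if \<sigma>: "\<bar>\<sigma> - s\<bar> < \<eta>" for \<sigma>
    proof -
      obtain y v where y: "ac_solution T (switched F\<^sub>0 F\<^sub>1 \<sigma>) y" "norm (y 0 - x 0) \<le> c * \<bar>\<sigma> - s\<bar>"
        "y 0 - x 0 = Q *v v" "y T - x T = \<Phi> T *v (Q *v v + v)"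
        using ex[OF \<sigma>] by blast
      have "(y 0 - x 0) $ i = 0" if "i \<in> I" for i
        using that G(2)[of i] by (simp only: y(3) Q complements) simp
      moreover have "(y T - x T) $ i = 0" if "i \<in> E" for i
        using G(1)[OF that, of "\<Phi> T *v v"] by (simp only: y(4) Q bm.add_right bm.minus_right) simp
      ultimately have "bvp_solution T (switched F\<^sub>0 F\<^sub>1 \<sigma>) I E b\<^sub>I b\<^sub>E y"
        using y(1) xI xE by (simp add: bvp_solution_def)
      moreover have "N (restrict_vec J (y 0 - x 0)) \<le> M * (c * \<bar>\<sigma> - s\<bar>)"
        using mM(2) y(2) norm_restrict_vec_le[of J "y 0 - x 0"]
        by (intro order_trans[OF mM(4)] mult_left_mono) auto
      ultimately show ?thesis by (auto simp: mult.assoc)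
    qed
    with \<open>0 < \<eta>\<close> show ?thesis
      unfolding eventually_nhds_metric dist_real_def by blast
  qed
  ultimately show ?thesis by blast
qed

end
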